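(* Let $\mu\subset\lambda$ be partitions and let $r\ge1$ be an integer with $r\ge\ell(\lambda)$ (set $\lambda_i=0$ for $i>\ell(\lambda)$, $\mu_j=0$ for $j>\ell(\mu)$). Then $$G_{\lambda/\mu}(x)=\det\left(\sum_{n=0}^\infty\binom{i-j}{n}\beta^n\,G_{\lambda_i-\mu_j-i+j+n}(x)\right)_{1\le i,j\le r}.$$
   Context: $k=\mathbb{C}(\beta)$; $\Lambda$ is the $k$-algebra of symmetric functions in $x=(x_1,x_2,\dots)$, with Schur functions $s_\lambda$ and Hall inner product $\langle s_\lambda,s_\mu\rangle=\delta_{\lambda,\mu}$. $I_n=\mathrm{span}_k\{s_\lambda:\ell(\lambda)>n\}$ and $\widehat\Lambda=\varprojlim\Lambda/I_n$; elements of $\widehat\Lambda$ are formal sums $\sum c_\lambda s_\lambda$ such that for every $n$ only finitely many $\lambda$ with $\ell(\lambda)\le n$ have $c_\lambda\neq0$. The Hall product extends to $\widehat\Lambda\times\Lambda\to k$. For $f\in\Lambda$, $f^\perp:\widehat\Lambda\to\widehat\Lambda$ is defined by $\langle f^\perp g,h\rangle=\langle g,fh\rangle$ for all $h\in\Lambda$. The stable Grothendieck polynomial $G_\lambda(x)\in\widehat\Lambda$ is the unique element such that for all $n\ge\ell(\lambda)$, $G_\lambda(x_1,\dots,x_n,0,0,\dots)=\det\bigl(x_i^{\lambda_j+n-j}(1+\beta x_i)^{j-1}\bigr)_{1\le i,j\le n}/\prod_{1\le i<j\le n}(x_i-x_j)$. The dual stable Grothendieck polynomials $g_\mu\in\Lambda$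 are determined by $\langle G_\lambda,g_\mu\rangle=\delta_{\lambda,\mu}$. Put $G_{\lambda/\!\!/\mu}=g_\mu^\perp G_\lambda$. A rook strip is a skew diagram with at most one box in any row or column. The skew stable Grothendieck polynomials $G_{\lambda/\mu}(x)\in\widehat\Lambda$ ($\mu\subset\lambda$) are the unique elements satisfying $G_{\lambda/\!\!/\mu}(x)=\sum_{\sigma:\ \mu/\sigma\text{ rook strip}}\beta^{|\mu/\sigma|}G_{\lambda/\sigma}(x)$ for all $\mu\subset\lambda$ (the sum includes $\sigma=\mu$). For $m\in\mathbb Z$, $G_m(x)$ is the coefficient of $z^m$ in $\frac{1}{1+\beta z^{-1}}\prod_{l\ge1}\frac{1+\beta x_l}{1-x_lz}$, with $\frac1{1+\beta z^{-1}}$ expanded in powers of $z^{-1}$; thus $G_m=G_{(m)}$ for $m\ge1$ and $G_m=(-\beta)^{-m}$ for $m\le0$. Binomials: $\binom{a}{n}=a(a-1)\cdots(a-n+1)/n!$ for $a\in\mathbb Z,\ n\ge0$. The infinite sums converge as formal power series in $x_1,x_2,\dots$ (for $m\ge1$, $G_m$ has no terms of degree less than $m$). *)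

theory Defs
  imports
    "HOL-Library.Poly_Mapping"
    "HOL-Library.Groups_Big_Fun"
    "HOL-Computational_Algebra.Fraction_Field"
    "HOL-Computational_Algebra.Formal_Power_Series"
    "Jordan_Normal_Form.Determinant"
begin

section \<open>The ground field\<close>

instance fract :: ("{idom, ring_char_0}") field_char_0
proof
  have "(of_nat n :: 'a fract) = Fract (of_nat n) 1" for n
    by (induction n) (simp_all add: Zero_fract_def One_fract_def)
  then show "inj (of_nat :: nat \<Rightarrow> 'a fract)"
    by (simp add: inj_def eq_fract)
qed

type_synonym ratfun = "complex poly fract"

definition beta :: ratfun where
  "beta = Fract [:0, 1:] 1"


section \<open>Formal power series in countably many variables\<close>

text \<open>Monomials are exponent functions of finite support; the variable written \<open>x\<^sub>l\<close> in
  mathematical notation is \<open>mvar (l - 1)\<close>, since all indices below start at \<open>0\<close>.\<close>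

type_synonym monom = "nat \<Rightarrow>\<^sub>0 nat"

typedef 'a mfps = "UNIV :: (monom \<Rightarrow> 'a) set"
  morphisms mcoeff Abs_mfps ..

lemma mcoeff_Abs [simp]: "mcoeff (Abs_mfps f) = f"
  by (simp add: Abs_mfps_inverse)

lemma mfps_eqI: "(\<And>a. mcoeff f a = mcoeff g a) \<Longrightarrow> f = g"
  by (metis ext mcoeff_inject)

definition splits :: "monom \<Rightarrow> (monom \<times> monom) set" where
  "splits a = {(b, c). b + c = a}"

lemma splits_iff [simp]: "(b, c) \<in> splits a \<longleftrightarrow> b + c = a"
  by (simp add: splits_def)

lemma finite_splits [simp]: "finite (splits a)"
proof -
  let ?K = "Poly_Mapping.keys a"
  let ?B = "{b. \<exists>c. b + c = a}"
  let ?r = "\<lambda>b. restrict (Poly_Mapping.lookup b) ?K"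
  have le: "Poly_Mapping.lookup b i \<le> Poly_Mapping.lookup a i" if "b \<in> ?B" for b i
    using that by (auto simp: lookup_add)
  have out: "Poly_Mapping.lookup b i = 0" if "b \<in> ?B" "i \<notin> ?K" for b i
    using le[OF that(1), of i] that(2) by (simp add: in_keys_iff)
  have inj: "inj_on ?r ?B"
  proof (rule inj_onI)
    fix b b' assume b: "b \<in> ?B" and b': "b' \<in> ?B" and eq: "?r b = ?r b'"
    show "b = b'"
    proof (rule poly_mapping_eqI)
      fix i show "Poly_Mapping.lookup b i = Poly_Mapping.lookup b' i"
        using fun_cong[OF eq, of i] out[OF b, of i] out[OF b', of i]
        by (cases "i \<in> ?K") (auto simp: restrict_def)
    qed
  qed
  have "?r ` ?B \<subseteq> PiE ?K (\<lambda>i. {..Poly_Mapping.lookup a i})"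
    using le by (auto simp: PiE_def Pi_def extensional_def)
  moreover have "finite (PiE ?K (\<lambda>i. {..Poly_Mapping.lookup a i}))"
    by (rule finite_PiE) auto
  ultimately have "finite ?B"
    using inj finite_imageD finite_subset by blast
  moreover have "splits a \<subseteq> ?B \<times> ?B"
    by (auto simp: splits_def) (metis add.commute)
  ultimately show ?thesis
    by (meson finite_SigmaI finite_subset)
qed

instantiation mfps :: (comm_ring_1) comm_ring_1
begin

definition zero_mfps :: "'a mfps" where
  "zero_mfps = Abs_mfps (\<lambda>a. 0)"

definition one_mfps :: "'a mfps" where
  "one_mfps = Abs_mfps (\<lambda>a. if a = 0 then 1 else 0)"

definition plus_mfps :: "'a mfps \<Rightarrow> 'a mfps \<Rightarrow> 'a mfps" where
  "plus_mfps f g = Abs_mfps (\<lambda>a. mcoeff f a + mcoeff g a)"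

definition uminus_mfps :: "'a mfps \<Rightarrow> 'a mfps" where
  "uminus_mfps f = Abs_mfps (\<lambda>a. - mcoeff f a)"

definition minus_mfps :: "'a mfps \<Rightarrow> 'a mfps \<Rightarrow> 'a mfps" where
  "minus_mfps f g = Abs_mfps (\<lambda>a. mcoeff f a - mcoeff g a)"

definition times_mfps :: "'a mfps \<Rightarrow> 'a mfps \<Rightarrow> 'a mfps" where
  "times_mfps f g = Abs_mfps (\<lambda>a. \<Sum>(b, c)\<in>splits a. mcoeff f b * mcoeff g c)"

lemma mcoeff_times: "mcoeff (f * g) a = (\<Sum>(b, c)\<in>splits a. mcoeff f b * mcoeff g c)"
  by (simp add: times_mfps_def)

instance
proof
  fix f g h :: "'a mfps"
  show "f + g + h = f + (g + h)" "f + g = g + f" "0 + f = f" "- f + f = 0" "f - g = f + - g"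
    by (simp_all add: plus_mfps_def zero_mfps_def uminus_mfps_def minus_mfps_def
        mcoeff_inverse algebra_simps)
  show "f * g * h = f * (g * h)"
  proof (rule mfps_eqI)
    fix a
    have "mcoeff (f * g * h) a =
        (\<Sum>(p, q)\<in>(SIGMA p:splits a. splits (fst p)).
          mcoeff f (fst q) * mcoeff g (snd q) * mcoeff h (snd p))"
      by (subst sum.Sigma[symmetric])
        (auto simp: mcoeff_times sum_distrib_right case_prod_beta)
    also have "\<dots> = (\<Sum>(p, q)\<in>(SIGMA p:splits a. splits (snd p)).
          mcoeff f (fst p) * (mcoeff g (fst q) * mcoeff h (snd q)))"
      by (rule sum.reindex_bij_witness
          [where i = "\<lambda>((b, _), (c, d)). ((b + c, d), (b, c))"
             and j = "\<lambda>((_, d), (b, c)). ((b, c + d), (c, d))"])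
        (auto simp: add.assoc mult.assoc)
    also have "\<dots> = mcoeff (f * (g * h)) a"
      by (subst sum.Sigma[symmetric])
        (auto simp: mcoeff_times sum_distrib_left case_prod_beta)
    finally show "mcoeff (f * g * h) a = mcoeff (f * (g * h)) a" .
  qed
  show "f * g = g * f"
  proof (rule mfps_eqI)
    fix a
    show "mcoeff (f * g) a = mcoeff (g * f) a"
      unfolding mcoeff_times
      by (rule sum.reindex_bij_witness[where i = "\<lambda>(b, c). (c, b)" and j = "\<lambda>(b, c). (c, b)"])
        (auto simp: add.commute mult.commute)
  qed
  show "1 * f = f"
  proof (rule mfps_eqI)
    fix a
    have "mcoeff (1 * f) a = (\<Sum>(b, c)\<in>splits a. (if b = 0 then 1 else 0) * mcoeff f c)"
      by (simp add: mcoeff_times one_mfps_def)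
    also have "\<dots> = (\<Sum>(b, c)\<in>{(0 :: monom, a)}. (if b = 0 then 1 else 0) * mcoeff f c)"
      by (rule sum.mono_neutral_right) (auto split: if_splits)
    finally show "mcoeff (1 * f) a = mcoeff f a" by simp
  qed
  show "(f + g) * h = f * h + g * h"
    by (rule mfps_eqI)
      (simp add: mcoeff_times plus_mfps_def case_prod_beta distrib_right sum.distrib)
  show "(0 :: 'a mfps) \<noteq> 1"
  proof
    assume "(0 :: 'a mfps) = 1"
    then have "mcoeff (0 :: 'a mfps) 0 = mcoeff 1 0" by simp
    then show False by (simp add: zero_mfps_def one_mfps_def)
  qed
qed

end

definition mconst :: "'a::comm_ring_1 \<Rightarrow> 'a mfps" where
  "mconst c = Abs_mfps (\<lambda>a. if a = 0 then c else 0)"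

definition mvar :: "nat \<Rightarrow> 'a::comm_ring_1 mfps" where
  "mvar i = Abs_mfps (\<lambda>a. if a = Poly_Mapping.single i 1 then 1 else 0)"

definition mdegree :: "monom \<Rightarrow> nat" where
  "mdegree a = (\<Sum>i\<in>Poly_Mapping.keys a. Poly_Mapping.lookup a i)"

text \<open>The substitution \<open>F(x\<^sub>1, \<dots>, x\<^sub>n, 0, 0, \<dots>)\<close>.\<close>

definition mtrunc :: "nat \<Rightarrow> 'a::comm_ring_1 mfps \<Rightarrow> 'a mfps" where
  "mtrunc n F = Abs_mfps (\<lambda>a. if Poly_Mapping.keys a \<subseteq> {..<n} then mcoeff F a else 0)"

text \<open>Convergence of formal power series: each coefficient is eventually constant. Infinite
  sums and products are limits in this sense.\<close>

definition formal_tendsto :: "(nat \<Rightarrow> 'a mfps) \<Rightarrow> 'a mfps \<Rightarrow> bool" where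
  "formal_tendsto f F \<longleftrightarrow> (\<forall>a. \<forall>\<^sub>F N in sequentially. mcoeff (f N) a = mcoeff F a)"

definition formal_lim :: "(nat \<Rightarrow> 'a mfps) \<Rightarrow> 'a mfps" where
  "formal_lim f = (THE F. formal_tendsto f F)"

definition formal_suminf :: "(nat \<Rightarrow> 'a::comm_ring_1 mfps) \<Rightarrow> 'a mfps" where
  "formal_suminf f = formal_lim (\<lambda>N. \<Sum>n<N. f n)"


section \<open>Partitions\<close>

text \<open>A partition is a weakly decreasing sequence that is eventually \<open>0\<close>; thus
  \<open>part lam i\<close> is \<open>\<lambda>\<^sub>i\<^sub>+\<^sub>1\<close>, and \<open>0\<close> beyond the length.\<close>

typedef partition = "{p :: nat \<Rightarrow> nat. antimono p \<and> finite {i. p i \<noteq> 0}}"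
  morphisms part Abs_partition
  by (rule exI[of _ "\<lambda>_. 0"]) (simp add: monotone_def)

definition plength :: "partition \<Rightarrow> nat" where
  "plength lam = card {i. part lam i \<noteq> 0}"

definition part_subset :: "partition \<Rightarrow> partition \<Rightarrow> bool" where
  "part_subset mu lam \<longleftrightarrow> (\<forall>i. part mu i \<le> part lam i)"

definition skew_diagram :: "partition \<Rightarrow> partition \<Rightarrow> (nat \<times> nat) set" where
  "skew_diagram lam mu = {(i, j). part mu i \<le> j \<and> j < part lam i}"

definition rook_strip :: "partition \<Rightarrow> partition \<Rightarrow> bool" where
  "rook_strip mu sigma \<longleftrightarrow> part_subset sigma mu \<and>
     (\<forall>p\<in>skew_diagram mu sigma. \<forall>q\<in>skew_diagram mu sigma.
        fst p = fst q \<or> snd p = snd q \<longrightarrow> p = q)"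


section \<open>Symmetric functions and their completion\<close>

definition symmetric :: "'a mfps \<Rightarrow> bool" where
  "symmetric F \<longleftrightarrow>
     (\<forall>\<pi> a. bij \<pi> \<longrightarrow> mcoeff F (Poly_Mapping.map_key \<pi> a) = mcoeff F a)"

definition Lambda :: "ratfun mfps set" where
  "Lambda = {F. symmetric F \<and> (\<exists>d. \<forall>a. mcoeff F a \<noteq> 0 \<longrightarrow> mdegree a \<le> d)}"

definition vandermonde :: "nat \<Rightarrow> ratfun mfps" where
  "vandermonde n = (\<Prod>(i, j)\<in>{(i, j). i < j \<and> j < n}. mvar i - mvar j)"

text \<open>Schur functions by the bialternant formula, cleared of its denominator.\<close>

definition schur :: "partition \<Rightarrow> ratfun mfps" where
  "schur lam = (THE F. F \<in> Lambda \<and> (\<forall>n\<ge>plength lam.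
     mtrunc n F * vandermonde n =
       det (mat n n (\<lambda>(i, j). mvar i ^ (part lam j + (n - 1 - j))))))"

text \<open>The formal sum of the \<open>c\<^sub>\<lambda> s\<^sub>\<lambda>\<close>, identified with the power series it represents; as
  \<open>s\<^sub>\<lambda>\<close> is homogeneous of degree \<open>|\<lambda>|\<close>, the sum in each coefficient has only finitely many
  nonzero terms.\<close>

definition schur_sum :: "(partition \<Rightarrow> ratfun) \<Rightarrow> ratfun mfps" where
  "schur_sum c = Abs_mfps (\<lambda>a. Sum_any (\<lambda>lam. c lam * mcoeff (schur lam) a))"

definition admissible :: "(partition \<Rightarrow> ratfun) \<Rightarrow> bool" where
  "admissible c \<longleftrightarrow> (\<forall>n. finite {lam. plength lam \<le> n \<and> c lam \<noteq> 0})"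

definition Lambda_hat :: "ratfun mfps set" where
  "Lambda_hat = schur_sum ` {c. admissible c}"

definition schur_coeff :: "ratfun mfps \<Rightarrow> partition \<Rightarrow> ratfun" where
  "schur_coeff F = (THE c. admissible c \<and> F = schur_sum c)"

text \<open>The Hall product on \<open>Lambda_hat \<times> Lambda\<close>; elements of \<open>Lambda\<close> have finite Schur
  expansions.\<close>

definition hall :: "ratfun mfps \<Rightarrow> ratfun mfps \<Rightarrow> ratfun" where
  "hall F h = Sum_any (\<lambda>lam. schur_coeff F lam * schur_coeff h lam)"

definition perp :: "ratfun mfps \<Rightarrow> ratfun mfps \<Rightarrow> ratfun mfps" where
  "perp f F = (THE H. H \<in> Lambda_hat \<and> (\<forall>h\<in>Lambda. hall H h = hall F (f * h)))"


section \<open>Stable Grothendieck polynomials\<close>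

definition groth :: "partition \<Rightarrow> ratfun mfps" where
  "groth lam = (THE F. F \<in> Lambda_hat \<and> (\<forall>n\<ge>plength lam.
     mtrunc n F * vandermonde n =
       det (mat n n (\<lambda>(i, j).
         mvar i ^ (part lam j + (n - 1 - j)) * (1 + mconst beta * mvar i) ^ j))))"

definition dual_groth :: "partition \<Rightarrow> ratfun mfps" where
  "dual_groth mu = (THE g. g \<in> Lambda \<and>
     (\<forall>lam. hall (groth lam) g = (if lam = mu then 1 else 0)))"

text \<open>\<open>G\<^bsub>\<lambda>//\<mu>\<^esub>\<close>, as opposed to \<open>G\<^bsub>\<lambda>/\<mu>\<^esub>\<close> below\<close>

definition groth_dslash :: "partition \<Rightarrow> partition \<Rightarrow> ratfun mfps" where
  "groth_dslash lam mu = perp (dual_groth mu) (groth lam)"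

text \<open>The family is only characterised for \<open>\<mu> \<subseteq> \<lambda>\<close>; it is set to \<open>0\<close> for the other pairs so
  that the definite description denotes.\<close>

definition skew_groth :: "partition \<Rightarrow> partition \<Rightarrow> ratfun mfps" where
  "skew_groth = (THE H. \<forall>lam mu.
     if part_subset mu lam
     then H lam mu \<in> Lambda_hat \<and>
       groth_dslash lam mu =
         (\<Sum>sigma\<in>{sigma. rook_strip mu sigma}.
            mconst (beta ^ card (skew_diagram mu sigma)) * H lam sigma)
     else H lam mu = 0)"

text \<open>The coefficient of \<open>z\<^sup>a\<close> in \<open>\<Prod>\<^sub>l (1 + \<beta> x\<^sub>l) / (1 - x\<^sub>l z)\<close>, where
  \<open>1 / (1 - x\<^sub>l z)\<close> is expanded as a geometric series.\<close>

definition gen_product_coeff :: "nat \<Rightarrow> ratfun mfps" where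
  "gen_product_coeff a = formal_lim (\<lambda>N. fps_nth
     (\<Prod>l<N. fps_const (1 + mconst beta * mvar l) * Abs_fps (\<lambda>k. mvar l ^ k)) a)"

text \<open>The coefficient of \<open>z\<^sup>m\<close> after multiplication by
  \<open>1 / (1 + \<beta> z\<^sup>-\<^sup>1) = \<Sum>\<^sub>b (-\<beta>)\<^sup>b z\<^sup>-\<^sup>b\<close>.\<close>

definition groth_row :: "int \<Rightarrow> ratfun mfps" where
  "groth_row m = formal_suminf (\<lambda>b.
     if 0 \<le> m + int b then mconst ((- beta) ^ b) * gen_product_coeff (nat (m + int b)) else 0)"

end

theory Submission
  imports Defs
begin

text \<open>
  Write \<open>u = 1 + \<beta>/w\<close> and \<open>A(w) = \<Prod>\<^sub>l (1 + \<beta> x\<^sub>l) / (1 - x\<^sub>l w)\<close>. The coefficients of \<open>A(w)\<close> in the \<open>x\<close>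
  are polynomials in \<open>w\<close>, and the entries of the determinant are \<open>[w\<^sup>m] u\<^sup>e A(w)\<close> with
  \<open>m = \<lambda>\<^sub>i - \<mu>\<^sub>j - i + j\<close> and \<open>e = i - j - 1\<close>, that is, \<open>\<phi>\<^sub>i(A d\<^sub>j)\<close> for linear functionals \<open>\<phi>\<^sub>i\<close> depending on \<open>\<lambda>\<close> and
  polynomials \<open>d\<^sub>j\<close> depending on \<open>\<mu>\<close>. For \<open>\<mu> = \<emptyset>\<close> this determinant is \<open>G\<^sub>\<lambda>\<close>, by comparison with the
  bialternant formula in \<open>r\<close> variables; for \<open>\<beta> = 0\<close> it is the Jacobi--Trudi formula.

  A modification \<open>k\<^sub>j\<close> of the columns \<open>d\<^sub>j\<close> is dual to the rows, \<open>det \<phi>\<^sup>\<lambda>\<^sub>i(k\<^sup>\<mu>\<^sub>j) = \<delta>\<^sub>\<lambda>\<^sub>\<mu>\<close>, and since \<open>A\<close> is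
  multiplicative in the set of variables, inserting the resulting resolution of the identity gives
  \<open>G\<^sub>\<lambda>(x, y) = \<Sum>\<^sub>\<mu> G\<^sub>\<mu>(x) K\<^sub>\<lambda>\<^sub>\<mu>(y)\<close> with \<open>K\<^sub>\<lambda>\<^sub>\<mu> = det \<phi>\<^sup>\<lambda>\<^sub>i(A k\<^sup>\<mu>\<^sub>j)\<close>. As \<open>\<langle>F, h\<^sub>c\<rangle>\<close> is the coefficient of \<open>x\<^sup>c\<close>
  in \<open>F\<close>, this identifies \<open>G\<^bsub>\<lambda>//\<mu>\<^esub>\<close> with \<open>K\<^sub>\<lambda>\<^sub>\<mu>\<close>. Finally column operations and multilinearity expand \<open>K\<^sub>\<lambda>\<^sub>\<mu>\<close>
  over the sets of corners of \<open>\<mu>\<close>, which are the rook strips, and the triangular system defining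
  \<open>G\<^bsub>\<lambda>/\<mu>\<^esub>\<close> has a unique solution.
\<close>


section \<open>Determinants of functions of two indices\<close>

text \<open>The engine is the identity \<open>w + \<beta> = w u\<close>. Multiplication by
  \<open>w\<close> lowers the index \<open>m\<close>; multiplication by \<open>w + \<beta>\<close>
  lowers \<open>m\<close> and raises the exponent \<open>e\<close>. So a whole row of the
  determinant comes from one functional applied to different polynomials, and determinants become
  alternating forms in their columns. The plain column \<open>w^(mu_j) (w + \<beta>)^(r-1-j)\<close>
  is not dual to the rows: on the diagonal its exponent is \<open>-1\<close>, the expansion in
  \<open>1/w\<close> does not stop, and the entry need not vanish when
  \<open>mu_j > lambda_i\<close>. Trading one factor \<open>w\<close> for \<open>w + \<beta>\<close>
  makes the exponent nonnegative there, without changing degrees; undoing this trade is what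
  produces the rook strips. The other obstacle is size. Entries can be infinite series even in one
  variable, while membership in the completion needs polynomials in each finite set of variables.
  This comes from the bialternant formula for the straight shapes, passes to the double-slash
  functions through the Hall product, and from these to the skew determinants through the triangular
  system.\<close>

definition fdet :: "nat \<Rightarrow> (nat \<Rightarrow> nat \<Rightarrow> 'a::comm_ring_1) \<Rightarrow> 'a" where
  "fdet n f = det (mat n n (\<lambda>(i, j). f i j))"

lemma fdet_leibniz:
  "fdet n f = (\<Sum>p | p permutes {..<n}. of_int (sign p) * (\<Prod>i<n. f i (p i)))"
proof -
  have *: "mat n n (\<lambda>(i, j). f i j) $$ (i, p i) = f i (p i)" if "p permutes {..<n}" "i < n" for p i
    using that permutes_in_image[of p "{..<n}" i] by simp
  have "fdet n f = (\<Sum>p | p permutes {..<n}.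
      of_int (sign p) * (\<Prod>i<n. mat n n (\<lambda>(i, j). f i j) $$ (i, p i)))"
    unfolding fdet_def using det_def'[of "mat n n (\<lambda>(i, j). f i j)" n]
    by (simp only: mat_carrier atLeast0LessThan)
  also have "\<dots> = (\<Sum>p | p permutes {..<n}. of_int (sign p) * (\<Prod>i<n. f i (p i)))"
  proof (rule sum.cong)
    fix p assume "p \<in> {p. p permutes {..<n}}"
    then have "(\<Prod>i<n. mat n n (\<lambda>(i, j). f i j) $$ (i, p i)) = (\<Prod>i<n. f i (p i))"
      by (intro prod.cong refl *) auto
    then show "of_int (sign p) * (\<Prod>i<n. mat n n (\<lambda>(i, j). f i j) $$ (i, p i))
      = of_int (sign p) * (\<Prod>i<n. f i (p i))" by (simp only:)
  qed simp
  finally show ?thesis .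
qed

lemma fdet_cong: "(\<And>i j. i < n \<Longrightarrow> j < n \<Longrightarrow> f i j = g i j) \<Longrightarrow> fdet n f = fdet n g"
  unfolding fdet_def by (rule arg_cong[of _ _ det]) auto

lemma fdet_transpose: "fdet n (\<lambda>i j. f j i) = fdet n f"
proof -
  have "mat n n (\<lambda>(i, j). f j i) = transpose_mat (mat n n (\<lambda>(i, j). f i j))" by auto
  then show ?thesis
    unfolding fdet_def using det_transpose[of "mat n n (\<lambda>(i, j). f i j)" n] by (simp only: mat_carrier)
qed

lemma fdet_permute_rows:
  assumes "p permutes {..<n}"
  shows "fdet n (\<lambda>i. f (p i)) = of_int (sign p) * fdet n f"
proof -
  let ?A = "mat n n (\<lambda>(i, j). f i j)"
  have "mat n n (\<lambda>(i, j). f (p i) j) = mat n n (\<lambda>(i, j). ?A $$ (p i, j))"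
    using permutes_in_image[OF assms] by (intro eq_matI) simp_all
  moreover have "det (mat n n (\<lambda>(i, j). ?A $$ (p i, j))) = of_int (sign p) * det ?A"
    by (rule det_permute_rows) (use assms in \<open>simp_all add: atLeast0LessThan\<close>)
  ultimately show ?thesis unfolding fdet_def by (simp only:)
qed

lemma fdet_row_linear:
  assumes "k < n"
  shows "fdet n (f(k := \<lambda>j. a j + c * b j)) = fdet n (f(k := a)) + c * fdet n (f(k := b))"
proof -
  have *: "(\<Prod>i<n. (f(k := g)) i (p i)) = g (p k) * (\<Prod>i\<in>{..<n} - {k}. f i (p i))"
    for g p using assms by (subst prod.remove[of _ k]) (auto intro!: prod.cong)
  show ?thesis unfolding fdet_leibniz *
    by (simp add: algebra_simps sum.distrib sum_distrib_left)
qed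

lemma fdet_row_zero:
  assumes "k < n" "\<And>j. j < n \<Longrightarrow> f k j = 0"
  shows "fdet n f = 0"
  unfolding fdet_leibniz
proof (rule sum.neutral, clarify)
  fix p assume "p permutes {..<n}"
  then have "f k (p k) = 0" using assms permutes_in_image[of p "{..<n}" k] by simp
  then have "(\<Prod>i<n. f i (p i)) = 0" using assms(1) by (intro prod_zero) auto
  then show "of_int (sign p) * (\<Prod>i<n. f i (p i)) = 0" by simp
qed

lemma fdet_equal_rows:
  assumes "k < n" "l < n" "k \<noteq> l" "\<And>j. j < n \<Longrightarrow> f k j = f l j"
  shows "fdet n f = 0"
  unfolding fdet_def
  by (rule det_identical_rows[of _ n k l]) (use assms in \<open>auto intro!: eq_vecI\<close>)

lemma fdet_scale_rows: "fdet n (\<lambda>i j. c i * f i j) = (\<Prod>i<n. c i) * fdet n f"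
  unfolding fdet_leibniz by (simp add: prod.distrib sum_distrib_left mult_ac)

text \<open>A permutation with a nonzero term would send the \<open>n - k\<close> rows from
  \<open>k\<close> on injectively into the \<open>n - k - 1\<close> columns after \<open>k\<close>.
  As partitions are sorted, a single row where containment fails produces such a block.\<close>

lemma fdet_block_zero:
  assumes "k < n" and "\<And>i j. k \<le> i \<Longrightarrow> i < n \<Longrightarrow> j \<le> k \<Longrightarrow> f i j = 0"
  shows "fdet n f = 0"
  unfolding fdet_leibniz
proof (rule sum.neutral, clarify)
  fix p assume p: "p permutes {..<n}"
  have "\<exists>i\<in>{k..<n}. p i \<le> k"
  proof (rule ccontr)
    assume "\<not> ?thesis"
    then have "p ` {k..<n} \<subseteq> {Suc k..<n}"
      using permutes_in_image[OF p] by (auto simp: not_le)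
    then have "card {k..<n} \<le> card {Suc k..<n}"
      using p by (intro card_inj_on_le[of p]) (auto simp: permutes_inj_on)
    then show False using assms(1) by simp
  qed
  then obtain i where "i \<in> {k..<n}" "p i \<le> k" by blast
  then have "(\<Prod>i<n. f i (p i)) = 0"
    using assms by (intro prod_zero) auto
  then show "of_int (sign p) * (\<Prod>i<n. f i (p i)) = 0" by simp
qed

lemma fdet_lower_triangular:
  assumes "\<And>i j. i < j \<Longrightarrow> j < n \<Longrightarrow> f i j = 0"
  shows "fdet n f = (\<Prod>i<n. f i i)"
  unfolding fdet_def
  by (subst det_lower_triangular[of n])
    (use assms in \<open>auto simp: prod_list_diag_prod atLeast0LessThan\<close>)

lemma fdet_upper_triangular:
  assumes "\<And>i j. j < i \<Longrightarrow> i < n \<Longrightarrow> f i j = 0"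
  shows "fdet n f = (\<Prod>i<n. f i i)"
  using fdet_lower_triangular[of n "\<lambda>i j. f j i"] assms by (simp add: fdet_transpose[of n f])

lemma fdet_mult: "fdet n (\<lambda>i j. \<Sum>k<n. f i k * g k j) = fdet n f * fdet n g"
proof -
  have "mat n n (\<lambda>(i, j). \<Sum>k<n. f i k * g k j) = mat n n (\<lambda>(i, j). f i j) * mat n n (\<lambda>(i, j). g i j)"
    by (rule eq_matI) (auto simp: scalar_prod_def atLeast0LessThan)
  then show ?thesis unfolding fdet_def by (simp add: det_mult[of _ n])
qed

text \<open>Laplace expansion along the last row. It makes the determinants stable under enlarging
  \<open>r\<close>.\<close>

lemma fdet_unit_last_row:
  assumes "\<And>j. j < n \<Longrightarrow> f n j = 0" "f n n = 1"
  shows "fdet (Suc n) f = fdet n f"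
proof -
  let ?A = "mat (Suc n) (Suc n) (\<lambda>(i, j). f i j)"
  have "mat_delete ?A n n = mat n n (\<lambda>(i, j). f i j)"
    by (rule eq_matI) (auto simp: mat_delete_def)
  then have "cofactor ?A n n = fdet n f"
    by (simp add: cofactor_def fdet_def)
  moreover have "fdet (Suc n) f = (\<Sum>j<Suc n. ?A $$ (n, j) * cofactor ?A n j)"
    unfolding fdet_def by (rule laplace_expansion_row[of _ "Suc n"]) auto
  moreover have "(\<Sum>j<Suc n. ?A $$ (n, j) * cofactor ?A n j) = (\<Sum>j<Suc n. if j = n then cofactor ?A n n else 0)"
    by (rule sum.cong) (use assms in auto)
  ultimately show ?thesis by simp
qed

lemma (in comm_ring_hom) hom_fdet: "hom (fdet n f) = fdet n (\<lambda>i j. hom (f i j))"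
proof -
  have "map_mat hom (mat n n (\<lambda>(i, j). f i j)) = mat n n (\<lambda>(i, j). hom (f i j))" by auto
  then show ?thesis unfolding fdet_def by (metis hom_det)
qed

text \<open>Right multiplication by a unipotent bidiagonal matrix: all columns change at once, and
  each receives the old next column rather than an already modified one.\<close>

lemma fdet_add_next_col:
  "fdet n (\<lambda>i j. f i j + (if Suc j < n then c j * f i (Suc j) else 0)) = fdet n f"
proof -
  define U where "U k j = (if k = j then 1 else if k = Suc j then c j else 0)" for k j
  have *: "f i j + (if Suc j < n then c j * f i (Suc j) else 0) = (\<Sum>k<n. f i k * U k j)"
    if "j < n" for i j
  proof -
    have "(\<Sum>k<n. f i k * U k j)
      = (\<Sum>k<n. (if k = j then f i j else 0) + (if k = Suc j then f i (Suc j) * c j else 0))"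
      by (rule sum.cong) (auto simp: U_def)
    then show ?thesis using that by (simp add: sum.distrib mult.commute)
  qed
  have "fdet n U = 1" by (subst fdet_lower_triangular) (auto simp: U_def)
  then show ?thesis using fdet_mult[of n f U] by (simp add: * cong: fdet_cong)
qed

section \<open>Vandermonde determinants\<close>

definition pairs_below :: "nat \<Rightarrow> (nat \<times> nat) set" where
  "pairs_below n = {(i, j). i < j \<and> j < n}"

lemma pairs_below_Suc: "pairs_below (Suc n) = pairs_below n \<union> (\<lambda>i. (i, n)) ` {..<n}"
  by (auto simp: pairs_below_def less_Suc_eq)

lemma finite_pairs_below [simp]: "finite (pairs_below n)"
proof -
  have "pairs_below n \<subseteq> {..<n} \<times> {..<n}" by (auto simp: pairs_below_def)
  then show ?thesis by (rule finite_subset) simp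
qed

lemma prod_pairs_below_Suc:
  "(\<Prod>(i, j)\<in>pairs_below (Suc n). g i j) = (\<Prod>(i, j)\<in>pairs_below n. g i j) * (\<Prod>i<n. g i n)"
proof -
  have "pairs_below n \<inter> (\<lambda>i. (i, n)) ` {..<n} = {}" by (auto simp: pairs_below_def)
  then show ?thesis
    unfolding pairs_below_Suc by (subst prod.union_disjoint) (auto simp: prod.reindex inj_on_def)
qed

lemma fdet_vandermonde:
  fixes x :: "nat \<Rightarrow> 'a::comm_ring_1"
  shows "fdet n (\<lambda>i j. x i ^ (n - 1 - j)) = (\<Prod>(i, j)\<in>pairs_below n. x i - x j)"
proof (induction n)
  case 0
  then show ?case by (simp add: fdet_leibniz pairs_below_def)
next
  case (Suc n)
  let ?f = "\<lambda>i j. x i ^ (n - j)"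
  let ?g = "\<lambda>i j. if j < n then (x i - x n) * x i ^ (n - 1 - j) else 1"
  \<comment> \<open>Subtracting \<open>x n\<close> times the next column leaves a unit last row and
    a factor \<open>x i - x n\<close> in the first \<open>n\<close> columns.\<close>
  have "fdet (Suc n) ?f = fdet (Suc n) (\<lambda>i j. ?f i j + (if Suc j < Suc n then - x n * ?f i (Suc j) else 0))"
    using fdet_add_next_col[of "Suc n" ?f "\<lambda>_. - x n"] by simp
  also have "\<dots> = fdet (Suc n) ?g"
  proof (rule fdet_cong)
    fix i j assume "i < Suc n" "j < Suc n"
    then show "?f i j + (if Suc j < Suc n then - x n * ?f i (Suc j) else 0) = ?g i j"
    proof (cases "j < n")
      case True
      then have "n - j = Suc (n - 1 - j)" by simp
      then show ?thesis using True by (simp add: algebra_simps)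
    qed (use \<open>j < Suc n\<close> in auto)
  qed
  also have "\<dots> = fdet n ?g" by (rule fdet_unit_last_row) auto
  also have "\<dots> = fdet n (\<lambda>i j. (x i - x n) * x i ^ (n - 1 - j))" by (rule fdet_cong) auto
  also have "\<dots> = (\<Prod>i<n. x i - x n) * (\<Prod>(i, j)\<in>pairs_below n. x i - x j)"
    by (subst fdet_scale_rows) (simp only: Suc)
  also have "\<dots> = (\<Prod>(i, j)\<in>pairs_below (Suc n). x i - x j)"
    by (subst prod_pairs_below_Suc) (simp add: mult.commute)
  finally show ?case by simp
qed

text \<open>Expanding \<open>(1 + c x)^j\<close> writes the columns through those of the ordinary
  Vandermonde matrix with a unitriangular \<open>M\<close>, so the twist disappears. This is the
  bialternant of the empty partition for every parameter.\<close>

lemma fdet_vandermonde_twisted: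
  fixes x :: "nat \<Rightarrow> 'a::comm_ring_1"
  shows "fdet n (\<lambda>i j. x i ^ (n - 1 - j) * (1 + c * x i) ^ j) = (\<Prod>(i, j)\<in>pairs_below n. x i - x j)"
proof -
  define M where "M k j = (if k \<le> j then of_nat (j choose k) * c ^ (j - k) else 0)" for k j :: nat
  have "fdet n (\<lambda>i j. x i ^ (n - 1 - j) * (1 + c * x i) ^ j)
     = fdet n (\<lambda>i j. \<Sum>k<n. x i ^ (n - 1 - k) * M k j)"
  proof (rule fdet_cong)
    fix i j assume ij: "i < n" "j < n"
    have "x i ^ (n - 1 - j) * (1 + c * x i) ^ j
      = (\<Sum>k\<le>j. x i ^ (n - 1 - j) * (of_nat (j choose k) * (c * x i) ^ (j - k)))"
      by (subst binomial_ring) (simp add: sum_distrib_left)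
    also have "\<dots> = (\<Sum>k\<le>j. x i ^ (n - 1 - k) * M k j)"
    proof (rule sum.cong)
      fix k assume k: "k \<in> {..j}"
      then have "n - 1 - k = (n - 1 - j) + (j - k)" using ij by auto
      then have *: "x i ^ (n - 1 - k) = x i ^ (n - 1 - j) * x i ^ (j - k)" by (simp only: power_add)
      then show "x i ^ (n - 1 - j) * (of_nat (j choose k) * (c * x i) ^ (j - k)) = x i ^ (n - 1 - k) * M k j"
        using k unfolding * by (simp add: M_def power_mult_distrib mult_ac)
    qed simp
    also have "\<dots> = (\<Sum>k<n. x i ^ (n - 1 - k) * M k j)"
      by (rule sum.mono_neutral_left) (use ij in \<open>auto simp: M_def\<close>)
    finally show "x i ^ (n - 1 - j) * (1 + c * x i) ^ j = (\<Sum>k<n. x i ^ (n - 1 - k) * M k j)" .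
  qed
  also have "\<dots> = fdet n (\<lambda>i j. x i ^ (n - 1 - j)) * fdet n M" by (rule fdet_mult)
  also have "fdet n M = 1" by (subst fdet_upper_triangular) (auto simp: M_def)
  finally show ?thesis by (simp only: mult_1_right fdet_vandermonde)
qed

text \<open>Multilinearity, one row of \<open>C\<close> at a time; \<open>S\<close> records the rows
  where the second summand is chosen. Here it serves to expand over sets of corners.\<close>

lemma fdet_row_expand:
  assumes "finite C" "C \<subseteq> {..<n}"
  shows "fdet n (\<lambda>i j. f i j + (if i \<in> C then c * g i j else 0))
    = (\<Sum>S\<in>Pow C. c ^ card S * fdet n (\<lambda>i. if i \<in> S then g i else f i))"
  using assms
proof (induction C arbitrary: f rule: finite_induct)
  case empty
  then show ?case by simp
next
  case (insert k C)
  have fin: "finite S" if "S \<in> Pow C" for S using that insert.hyps(1) finite_subset by blast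
  have k: "k < n" "C \<subseteq> {..<n}" using insert.prems by auto
  let ?F = "\<lambda>i j. f i j + (if i \<in> C then c * g i j else 0)"
  let ?D = "\<lambda>S. fdet n (\<lambda>i. if i \<in> S then g i else f i)"
  have 1: "(\<lambda>i j. f i j + (if i \<in> insert k C then c * g i j else 0)) = ?F(k := \<lambda>j. f k j + c * g k j)"
    by (rule ext)+ (use insert.hyps in auto)
  have 2: "?F(k := f k) = ?F" by (rule ext)+ (use insert.hyps in auto)
  have 3: "?F(k := g k) = (\<lambda>i j. (f(k := g k)) i j + (if i \<in> C then c * g i j else 0))"
    by (rule ext)+ (use insert.hyps in auto)
  have 4: "c * (c ^ card S * fdet n (\<lambda>i. if i \<in> S then g i else (f(k := g k)) i))
      = c ^ card (insert k S) * ?D (insert k S)" if S: "S \<in> Pow C" for S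
  proof -
    have "k \<notin> S" using S insert.hyps by auto
    then have "card (insert k S) = Suc (card S)" using fin[OF S] by simp
    moreover have "(\<lambda>i. if i \<in> S then g i else (f(k := g k)) i) = (\<lambda>i. if i \<in> insert k S then g i else f i)"
      using \<open>k \<notin> S\<close> by (intro ext) auto
    ultimately show ?thesis by (simp only: power_Suc mult.assoc)
  qed
  have "fdet n (?F(k := g k)) = (\<Sum>S\<in>Pow C. c ^ card S * fdet n (\<lambda>i. if i \<in> S then g i else (f(k := g k)) i))"
    unfolding 3 by (rule insert.IH[OF k(2)])
  then have "c * fdet n (?F(k := g k)) = (\<Sum>S\<in>Pow C. c ^ card (insert k S) * ?D (insert k S))"
    by (simp only: sum_distrib_left) (intro sum.cong refl 4)
  also have "\<dots> = (\<Sum>S\<in>insert k ` Pow C. c ^ card S * ?D S)"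
  proof -
    have "inj_on (insert k) (Pow C)"
      using insert.hyps(2) by (intro inj_onI) (metis PowD insert_ident subsetD)
    then show ?thesis by (simp only: sum.reindex comp_def)
  qed
  finally have 5: "c * fdet n (?F(k := g k)) = (\<Sum>S\<in>insert k ` Pow C. c ^ card S * ?D S)" .
  have "fdet n (\<lambda>i j. f i j + (if i \<in> insert k C then c * g i j else 0))
     = fdet n ?F + c * fdet n (?F(k := g k))"
    unfolding 1 using fdet_row_linear[OF k(1), of ?F "f k" c "g k"] by (simp only: 2)
  also have "\<dots> = (\<Sum>S\<in>Pow C. c ^ card S * ?D S) + (\<Sum>S\<in>insert k ` Pow C. c ^ card S * ?D S)"
    by (simp only: 5 insert.IH[OF k(2)])
  also have "\<dots> = (\<Sum>S\<in>Pow (insert k C). c ^ card S * ?D S)"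
  proof -
    have "Pow C \<inter> insert k ` Pow C = {}" using insert.hyps(2) by blast
    then show ?thesis
      unfolding Pow_insert using insert.hyps(1) by (simp add: sum.union_disjoint)
  qed
  finally show ?case .
qed


section \<open>Power series in countably many variables\<close>

lemma mcoeff_0 [simp]: "mcoeff 0 a = 0"
  by (simp add: zero_mfps_def)

lemma mcoeff_1: "mcoeff 1 a = (if a = 0 then 1 else 0)"
  by (simp add: one_mfps_def)

lemma mcoeff_add [simp]: "mcoeff (F + G) a = mcoeff F a + mcoeff G a"
  by (simp add: plus_mfps_def)

lemma mcoeff_diff [simp]: "mcoeff (F - G) a = mcoeff F a - mcoeff G a"
  by (simp add: minus_mfps_def)

lemma mcoeff_sum [simp]: "mcoeff (\<Sum>i\<in>I. F i) a = (\<Sum>i\<in>I. mcoeff (F i) a)"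
  by (induction I rule: infinite_finite_induct) auto

lemma keys_add_nat: "Poly_Mapping.keys (a + b :: monom) = Poly_Mapping.keys a \<union> Poly_Mapping.keys b"
  by (auto simp: in_keys_iff lookup_add)

lemma lookup_add_disjoint:
  fixes a c :: monom
  assumes "Poly_Mapping.keys a \<inter> Poly_Mapping.keys c = {}"
  shows "i \<in> Poly_Mapping.keys a \<Longrightarrow> Poly_Mapping.lookup (a + c) i = Poly_Mapping.lookup a i"
    and "i \<in> Poly_Mapping.keys c \<Longrightarrow> Poly_Mapping.lookup (a + c) i = Poly_Mapping.lookup c i"
proof -
  assume "i \<in> Poly_Mapping.keys a"
  then have "i \<notin> Poly_Mapping.keys c" using assms by blast
  then show "Poly_Mapping.lookup (a + c) i = Poly_Mapping.lookup a i" by (simp add: lookup_add in_keys_iff)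
next
  assume "i \<in> Poly_Mapping.keys c"
  then have "i \<notin> Poly_Mapping.keys a" using assms by blast
  then show "Poly_Mapping.lookup (a + c) i = Poly_Mapping.lookup c i" by (simp add: lookup_add in_keys_iff)
qed

lemma mcoeff_mconst_times [simp]: "mcoeff (mconst c * F) a = c * mcoeff F a"
proof -
  have "mcoeff (mconst c * F) a = (\<Sum>(b, d)\<in>{(0 :: monom, a)}. mcoeff (mconst c) b * mcoeff F d)"
    unfolding mcoeff_times
    by (rule sum.mono_neutral_right) (auto simp: mconst_def split: if_splits)
  then show ?thesis by (simp add: mconst_def)
qed

lemma mcoeff_mvar_times:
  "mcoeff (mvar i * F) a = (if Poly_Mapping.lookup a i = 0 then 0 else mcoeff F (a - Poly_Mapping.single i 1))"
proof (cases "Poly_Mapping.lookup a i = 0")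
  case True
  have "(b, d) \<in> splits a \<Longrightarrow> b \<noteq> Poly_Mapping.single i 1" for b d
    using True by (auto simp: lookup_add lookup_single)
  then show ?thesis using True
    unfolding mcoeff_times by (auto simp: mvar_def intro!: sum.neutral)
next
  case False
  have a: "a = Poly_Mapping.single i 1 + (a - Poly_Mapping.single i 1)"
    using False by (intro poly_mapping_eqI) (auto simp: lookup_add lookup_minus lookup_single when_def)
  have "mcoeff (mvar i * F) a
    = (\<Sum>(b, d)\<in>{(Poly_Mapping.single i 1, a - Poly_Mapping.single i 1)}. mcoeff (mvar i) b * mcoeff F d)"
    unfolding mcoeff_times
  proof (rule sum.mono_neutral_right)
    show "{(Poly_Mapping.single i 1, a - Poly_Mapping.single i 1)} \<subseteq> splits a"
      using a by auto
    show "\<forall>x\<in>splits a - {(Poly_Mapping.single i 1, a - Poly_Mapping.single i 1)}.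
       (case x of (b, d) \<Rightarrow> mcoeff (mvar i) b * mcoeff F d) = 0"
      by (auto simp: mvar_def split: if_splits)
  qed simp
  then show ?thesis using False by (simp add: mvar_def)
qed

lemma mcoeff_mconst: "mcoeff (mconst c) a = (if a = 0 then c else 0)"
  by (simp add: mconst_def)

interpretation mconst: comm_ring_hom mconst
proof
  fix x y :: 'a
  show "mconst (x * y) = mconst x * mconst y"
    by (rule mfps_eqI) (simp add: mcoeff_mconst)
qed (auto intro!: mfps_eqI simp: mcoeff_mconst mcoeff_1)

lemma mcoeff_of_int_times: "mcoeff (of_int z * F) a = of_int z * mcoeff F a"
  by (metis mconst.hom_of_int mcoeff_mconst_times)

section \<open>Coefficients of products and determinants\<close>

definition families :: "nat \<Rightarrow> monom \<Rightarrow> (nat \<Rightarrow> monom) set" where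
  "families n a = {g. (\<forall>i\<ge>n. g i = 0) \<and> (\<Sum>i<n. g i) = a}"

lemma families_0: "families 0 a = (if a = 0 then {\<lambda>_. 0} else {})"
  by (auto simp: families_def)

lemma families_Suc_bij:
  "bij_betw (\<lambda>(p, g). g(n := snd p)) (SIGMA p:splits a. families n (fst p)) (families (Suc n) a)"
proof (rule bij_betw_byWitness[where f' = "\<lambda>g. ((\<Sum>i<n. g i, g n), g(n := 0))"])
  show "\<forall>x\<in>(SIGMA p:splits a. families n (fst p)).
       ((\<Sum>i<n. (case x of (p, g) \<Rightarrow> g(n := snd p)) i, (case x of (p, g) \<Rightarrow> g(n := snd p)) n),
        (case x of (p, g) \<Rightarrow> g(n := snd p))(n := 0)) = x"
    by (auto simp: families_def fun_eq_iff)
  show "\<forall>g\<in>families (Suc n) a. (case ((\<Sum>i<n. g i, g n), g(n := 0)) of (p, g) \<Rightarrow> g(n := snd p)) = g"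
    by auto
  show "(\<lambda>(p, g). g(n := snd p)) ` (SIGMA p:splits a. families n (fst p)) \<subseteq> families (Suc n) a"
    by (auto simp: families_def)
  show "(\<lambda>g. ((\<Sum>i<n. g i, g n), g(n := 0))) ` families (Suc n) a \<subseteq> (SIGMA p:splits a. families n (fst p))"
    by (auto simp: families_def le_Suc_eq)
qed

lemma finite_families [simp]: "finite (families n a)"
proof (induction n arbitrary: a)
  case (Suc n)
  then have "finite (SIGMA p:splits a. families n (fst p))" by auto
  then show ?case using bij_betw_finite[OF families_Suc_bij] by blast
qed (simp add: families_0)

lemma mcoeff_prod: "mcoeff (\<Prod>i<n. F i) a = (\<Sum>g\<in>families n a. \<Prod>i<n. mcoeff (F i) (g i))"
proof (induction n arbitrary: a)
  case 0
  then show ?case by (simp add: families_0 mcoeff_1)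
next
  case (Suc n)
  have "mcoeff (\<Prod>i<Suc n. F i) a
    = (\<Sum>p\<in>splits a. \<Sum>g\<in>families n (fst p). (\<Prod>i<n. mcoeff (F i) (g i)) * mcoeff (F n) (snd p))"
    by (simp add: mcoeff_times Suc sum_distrib_right case_prod_beta)
  also have "\<dots> = (\<Sum>(p, g)\<in>(SIGMA p:splits a. families n (fst p)).
      (\<Prod>i<n. mcoeff (F i) (g i)) * mcoeff (F n) (snd p))"
    by (subst sum.Sigma) auto
  also have "\<dots> = (\<Sum>x\<in>(SIGMA p:splits a. families n (fst p)).
      (\<lambda>h. \<Prod>i<Suc n. mcoeff (F i) (h i)) ((\<lambda>(p, g). g(n := snd p)) x))"
    by (rule sum.cong) (auto intro!: prod.cong)
  also have "\<dots> = (\<Sum>h\<in>families (Suc n) a. \<Prod>i<Suc n. mcoeff (F i) (h i))"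
    by (rule sum.reindex_bij_betw[OF families_Suc_bij])
  finally show ?case .
qed

lemma mcoeff_fdet:
  "mcoeff (fdet n F) a = (\<Sum>g\<in>families n a. fdet n (\<lambda>i j. mcoeff (F i j) (g i)))"
  unfolding fdet_leibniz mcoeff_sum mcoeff_of_int_times mcoeff_prod sum_distrib_left
  by (rule sum.swap)

lemma families_permute:
  assumes p: "p permutes {..<n}"
  shows "bij_betw (\<lambda>g. g \<circ> p) (families n a) (families n a)"
proof -
  have *: "g \<circ> q \<in> families n a" if q: "q permutes {..<n}" and g: "g \<in> families n a" for q g
  proof -
    have "(\<Sum>i<n. g (q i)) = (\<Sum>i<n. g i)" by (rule sum.permute[OF q, unfolded comp_def, symmetric])
    moreover have "q i = i" if "i \<ge> n" for i using q that by (simp add: permutes_def)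
    ultimately show ?thesis using g by (simp add: families_def)
  qed
  show ?thesis
    by (rule bij_betw_byWitness[where f' = "\<lambda>g. g \<circ> inv_into UNIV p"])
      (use *[OF p] *[OF permutes_inv[OF p]] permutes_inv_o[OF p] in \<open>auto simp: comp_assoc\<close>)
qed

text \<open>For each permutation in the Leibniz formula the tuple \<open>g\<close> can be permuted
  along with it. Monomials thereby move from the rows to the columns, so that in the coproduct one
  alphabet acts on the functionals and the other on the columns.\<close>

lemma sum_families_fdet_swap:
  "(\<Sum>g\<in>families n a. fdet n (\<lambda>i j. f i j (g i))) = (\<Sum>g\<in>families n a. fdet n (\<lambda>i j. f i j (g j)))"
proof -
  have *: "(\<Sum>g\<in>families n a. \<Prod>i<n. f i (p i) (g i)) = (\<Sum>g\<in>families n a. \<Prod>i<n. f i (p i) (g (p i)))"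
    if "p permutes {..<n}" for p
    using sum.reindex_bij_betw[OF families_permute[OF that], of "\<lambda>g. \<Prod>i<n. f i (p i) (g i)" a]
    by simp
  show ?thesis
    unfolding fdet_leibniz
    by (subst (1 2) sum.swap) (auto simp: sum_distrib_left[symmetric] * intro!: sum.cong)
qed

section \<open>Specialisation to finitely many variables\<close>

lemma mcoeff_mtrunc: "mcoeff (mtrunc n F) a = (if Poly_Mapping.keys a \<subseteq> {..<n} then mcoeff F a else 0)"
  by (simp add: mtrunc_def)

lemma mtrunc_times: "mtrunc n (F * G) = mtrunc n F * mtrunc n G"
proof (rule mfps_eqI)
  fix a
  have *: "mcoeff (mtrunc n F) b * mcoeff (mtrunc n G) c
      = (if Poly_Mapping.keys a \<subseteq> {..<n} then mcoeff F b * mcoeff G c else 0)" if "b + c = a" for b c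
    using keys_add_nat[of b c] that by (auto simp: mcoeff_mtrunc)
  have "mcoeff (mtrunc n F * mtrunc n G) a =
    (\<Sum>(b, c)\<in>splits a. if Poly_Mapping.keys a \<subseteq> {..<n} then mcoeff F b * mcoeff G c else 0)"
    unfolding mcoeff_times
    by (rule sum.cong) (use * in \<open>auto simp del: split_paired_All\<close>)
  also have "\<dots> = (if Poly_Mapping.keys a \<subseteq> {..<n} then (\<Sum>(b, c)\<in>splits a. mcoeff F b * mcoeff G c) else 0)"
    by (simp add: case_prod_beta)
  finally show "mcoeff (mtrunc n (F * G)) a = mcoeff (mtrunc n F * mtrunc n G) a"
    by (simp add: mcoeff_mtrunc mcoeff_times)
qed

interpretation mtrunc: comm_ring_hom "mtrunc n"
  by unfold_locales (auto intro!: mfps_eqI simp: mcoeff_mtrunc mtrunc_times mcoeff_1)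

lemma mtrunc_mvar: "mtrunc n (mvar i) = (if i < n then mvar i else 0)"
  by (rule mfps_eqI) (auto simp: mcoeff_mtrunc mvar_def split: if_splits)

lemma mtrunc_mtrunc: "mtrunc m (mtrunc n F) = mtrunc (min m n) F"
  by (rule mfps_eqI) (auto simp: mcoeff_mtrunc)

lemma ex_keys_bound: "\<exists>n\<ge>N. Poly_Mapping.keys (a :: monom) \<subseteq> {..<n}"
proof -
  obtain m where "Poly_Mapping.keys a \<subseteq> {..<m}"
    using finite_nat_bounded[OF finite_keys[of a]] by blast
  then show ?thesis by (intro exI[of _ "max m N"]) auto
qed

lemma mfps_eq_mtruncI:
  assumes "\<And>n. n \<ge> N \<Longrightarrow> mtrunc n F = mtrunc n G"
  shows "F = G"
proof (rule mfps_eqI)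
  fix a :: monom
  obtain n where n: "n \<ge> N" "Poly_Mapping.keys a \<subseteq> {..<n}" using ex_keys_bound[of N a] by blast
  then have "mcoeff (mtrunc n F) a = mcoeff (mtrunc n G) a" using assms by simp
  then show "mcoeff F a = mcoeff G a" using n by (simp add: mcoeff_mtrunc)
qed

section \<open>Cancellation of nonzero divisors\<close>

definition nonzerodiv :: "'a::comm_ring_1 \<Rightarrow> bool" where
  "nonzerodiv f \<longleftrightarrow> (\<forall>g. f * g = 0 \<longrightarrow> g = 0)"

lemma nonzerodiv_cancel: "nonzerodiv f \<Longrightarrow> f * g = f * h \<Longrightarrow> g = h"
  unfolding nonzerodiv_def by (metis eq_iff_diff_eq_0 right_diff_distrib)

lemma nonzerodiv_1: "nonzerodiv 1"
  by (simp add: nonzerodiv_def)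

lemma nonzerodiv_mult: "nonzerodiv f \<Longrightarrow> nonzerodiv g \<Longrightarrow> nonzerodiv (f * g)"
  unfolding nonzerodiv_def by (metis mult.assoc)

lemma nonzerodiv_prod: "(\<And>i. i \<in> I \<Longrightarrow> nonzerodiv (f i)) \<Longrightarrow> nonzerodiv (\<Prod>i\<in>I. f i)"
proof (induction I rule: infinite_finite_induct)
  case (insert i I)
  have "nonzerodiv (f i * (\<Prod>i\<in>I. f i))"
    by (rule nonzerodiv_mult) (use insert in auto)
  then show ?case using insert.hyps by simp
qed (simp_all add: nonzerodiv_1)

lemma nonzerodiv_power: "nonzerodiv f \<Longrightarrow> nonzerodiv (f ^ n)"
  by (induction n) (auto intro: nonzerodiv_1 nonzerodiv_mult)

lemma nonzerodiv_mvar: "nonzerodiv (mvar i :: 'a::comm_ring_1 mfps)"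
  unfolding nonzerodiv_def
proof (intro allI impI mfps_eqI)
  fix F :: "'a mfps" and a assume "mvar i * F = 0"
  then have "mcoeff (mvar i * F) (a + Poly_Mapping.single i 1) = 0" by simp
  then show "mcoeff F a = mcoeff 0 a" by (simp add: mcoeff_mvar_times lookup_add)
qed

text \<open>If \<open>x_i F = x_j F\<close>, the coefficient at \<open>a\<close> equals the one at
  \<open>a\<close> with a unit moved from \<open>j\<close> to \<open>i\<close>, and it is zero once
  the exponent of \<open>j\<close> is exhausted; hence the induction on that exponent.\<close>

lemma nonzerodiv_mvar_diff:
  assumes "i \<noteq> j"
  shows "nonzerodiv (mvar i - mvar j :: 'a::comm_ring_1 mfps)"
  unfolding nonzerodiv_def
proof (intro allI impI mfps_eqI)
  fix F :: "'a mfps" and a assume "(mvar i - mvar j) * F = 0"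
  then have eq: "mcoeff (mvar i * F) b = mcoeff (mvar j * F) b" for b
    by (simp add: left_diff_distrib)
  have "mcoeff F a = 0" if "Poly_Mapping.lookup a j = k" for k
    using that
  proof (induction k arbitrary: a)
    case 0
    then show ?case
      using eq[of "a + Poly_Mapping.single i 1"] assms
      by (simp add: mcoeff_mvar_times lookup_add lookup_single)
  next
    case (Suc k)
    have "mcoeff F (a + Poly_Mapping.single i 1 - Poly_Mapping.single j 1) = 0"
      by (rule Suc.IH) (use Suc.prems assms in \<open>simp add: lookup_add lookup_minus lookup_single\<close>)
    then show ?case
      using eq[of "a + Poly_Mapping.single i 1"] assms Suc.prems
      by (simp add: mcoeff_mvar_times lookup_add lookup_single)
  qed
  then show "mcoeff F a = mcoeff 0 a" by simp
qed

lemma nonzerodiv_one_plus_mvar: "nonzerodiv (1 + mconst c * mvar i :: 'a::comm_ring_1 mfps)"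
  unfolding nonzerodiv_def
proof (intro allI impI mfps_eqI)
  fix F :: "'a mfps" and a assume "(1 + mconst c * mvar i) * F = 0"
  then have *: "mcoeff ((1 + mconst c * mvar i) * F) b = 0" for b by simp
  have eq: "mcoeff F b = - (c * mcoeff (mvar i * F) b)" for b
    using *[of b] by (simp add: distrib_right mult.assoc eq_neg_iff_add_eq_0)
  have "mcoeff F a = 0" if "Poly_Mapping.lookup a i = k" for k
    using that
  proof (induction k arbitrary: a)
    case 0
    then show ?case using eq[of a] by (simp add: mcoeff_mvar_times)
  next
    case (Suc k)
    have "mcoeff F (a - Poly_Mapping.single i 1) = 0"
      by (rule Suc.IH) (use Suc.prems in \<open>simp add: lookup_minus\<close>)
    then show ?case using eq[of a] by (simp add: mcoeff_mvar_times)
  qed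
  then show "mcoeff F a = mcoeff 0 a" by simp
qed

lemma vandermonde_pairs: "vandermonde n = (\<Prod>(i, j)\<in>pairs_below n. mvar i - mvar j)"
  by (simp add: vandermonde_def pairs_below_def)

lemma nonzerodiv_vandermonde: "nonzerodiv (vandermonde n)"
  unfolding vandermonde_pairs
  by (rule nonzerodiv_prod) (auto simp: pairs_below_def intro!: nonzerodiv_mvar_diff)

lemma vandermonde_eq_fdet:
  "vandermonde n = fdet n (\<lambda>i j. mvar i ^ (n - 1 - j) * (1 + mconst c * mvar i) ^ j)"
  unfolding vandermonde_pairs by (rule fdet_vandermonde_twisted[symmetric])

lemma mtrunc_vandermonde: "mtrunc n (vandermonde n) = vandermonde n"
  unfolding vandermonde_pairs mtrunc.hom_prod
  by (rule prod.cong) (auto simp: pairs_below_def mtrunc.hom_minus mtrunc_mvar)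

text \<open>Setting the last variable to zero turns each factor \<open>x_i - x_n\<close> into
  \<open>x_i\<close>. Both the stability of Schur coefficients and the vanishing in too few
  variables rest on this.\<close>

lemma mtrunc_vandermonde_Suc: "mtrunc n (vandermonde (Suc n)) = vandermonde n * (\<Prod>i<n. mvar i)"
proof -
  have "(\<Prod>(i, j)\<in>pairs_below n. mtrunc n (mvar i) - mtrunc n (mvar j)) = (\<Prod>(i, j)\<in>pairs_below n. mvar i - mvar j :: ratfun mfps)"
    by (rule prod.cong) (auto simp: pairs_below_def mtrunc_mvar)
  then show ?thesis
    unfolding vandermonde_pairs prod_pairs_below_Suc mtrunc.hom_mult mtrunc.hom_prod case_prod_beta mtrunc.hom_minus
    by (simp add: mtrunc_mvar case_prod_beta)
qed

section \<open>Symmetry and total degree\<close>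

lemma symmetricD: "symmetric F \<Longrightarrow> bij \<pi> \<Longrightarrow> mcoeff F (Poly_Mapping.map_key \<pi> a) = mcoeff F a"
  by (simp add: symmetric_def)

lemma lookup_map_key: "bij \<pi> \<Longrightarrow> Poly_Mapping.lookup (Poly_Mapping.map_key \<pi> a) i = Poly_Mapping.lookup a (\<pi> i)"
  by (simp add: map_key.rep_eq bij_is_inj)

lemma map_key_add: "bij \<pi> \<Longrightarrow> Poly_Mapping.map_key \<pi> (a + b) = Poly_Mapping.map_key \<pi> a + Poly_Mapping.map_key \<pi> b"
  by (rule poly_mapping_eqI) (simp add: lookup_map_key lookup_add)

lemma map_key_inverse:
  assumes "bij \<pi>"
  shows "Poly_Mapping.map_key (inv_into UNIV \<pi>) (Poly_Mapping.map_key \<pi> a) = a"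
    and "Poly_Mapping.map_key \<pi> (Poly_Mapping.map_key (inv_into UNIV \<pi>) a) = a"
  using assms
  by (auto intro!: poly_mapping_eqI simp: lookup_map_key bij_imp_bij_inv bij_is_surj surj_f_inv_f inv_f_f bij_is_inj)

lemma keys_map_key: "bij \<pi> \<Longrightarrow> Poly_Mapping.keys (Poly_Mapping.map_key \<pi> a) = \<pi> -` Poly_Mapping.keys a"
  by (auto simp: in_keys_iff lookup_map_key)

lemma symmetric_0 [simp]: "symmetric 0"
  by (simp add: symmetric_def)

lemma symmetric_mconst [simp]: "symmetric (mconst c)"
proof -
  have "Poly_Mapping.map_key \<pi> a = 0 \<longleftrightarrow> a = 0" if "bij \<pi>" for \<pi> :: "nat \<Rightarrow> nat" and a :: monom
    using map_key_inverse(1)[OF that, of a] map_key_inverse(1)[OF that, of 0]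
    by (metis lookup_map_key lookup_zero poly_mapping_eqI that)
  then show ?thesis by (auto simp: symmetric_def mconst_def)
qed

lemma symmetric_1 [simp]: "symmetric 1"
  using symmetric_mconst[of 1] by simp

lemma symmetric_add: "symmetric F \<Longrightarrow> symmetric G \<Longrightarrow> symmetric (F + G)"
  by (simp add: symmetric_def)

lemma symmetric_diff: "symmetric F \<Longrightarrow> symmetric G \<Longrightarrow> symmetric (F - G)"
  by (simp add: symmetric_def)

lemma symmetric_sum: "(\<And>i. i \<in> I \<Longrightarrow> symmetric (F i)) \<Longrightarrow> symmetric (\<Sum>i\<in>I. F i)"
  by (simp add: symmetric_def)

lemma symmetric_times:
  assumes "symmetric F" "symmetric G"
  shows "symmetric (F * G)"
  unfolding symmetric_def
proof (intro allI impI)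
  fix \<pi> :: "nat \<Rightarrow> nat" and a :: monom assume \<pi>: "bij \<pi>"
  let ?m = "Poly_Mapping.map_key \<pi>" and ?m' = "Poly_Mapping.map_key (inv_into UNIV \<pi>)"
  show "mcoeff (F * G) (?m a) = mcoeff (F * G) a"
    unfolding mcoeff_times
    by (rule sum.reindex_bij_witness[where i = "\<lambda>(b, c). (?m b, ?m c)" and j = "\<lambda>(b, c). (?m' b, ?m' c)"])
      (auto simp: map_key_inverse[OF \<pi>] map_key_add[symmetric] \<pi> bij_imp_bij_inv symmetricD[OF assms(1)] symmetricD[OF assms(2)])
qed

lemma symmetric_prod: "(\<And>i. i \<in> I \<Longrightarrow> symmetric (F i)) \<Longrightarrow> symmetric (\<Prod>i\<in>I. F i)"
  by (induction I rule: infinite_finite_induct) (auto intro: symmetric_times)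

lemma symmetric_fdet:
  assumes "\<And>i j. i < n \<Longrightarrow> j < n \<Longrightarrow> symmetric (F i j)"
  shows "symmetric (fdet n F)"
  unfolding fdet_leibniz
proof (rule symmetric_sum, rule symmetric_times)
  fix p assume "p \<in> {p. p permutes {..<n}}"
  then have "p i < n" if "i < n" for i using that permutes_in_image[of p "{..<n}" i] by simp
  then show "symmetric (\<Prod>i<n. F i (p i))" using assms by (intro symmetric_prod) auto
  have "of_int (sign p) = (mconst (of_int (sign p)) :: 'a mfps)" by simp
  then show "symmetric (of_int (sign p) :: 'a mfps)" by (metis symmetric_mconst)
qed

lemma mdegree_superset: "finite A \<Longrightarrow> Poly_Mapping.keys a \<subseteq> A \<Longrightarrow> mdegree a = (\<Sum>i\<in>A. Poly_Mapping.lookup a i)"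
  unfolding mdegree_def by (rule sum.mono_neutral_left) (auto simp: in_keys_iff)

lemma mdegree_add: "mdegree (a + b) = mdegree a + mdegree b"
proof -
  let ?A = "Poly_Mapping.keys a \<union> Poly_Mapping.keys b"
  show ?thesis
    using mdegree_superset[of ?A a] mdegree_superset[of ?A b] mdegree_superset[of ?A "a + b"]
    by (simp add: keys_add_nat lookup_add sum.distrib)
qed

lemma mdegree_0 [simp]: "mdegree 0 = 0"
  by (simp add: mdegree_def)

lemma mdegree_single [simp]: "mdegree (Poly_Mapping.single i k) = k"
  by (simp add: mdegree_superset[of "{i}"])

lemma mdegree_map_key: 
  assumes "bij \<pi>"
  shows "mdegree (Poly_Mapping.map_key \<pi> a) = mdegree a"
  unfolding mdegree_def keys_map_key[OF assms]
  by (rule sum.reindex_bij_witness[where i = "inv_into UNIV \<pi>" and j = \<pi>])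
    (use assms in \<open>auto simp: lookup_map_key bij_is_surj surj_f_inv_f inv_f_f bij_is_inj\<close>)

lemma finite_mdegree_bounded: "finite {a. Poly_Mapping.keys a \<subseteq> {..<n} \<and> mdegree a \<le> d}"
proof -
  let ?S = "{a. Poly_Mapping.keys a \<subseteq> {..<n} \<and> mdegree a \<le> d}"
  let ?r = "\<lambda>a. restrict (Poly_Mapping.lookup a) {..<n}"
  have "inj_on ?r ?S"
  proof (rule inj_onI)
    fix a b assume a: "a \<in> ?S" and b: "b \<in> ?S" and eq: "?r a = ?r b"
    show "a = b"
    proof (rule poly_mapping_eqI)
      fix i show "Poly_Mapping.lookup a i = Poly_Mapping.lookup b i"
      proof (cases "i < n")
        case True
        then show ?thesis using fun_cong[OF eq, of i] by simp
      next
        case False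
        then have "i \<notin> Poly_Mapping.keys a" "i \<notin> Poly_Mapping.keys b" using a b by auto
        then show ?thesis by (simp add: in_keys_iff)
      qed
    qed
  qed
  moreover have "?r ` ?S \<subseteq> PiE {..<n} (\<lambda>_. {..d})"
  proof -
    have "Poly_Mapping.lookup a i \<le> d" if "a \<in> ?S" "i < n" for a i
      using that mdegree_superset[of "{..<n}" a] member_le_sum[of i "{..<n}" "Poly_Mapping.lookup a"] by auto
    then show ?thesis by (auto simp: PiE_def Pi_def extensional_def)
  qed
  moreover have "finite (PiE {..<n} (\<lambda>_. {..d}))" by (rule finite_PiE) auto
  ultimately show ?thesis using finite_imageD finite_subset by blast
qed


section \<open>Jacobi--Trudi determinants and the bialternant formula\<close>

text \<open>\<open>lf b m e p\<close> is the coefficient of \<open>w\<^sup>m\<close> in \<open>(1 + b/w)\<^sup>e p(w)\<close>, expanded in powers of \<open>1/w\<close>.\<close>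

definition lfc :: "ratfun \<Rightarrow> int \<Rightarrow> int \<Rightarrow> nat \<Rightarrow> ratfun" where
  "lfc b m e k = (if m \<le> int k then (of_int e gchoose nat (int k - m)) * b ^ nat (int k - m) else 0)"

definition lf :: "ratfun \<Rightarrow> int \<Rightarrow> int \<Rightarrow> ratfun poly \<Rightarrow> ratfun" where
  "lf b m e p = (\<Sum>k\<le>degree p. coeff p k * lfc b m e k)"

lemma lf_altdef: "degree p \<le> N \<Longrightarrow> lf b m e p = (\<Sum>k\<le>N. coeff p k * lfc b m e k)"
  unfolding lf_def by (rule sum.mono_neutral_left) (auto simp: coeff_eq_0)

lemma lf_0 [simp]: "lf b m e 0 = 0"
  by (simp add: lf_def)

lemma lf_add: "lf b m e (p + q) = lf b m e p + lf b m e q"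
proof -
  let ?N = "max (degree p) (degree q)"
  have "degree (p + q) \<le> ?N" by (rule degree_add_le_max)
  then show ?thesis
    by (simp add: lf_altdef[of _ ?N] distrib_right sum.distrib)
qed

lemma lf_smult: "lf b m e (smult c p) = c * lf b m e p"
  by (subst lf_altdef[of _ "degree p"]) (simp_all add: degree_smult_le lf_def sum_distrib_left mult.assoc)

lemma lf_sum: "lf b m e (\<Sum>i\<in>I. p i) = (\<Sum>i\<in>I. lf b m e (p i))"
  by (induction I rule: infinite_finite_induct) (auto simp: lf_add)

lemma lfc_Suc: "lfc b m e (Suc k) = lfc b (m - 1) e k"
proof -
  have 1: "int (Suc k) - m = int k - (m - 1)" by simp
  have 2: "m \<le> int (Suc k) \<longleftrightarrow> m - 1 \<le> int k" by auto
  show ?thesis unfolding lfc_def 1 2 ..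
qed

lemma lfc_pascal: "b * lfc b m e k + lfc b (m - 1) e k = lfc b (m - 1) (e + 1) k"
proof -
  consider "int k < m - 1" | "int k = m - 1" | "m \<le> int k" by linarith
  then show ?thesis
  proof cases
    case 3
    define d where "d = nat (int k - m)"
    have "nat (int k - (m - 1)) = Suc d" using 3 by (simp add: d_def nat_diff_distrib')
    then show ?thesis
      using 3 gbinomial_Suc_Suc[of "of_int e :: ratfun" d]
      by (simp add: lfc_def d_def[symmetric] algebra_simps)
  qed (auto simp: lfc_def)
qed

lemma lf_pCons: "lf b m e (pCons a p) = a * lfc b m e 0 + lf b (m - 1) e p"
proof -
  have "lf b m e (pCons a p) = (\<Sum>k\<le>Suc (degree p). coeff (pCons a p) k * lfc b m e k)"
    by (rule lf_altdef) (rule degree_pCons_le)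
  also have "\<dots> = a * lfc b m e 0 + lf b (m - 1) e p"
    by (subst sum.atMost_Suc_shift) (simp add: lfc_Suc lf_def)
  finally show ?thesis .
qed

lemma lf_times_w: "lf b m e ([:0, 1:] * p) = lf b (m - 1) e p"
  by (simp add: lf_pCons)

text \<open>Because \<open>w + b = w (1 + b/w)\<close>; on coefficients this is Pascal's
  rule.\<close>

lemma lf_times_w_plus_b: "lf b m e ([:b, 1:] * p) = lf b (m - 1) (e + 1) p"
proof -
  have "[:b, 1:] * p = smult b p + pCons 0 p" by simp
  then have "lf b m e ([:b, 1:] * p) = b * lf b m e p + lf b (m - 1) e p"
    by (simp only: lf_add lf_smult lf_pCons) simp
  also have "\<dots> = (\<Sum>k\<le>degree p. coeff p k * (b * lfc b m e k + lfc b (m - 1) e k))"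
    by (simp add: lf_def sum_distrib_left sum.distrib algebra_simps)
  finally show ?thesis by (simp only: lfc_pascal lf_def)
qed

lemma lf_times_w_power: "lf b m e ([:0, 1:] ^ k * p) = lf b (m - int k) e p"
proof (induction k arbitrary: m)
  case (Suc k)
  have "m - 1 - int k = m - int (Suc k)" by simp
  then show ?case unfolding power_Suc mult.assoc lf_times_w Suc by (simp only:)
qed simp

lemma lf_times_w_plus_b_power: "lf b m e ([:b, 1:] ^ k * p) = lf b (m - int k) (e + int k) p"
proof (induction k arbitrary: m e)
  case (Suc k)
  have "m - 1 - int k = m - int (Suc k)" "e + 1 + int k = e + int (Suc k)" by simp_all
  then show ?case unfolding power_Suc mult.assoc lf_times_w_plus_b Suc by (simp only:)
qed simp

lemma lfc_zero_high: "int k < m \<Longrightarrow> lfc b m e k = 0"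
  by (simp add: lfc_def)

text \<open>For \<open>e \<ge> 0\<close> the factor \<open>(1 + b/w)^e\<close> contains no power
  below \<open>w^(-e)\<close>, and \<open>w^k\<close> only raises it.\<close>

lemma lfc_zero_low:
  assumes "0 \<le> e" "m < - e"
  shows "lfc b m e k = 0"
proof -
  have "(of_int e :: ratfun) = of_nat (nat e)" using assms by simp
  moreover have "nat e < nat (int k - m)" using assms by linarith
  ultimately show ?thesis
    by (simp add: lfc_def binomial_gbinomial[symmetric])
qed

lemma lf_zero_low: "0 \<le> e \<Longrightarrow> m < - e \<Longrightarrow> lf b m e p = 0"
  by (simp add: lf_def lfc_zero_low)

lemma lf_1: "lf b m e 1 = lfc b m e 0"
  by (simp add: lf_def)

lemma lf_monom: "lf b m e (monom 1 k) = lfc b m e k"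
  by (subst lf_altdef[of _ k]) (auto simp: degree_monom_eq if_distrib[of "\<lambda>x. x * _"] cong: if_cong)

lemma lfc_exponent_0: "lfc b m 0 k = (if int k = m then 1 else 0)"
proof (cases "m < int k")
  case True
  then have "nat (int k - m) \<noteq> 0" by simp
  then obtain d where "nat (int k - m) = Suc d" using not0_implies_Suc by blast
  then show ?thesis using True by (simp add: lfc_def)
qed (auto simp: lfc_def)

text \<open>The coefficient of \<open>x\<^sup>a\<close> in \<open>A(w)\<close>, since \<open>(1 + b x) / (1 - x w) = 1 + \<Sum>\<^sub>c x\<^sup>c w\<^sup>c\<^sup>-\<^sup>1 (w + b)\<close> over \<open>c \<ge> 1\<close>.\<close>

definition gen_poly :: "ratfun \<Rightarrow> monom \<Rightarrow> ratfun poly" where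
  "gen_poly b a = (\<Prod>i\<in>Poly_Mapping.keys a. [:0, 1:] ^ (Poly_Mapping.lookup a i - 1) * [:b, 1:])"

lemma gen_poly_0 [simp]: "gen_poly b 0 = 1"
  by (simp add: gen_poly_def)

lemma gen_poly_single: "c > 0 \<Longrightarrow> gen_poly b (Poly_Mapping.single i c) = [:0, 1:] ^ (c - 1) * [:b, 1:]"
  by (simp add: gen_poly_def)

lemma gen_poly_add:
  assumes "Poly_Mapping.keys a \<inter> Poly_Mapping.keys c = {}"
  shows "gen_poly b (a + c) = gen_poly b a * gen_poly b c"
  unfolding gen_poly_def keys_add_nat
  by (subst prod.union_disjoint) (use assms lookup_add_disjoint[OF assms] in \<open>simp_all cong: prod.cong\<close>)

lemma gen_poly_map_key:
  assumes "bij \<pi>"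
  shows "gen_poly b (Poly_Mapping.map_key \<pi> a) = gen_poly b a"
  unfolding gen_poly_def keys_map_key[OF assms]
  by (rule prod.reindex_bij_witness[where i = "inv_into UNIV \<pi>" and j = \<pi>])
    (use assms in \<open>auto simp: lookup_map_key bij_is_surj surj_f_inv_f inv_f_f bij_is_inj\<close>)

lemma gen_poly_zero_beta: "gen_poly 0 a = [:0, 1:] ^ mdegree a"
proof -
  have "gen_poly 0 a = (\<Prod>i\<in>Poly_Mapping.keys a. [:0, 1:] ^ Poly_Mapping.lookup a i)"
    unfolding gen_poly_def
  proof (rule prod.cong)
    fix i assume "i \<in> Poly_Mapping.keys a"
    then have "Poly_Mapping.lookup a i = Suc (Poly_Mapping.lookup a i - 1)" by (simp add: in_keys_iff)
    then show "[:0, 1:] ^ (Poly_Mapping.lookup a i - 1) * [:0, 1:] = ([:0, 1:] :: ratfun poly) ^ Poly_Mapping.lookup a i"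
      by (metis power_Suc2)
  qed simp
  then show ?thesis by (simp only: mdegree_def power_sum)
qed

text \<open>For \<open>b = 0\<close> this is the complete homogeneous symmetric function of degree \<open>m\<close>, whatever \<open>e\<close>.\<close>

definition entry :: "ratfun \<Rightarrow> int \<Rightarrow> int \<Rightarrow> ratfun mfps" where
  "entry b m e = Abs_mfps (\<lambda>a. lf b m e (gen_poly b a))"

lemma mcoeff_entry: "mcoeff (entry b m e) a = lf b m e (gen_poly b a)"
  by (simp add: entry_def)

lemma symmetric_entry: "symmetric (entry b m e)"
  by (simp add: symmetric_def mcoeff_entry gen_poly_map_key)

lemma entry_zero_low: "0 \<le> e \<Longrightarrow> m < - e \<Longrightarrow> entry b m e = 0"
  by (rule mfps_eqI) (simp add: mcoeff_entry lf_zero_low)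

lemma gen_poly_dvd:
  assumes "a \<noteq> 0"
  obtains p where "gen_poly b a = [:b, 1:] * p"
proof -
  obtain i where i: "i \<in> Poly_Mapping.keys a" using assms by (metis ex_in_conv keys_eq_empty)
  have "[:b, 1:] dvd [:0, 1:] ^ (Poly_Mapping.lookup a i - 1) * [:b, 1:]" by (rule dvd_triv_right)
  also have "\<dots> dvd gen_poly b a" unfolding gen_poly_def using i by (intro dvd_prodI) auto
  finally show ?thesis using that by (elim dvdE)
qed

text \<open>At a nonconstant monomial the coefficient of \<open>A(w)\<close> has a factor
  \<open>w + b\<close>, which cancels the exponent \<open>-1\<close> and leaves the coefficient of
  \<open>w^(-1)\<close> in a polynomial.\<close>

lemma entry_0_minus_1: "entry b 0 (- 1) = 1"
proof (rule mfps_eqI)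
  fix a :: monom
  show "mcoeff (entry b 0 (- 1)) a = mcoeff 1 a"
  proof (cases "a = 0")
    case True
    then show ?thesis by (simp add: mcoeff_entry mcoeff_1 lf_1 lfc_def)
  next
    case False
    then obtain p where "gen_poly b a = [:b, 1:] * p" by (rule gen_poly_dvd)
    then have "mcoeff (entry b 0 (- 1)) a = lf b (- 1) 0 p"
      by (simp only: mcoeff_entry lf_times_w_plus_b) simp
    then show ?thesis using False by (simp add: mcoeff_1 lf_zero_low)
  qed
qed

definition jacobi_trudi :: "ratfun \<Rightarrow> nat \<Rightarrow> (nat \<Rightarrow> nat) \<Rightarrow> (nat \<Rightarrow> nat) \<Rightarrow> ratfun mfps" where
  "jacobi_trudi b r l m = fdet r (\<lambda>i j. entry b (int (l i) - int (m j) - int i + int j) (int i - int j - 1))"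

lemma jacobi_trudi_empty: "jacobi_trudi b r (\<lambda>_. 0) (\<lambda>_. 0) = 1"
  unfolding jacobi_trudi_def
  by (subst fdet_upper_triangular) (auto simp: entry_zero_low entry_0_minus_1)

text \<open>In the last row an entry with \<open>j < r\<close> has exponent
  \<open>e = r - j - 1 \<ge> 0\<close> and index \<open>-e - 1\<close>, just below the range where
  \<open>entry\<close> can be nonzero.\<close>

lemma jacobi_trudi_Suc:
  assumes "l r = 0"
  shows "jacobi_trudi b (Suc r) l (\<lambda>_. 0) = jacobi_trudi b r l (\<lambda>_. 0)"
  unfolding jacobi_trudi_def
  by (rule fdet_unit_last_row) (auto simp: assms entry_zero_low entry_0_minus_1)

lemma jacobi_trudi_stable:
  assumes "\<And>i. r \<le> i \<Longrightarrow> l i = 0" "r \<le> n"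
  shows "jacobi_trudi b n l (\<lambda>_. 0) = jacobi_trudi b r l (\<lambda>_. 0)"
  using assms(2) by (induction n rule: dec_induct) (auto simp: jacobi_trudi_Suc assms(1))

lemma symmetric_jacobi_trudi: "symmetric (jacobi_trudi b r l m)"
  unfolding jacobi_trudi_def by (rule symmetric_fdet) (rule symmetric_entry)

text \<open>\<open>A(w)\<close> is treated as a power series in the \<open>x\<close> with
  coefficients polynomial in \<open>w\<close>. The functionals act coefficientwise and are linear
  over the series free of \<open>w\<close>, which \<open>lift_mfps\<close> embeds.\<close>

definition lf_mfps :: "ratfun \<Rightarrow> int \<Rightarrow> int \<Rightarrow> ratfun poly mfps \<Rightarrow> ratfun mfps" where
  "lf_mfps b m e Y = Abs_mfps (\<lambda>a. lf b m e (mcoeff Y a))"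

definition lift_mfps :: "ratfun mfps \<Rightarrow> ratfun poly mfps" where
  "lift_mfps F = Abs_mfps (\<lambda>a. [:mcoeff F a:])"

lemma mcoeff_lf_mfps [simp]: "mcoeff (lf_mfps b m e Y) a = lf b m e (mcoeff Y a)"
  by (simp add: lf_mfps_def)

lemma mcoeff_lift_mfps [simp]: "mcoeff (lift_mfps F) a = [:mcoeff F a:]"
  by (simp add: lift_mfps_def)

lemma const_poly_sum: "[:\<Sum>i\<in>I. f i:] = (\<Sum>i\<in>I. [:f i:])"
proof (induction I rule: infinite_finite_induct)
  case (insert x I)
  have "[:f x + (\<Sum>i\<in>I. f i):] = [:f x:] + [:\<Sum>i\<in>I. f i:]" by simp
  then show ?case unfolding sum.insert[OF insert.hyps] insert.IH .
qed simp_all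

interpretation lift_mfps: comm_ring_hom lift_mfps
proof
  fix F G :: "ratfun mfps"
  show "lift_mfps (F * G) = lift_mfps F * lift_mfps G"
    by (rule mfps_eqI) (simp add: mcoeff_times const_poly_sum case_prod_beta mult.commute)
qed (auto intro!: mfps_eqI simp: mcoeff_1)

lemma lift_mfps_mvar: "lift_mfps (mvar i) = mvar i"
  by (rule mfps_eqI) (simp add: mvar_def)

lemma lift_mfps_mconst: "lift_mfps (mconst c) = mconst [:c:]"
  by (rule mfps_eqI) (simp add: mcoeff_mconst)

lemma lf_mfps_lift_times: "lf_mfps b m e (lift_mfps F * Y) = F * lf_mfps b m e Y"
  by (rule mfps_eqI) (simp add: mcoeff_times lf_sum lf_smult case_prod_beta)

lemma lf_mfps_sum: "lf_mfps b m e (\<Sum>i\<in>I. Y i) = (\<Sum>i\<in>I. lf_mfps b m e (Y i))"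
  by (rule mfps_eqI) (simp add: lf_sum)

lemma lf_mfps_w_plus_b_power:
  "lf_mfps b m e (mconst [:b, 1:] ^ k * Y) = lf_mfps b (m - int k) (e + int k) Y"
  by (rule mfps_eqI) (simp add: mconst.hom_power[symmetric] lf_times_w_plus_b_power)

lemma mtrunc_lf_mfps: "mtrunc n (lf_mfps b m e Y) = lf_mfps b m e (mtrunc n Y)"
  by (rule mfps_eqI) (simp add: mcoeff_mtrunc)

section \<open>The generating series in finitely many variables\<close>

definition gen_series :: "ratfun \<Rightarrow> ratfun poly mfps" where
  "gen_series b = Abs_mfps (gen_poly b)"

lemma mcoeff_gen_series [simp]: "mcoeff (gen_series b) a = gen_poly b a"
  by (simp add: gen_series_def)

lemma entry_eq_lf_mfps: "entry b m e = lf_mfps b m e (gen_series b)"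
  by (rule mfps_eqI) (simp add: mcoeff_entry)

lemma gen_series_step:
  "mtrunc (Suc n) (gen_series b) * (1 - mconst [:0, 1:] * mvar n)
    = mtrunc n (gen_series b) * (1 + mconst [:b:] * mvar n)"
proof (rule mfps_eqI)
  fix a :: monom
  let ?Q = "gen_series b" and ?e = "Poly_Mapping.single n 1" and ?c = "Poly_Mapping.lookup a n"
  let ?a = "a - Poly_Mapping.single n ?c"
  have L: "mcoeff (mtrunc (Suc n) ?Q * (1 - mconst [:0, 1:] * mvar n)) a
    = mcoeff (mtrunc (Suc n) ?Q) a - [:0, 1:] * (if ?c = 0 then 0 else mcoeff (mtrunc (Suc n) ?Q) (a - ?e))"
    unfolding right_diff_distrib mult_1_right mcoeff_diff mult.commute[of "mtrunc (Suc n) ?Q"]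
      mult.assoc mcoeff_mconst_times mcoeff_mvar_times by simp
  have R: "mcoeff (mtrunc n ?Q * (1 + mconst [:b:] * mvar n)) a
    = mcoeff (mtrunc n ?Q) a + [:b:] * (if ?c = 0 then 0 else mcoeff (mtrunc n ?Q) (a - ?e))"
    unfolding distrib_left mult_1_right mcoeff_add mult.commute[of "mtrunc n ?Q"]
      mult.assoc mcoeff_mconst_times mcoeff_mvar_times by simp
  show "mcoeff (mtrunc (Suc n) ?Q * (1 - mconst [:0, 1:] * mvar n)) a
    = mcoeff (mtrunc n ?Q * (1 + mconst [:b:] * mvar n)) a"
  proof (cases "Poly_Mapping.keys a \<subseteq> {..<Suc n}")
    case False
    then obtain j where j: "j \<in> Poly_Mapping.keys a" "j > n" by (meson lessThan_iff not_less_eq subsetI)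
    then have "j \<in> Poly_Mapping.keys (a - ?e)" by (simp add: in_keys_iff lookup_minus lookup_single)
    then have "\<not> Poly_Mapping.keys (a - ?e) \<subseteq> {..<Suc n}" "\<not> Poly_Mapping.keys (a - ?e) \<subseteq> {..<n}"
      "\<not> Poly_Mapping.keys a \<subseteq> {..<n}" using j by auto
    then show ?thesis unfolding L R using False by (simp add: mcoeff_mtrunc)
  next
    case True
    have keys: "Poly_Mapping.keys ?a \<subseteq> {..<n}"
    proof
      fix i assume "i \<in> Poly_Mapping.keys ?a"
      then have "i \<noteq> n" "i \<in> Poly_Mapping.keys a"
        by (auto simp: in_keys_iff lookup_minus lookup_single when_def split: if_splits)
      then show "i \<in> {..<n}" using True by (auto simp: less_Suc_eq)
    qed
    have a: "a = ?a + Poly_Mapping.single n ?c"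
      by (rule poly_mapping_eqI) (auto simp: lookup_add lookup_minus lookup_single when_def)
    have g: "gen_poly b (?a + Poly_Mapping.single n c) = gen_poly b ?a * gen_poly b (Poly_Mapping.single n c)" for c
      by (rule gen_poly_add) (use keys in \<open>auto split: if_splits\<close>)
    have ae: "a - ?e = ?a + Poly_Mapping.single n (?c - 1)" if "?c > 0"
      by (rule poly_mapping_eqI) (use that in \<open>auto simp: lookup_add lookup_minus lookup_single when_def\<close>)
    have "Poly_Mapping.keys (a - ?e) \<subseteq> Poly_Mapping.keys a"
      by (auto simp: in_keys_iff lookup_minus)
    then have keyse: "Poly_Mapping.keys (a - ?e) \<subseteq> {..<Suc n}" using True by (rule order_trans)
    \<comment> \<open>Exponent \<open>c\<close> of the new variable contributes \<open>1\<close>,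
      \<open>w + b\<close> or \<open>w^(c-1) (w + b)\<close>; multiplication by
      \<open>1 - w x\<close> turns these into \<open>1\<close>, \<open>b\<close> and
      \<open>0\<close>.\<close>
    consider "?c = 0" | "?c = 1" | "?c > 1" by linarith
    then show ?thesis
    proof cases
      case 1
      then have "?a = a" by simp
      then have "Poly_Mapping.keys a \<subseteq> {..<n}" using keys by simp
      then show ?thesis unfolding L R using 1 True by (simp add: mcoeff_mtrunc)
    next
      case 2
      have "n \<in> Poly_Mapping.keys a" using 2 by (simp add: in_keys_iff)
      then have n: "\<not> Poly_Mapping.keys a \<subseteq> {..<n}" by auto
      have e: "a - ?e = ?a" using 2 by simp
      have "gen_poly b a = gen_poly b (?a + Poly_Mapping.single n 1)" using a 2 by simp
      then have ga: "gen_poly b a = gen_poly b ?a * [:b, 1:]"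
        by (simp only: g) (simp add: gen_poly_single)
      have "[:b, 1:] = [:0, 1:] + [:b:]" by simp
      then have "gen_poly b ?a * [:b, 1:] - [:0, 1:] * gen_poly b ?a = [:b:] * gen_poly b ?a"
        by (simp only: distrib_left) simp
      then show ?thesis unfolding L R using 2 True n keys keyse e ga by (simp add: mcoeff_mtrunc)
    next
      case 3
      have "n \<in> Poly_Mapping.keys a" "n \<in> Poly_Mapping.keys (a - ?e)"
        using 3 by (simp_all add: in_keys_iff lookup_minus)
      then have n: "\<not> Poly_Mapping.keys a \<subseteq> {..<n}" "\<not> Poly_Mapping.keys (a - ?e) \<subseteq> {..<n}" by auto
      have c: "?c - 1 = Suc (?c - 1 - 1)" using 3 by simp
      have "gen_poly b a = gen_poly b (?a + Poly_Mapping.single n ?c)" using a by simp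
      also have "\<dots> = gen_poly b ?a * ([:0, 1:] ^ (?c - 1) * [:b, 1:])"
        unfolding g using 3 by (subst gen_poly_single) auto
      also have "[:0, 1:] ^ (?c - 1) = [:0, 1:] * [:0, 1 :: ratfun:] ^ (?c - 1 - 1)"
        by (subst c) (rule power_Suc)
      finally have ga: "gen_poly b a = gen_poly b ?a * ([:0, 1:] * [:0, 1:] ^ (?c - 1 - 1) * [:b, 1:])" .
      have "gen_poly b (a - ?e) = gen_poly b (?a + Poly_Mapping.single n (?c - 1))" using ae 3 by simp
      also have "\<dots> = gen_poly b ?a * ([:0, 1:] ^ (?c - 1 - 1) * [:b, 1:])"
        unfolding g using 3 by (subst gen_poly_single) auto
      finally have "gen_poly b a = [:0, 1:] * gen_poly b (a - ?e)"
        unfolding ga by (simp only: mult_ac)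
      then show ?thesis unfolding L R using 3 True n keyse by (simp add: mcoeff_mtrunc)
    qed
  qed
qed

lemma gen_series_product:
  "(\<Prod>k<n. 1 - mconst [:0, 1:] * mvar k) * mtrunc n (gen_series b) = (\<Prod>k<n. 1 + mconst [:b:] * mvar k)"
proof (induction n)
  case 0
  have "mtrunc 0 (gen_series b) = 1"
    by (rule mfps_eqI) (auto simp: mcoeff_mtrunc mcoeff_1)
  then show ?case by simp
next
  case (Suc n)
  have "(\<Prod>k<Suc n. 1 - mconst [:0, 1:] * mvar k) * mtrunc (Suc n) (gen_series b)
    = (\<Prod>k<n. 1 - mconst [:0, 1:] * mvar k) * (mtrunc (Suc n) (gen_series b) * (1 - mconst [:0, 1:] * mvar n))"
    by (simp only: prod.lessThan_Suc mult_ac)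
  also have "\<dots> = (\<Prod>k<n. 1 - mconst [:0, 1:] * mvar k) * mtrunc n (gen_series b) * (1 + mconst [:b:] * mvar n)"
    by (simp only: gen_series_step mult.assoc)
  finally show ?case by (simp only: Suc prod.lessThan_Suc)
qed

text \<open>From \<open>1 - w x = (1 + b x) - x (w + b)\<close>. Powers of \<open>w + b\<close> are
  wanted because multiplying by them moves along a row of the determinant.\<close>

lemma expand_linear_factors:
  assumes "finite K"
  shows "\<exists>B. (\<Prod>k\<in>K. 1 - mconst [:0, 1:] * mvar k) = (\<Sum>j\<le>card K. lift_mfps (B j) * mconst [:b, 1:] ^ j)"
  using assms
proof (induction K rule: finite_induct)
  case empty
  show ?case by (rule exI[of _ "\<lambda>_. 1"]) simp
next
  case (insert k K)
  let ?T = "mconst [:b, 1:]" and ?N = "card K"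
  obtain B where B: "(\<Prod>k\<in>K. 1 - mconst [:0, 1:] * mvar k) = (\<Sum>j\<le>?N. lift_mfps (B j) * ?T ^ j)"
    using insert.IH by blast
  define c where "c = lift_mfps (1 + mconst b * mvar k)"
  define B' where "B' j = (if j \<le> ?N then (1 + mconst b * mvar k) * B j else 0)
     - (case j of 0 \<Rightarrow> 0 | Suc i \<Rightarrow> mvar k * B i)" for j
  have "[:0, 1:] = [:b, 1:] - [:b:]" by simp
  then have W: "mconst [:0, 1:] = ?T - mconst [:b:]" by (simp only: mconst.hom_minus)
  have f: "1 - mconst [:0, 1:] * mvar k = c - lift_mfps (mvar k) * ?T"
    unfolding W c_def by (simp add: lift_mfps.hom_mult lift_mfps.hom_add lift_mfps_mvar lift_mfps_mconst algebra_simps)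
  have 1: "(\<Sum>j\<le>Suc ?N. lift_mfps (if j \<le> ?N then (1 + mconst b * mvar k) * B j else 0) * ?T ^ j)
    = c * (\<Sum>j\<le>?N. lift_mfps (B j) * ?T ^ j)"
    by (simp add: sum_distrib_left c_def lift_mfps.hom_mult mult.assoc)
  have 2: "(\<Sum>j\<le>Suc ?N. lift_mfps (case j of 0 \<Rightarrow> 0 | Suc i \<Rightarrow> mvar k * B i) * ?T ^ j)
    = lift_mfps (mvar k) * ?T * (\<Sum>j\<le>?N. lift_mfps (B j) * ?T ^ j)"
    by (subst sum.atMost_Suc_shift) (simp add: sum_distrib_left lift_mfps.hom_mult mult_ac)
  have "(\<Prod>k\<in>insert k K. 1 - mconst [:0, 1:] * mvar k)
    = (c - lift_mfps (mvar k) * ?T) * (\<Sum>j\<le>?N. lift_mfps (B j) * ?T ^ j)"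
    unfolding prod.insert[OF insert.hyps] f B ..
  also have "\<dots> = (\<Sum>j\<le>Suc ?N. lift_mfps (B' j) * ?T ^ j)"
    unfolding left_diff_distrib B'_def lift_mfps.hom_minus sum_subtractf 1 2 ..
  also have "Suc ?N = card (insert k K)" using insert.hyps by simp
  finally show ?case by blast
qed

text \<open>The series \<open>1 / (1 - x_l w)\<close>; the condition says that no variable except
  \<open>l\<close> occurs in \<open>a\<close>.\<close>

definition geom :: "nat \<Rightarrow> ratfun poly mfps" where
  "geom l = Abs_mfps (\<lambda>a. if a = Poly_Mapping.single l (Poly_Mapping.lookup a l)
     then monom 1 (Poly_Mapping.lookup a l) else 0)"

lemma mcoeff_geom: "mcoeff (geom l) a = (if a = Poly_Mapping.single l (Poly_Mapping.lookup a l)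
     then monom 1 (Poly_Mapping.lookup a l) else 0)"
  by (simp add: geom_def)

lemma single_minus_single_iff:
  assumes "Poly_Mapping.lookup (a :: monom) l > 0"
  shows "a - Poly_Mapping.single l 1 = Poly_Mapping.single l (Poly_Mapping.lookup a l - 1)
    \<longleftrightarrow> a = Poly_Mapping.single l (Poly_Mapping.lookup a l)" (is "?A \<longleftrightarrow> ?B")
proof
  assume A: ?A
  show ?B
  proof (rule poly_mapping_eqI)
    fix i
    have "Poly_Mapping.lookup (a - Poly_Mapping.single l 1) i
      = Poly_Mapping.lookup (Poly_Mapping.single l (Poly_Mapping.lookup a l - 1)) i"
      using A by (simp only:)
    then show "Poly_Mapping.lookup a i = Poly_Mapping.lookup (Poly_Mapping.single l (Poly_Mapping.lookup a l)) i"
      using assms by (auto simp: lookup_minus lookup_single when_def split: if_splits)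
  qed
next
  assume B: ?B
  show ?A
  proof (rule poly_mapping_eqI)
    fix i
    show "Poly_Mapping.lookup (a - Poly_Mapping.single l 1) i
      = Poly_Mapping.lookup (Poly_Mapping.single l (Poly_Mapping.lookup a l - 1)) i"
    proof (cases "i = l")
      case False
      then have "Poly_Mapping.lookup a i = 0" by (subst B) (simp add: lookup_single)
      then show ?thesis using False by (simp add: lookup_minus lookup_single)
    qed (simp add: lookup_minus)
  qed
qed

lemma geom_inverse: "(1 - mconst [:0, 1:] * mvar l) * geom l = 1"
proof (rule mfps_eqI)
  fix a :: monom
  let ?c = "Poly_Mapping.lookup a l"
  have L: "mcoeff ((1 - mconst [:0, 1:] * mvar l) * geom l) a
    = mcoeff (geom l) a - [:0, 1:] * (if ?c = 0 then 0 else mcoeff (geom l) (a - Poly_Mapping.single l 1))"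
    unfolding left_diff_distrib mult_1_left mcoeff_diff mult.assoc mcoeff_mconst_times mcoeff_mvar_times
    by simp
  show "mcoeff ((1 - mconst [:0, 1:] * mvar l) * geom l) a = mcoeff 1 a"
  proof (cases "?c = 0")
    case True
    then show ?thesis unfolding L by (simp add: mcoeff_geom mcoeff_1)
  next
    case False
    then have "a \<noteq> 0" by auto
    have "monom 1 ?c = [:0, 1:] * monom (1 :: ratfun) (?c - 1)"
      using False by (cases ?c) (simp_all add: monom_Suc)
    moreover have "Poly_Mapping.lookup (a - Poly_Mapping.single l 1) l = ?c - 1"
      by (simp add: lookup_minus)
    ultimately have "mcoeff (geom l) a = [:0, 1:] * mcoeff (geom l) (a - Poly_Mapping.single l 1)"
      using single_minus_single_iff[of a l] False by (simp add: mcoeff_geom)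
    then show ?thesis unfolding L using False \<open>a \<noteq> 0\<close> by (simp add: mcoeff_1)
  qed
qed

lemma mcoeff_mvar_power: "mcoeff (mvar l ^ m) a = (if a = Poly_Mapping.single l m then 1 else 0)"
proof (induction m arbitrary: a)
  case 0
  then show ?case by (simp add: mcoeff_1)
next
  case (Suc m)
  show ?case
  proof (cases "Poly_Mapping.lookup a l = 0")
    case True
    then have "a \<noteq> Poly_Mapping.single l (Suc m)" by auto
    then show ?thesis using True by (simp add: mcoeff_mvar_times)
  next
    case False
    have "a - Poly_Mapping.single l 1 = Poly_Mapping.single l m \<longleftrightarrow> a = Poly_Mapping.single l (Suc m)"
    proof
      assume *: "a - Poly_Mapping.single l 1 = Poly_Mapping.single l m"
      then have "Poly_Mapping.lookup (a - Poly_Mapping.single l 1) l = m" by simp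
      then have "m = Poly_Mapping.lookup a l - 1" by (simp add: lookup_minus)
      then show "a = Poly_Mapping.single l (Suc m)"
        using single_minus_single_iff[of a l] False * by simp
    next
      assume *: "a = Poly_Mapping.single l (Suc m)"
      show "a - Poly_Mapping.single l 1 = Poly_Mapping.single l m"
        unfolding * by (rule poly_mapping_eqI) (simp add: lookup_minus lookup_single when_def)
    qed
    then show ?thesis using False by (simp add: mcoeff_mvar_times Suc.IH)
  qed
qed

text \<open>The functional sends \<open>1 / (1 - x w)\<close> to \<open>x^m (1 + b x)^e\<close>. For
  negative \<open>m\<close> this fails, since the sum over \<open>x^k\<close> is cut off at
  \<open>k = 0\<close>.\<close>

lemma lf_mfps_geom_step:
  assumes "0 \<le> m"
  shows "(1 + mconst b * mvar l) * lf_mfps b m e (geom l) = lf_mfps b m (e + 1) (geom l)"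
proof (rule mfps_eqI)
  fix a :: monom
  let ?c = "Poly_Mapping.lookup a l" and ?e = "Poly_Mapping.single l 1"
  have L: "mcoeff ((1 + mconst b * mvar l) * lf_mfps b m e (geom l)) a
    = lf b m e (mcoeff (geom l) a) + b * (if ?c = 0 then 0 else lf b m e (mcoeff (geom l) (a - ?e)))"
    unfolding distrib_right mult_1_left mcoeff_add mult.assoc mcoeff_mconst_times mcoeff_mvar_times
    by simp
  show "mcoeff ((1 + mconst b * mvar l) * lf_mfps b m e (geom l)) a = mcoeff (lf_mfps b m (e + 1) (geom l)) a"
  proof (cases ?c)
    case 0
    have "lfc b m e 0 = lfc b m (e + 1) 0" using assms by (simp add: lfc_def)
    then show ?thesis unfolding L using 0 by (simp add: mcoeff_geom lf_monom lf_1)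
  next
    case (Suc c)
    have "Poly_Mapping.lookup (a - ?e) l = c" using Suc by (simp add: lookup_minus)
    moreover have "b * lfc b m e c + lfc b m e (Suc c) = lfc b m (e + 1) (Suc c)"
      by (simp add: lfc_Suc lfc_pascal)
    ultimately show ?thesis unfolding L using single_minus_single_iff[of a l] Suc
      by (simp add: mcoeff_geom lf_monom add.commute lookup_minus)
  qed
qed

lemma lf_mfps_geom_power:
  assumes "0 \<le> m"
  shows "(1 + mconst b * mvar l) ^ k * lf_mfps b m e (geom l) = lf_mfps b m (e + int k) (geom l)"
proof (induction k arbitrary: e)
  case (Suc k)
  show ?case
    unfolding power_Suc2 mult.assoc lf_mfps_geom_step[OF assms] Suc by (simp add: add.assoc)
qed simp

lemma lf_mfps_geom_0: "lf_mfps b (int m) 0 (geom l) = mvar l ^ m"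
  by (rule mfps_eqI) (auto simp: mcoeff_geom lf_monom lfc_exponent_0 mcoeff_mvar_power)

lemma lf_mfps_geom:
  "(1 + mconst b * mvar l) ^ n * lf_mfps b (int m) (int i - int n) (geom l) = mvar l ^ m * (1 + mconst b * mvar l) ^ i"
  using lf_mfps_geom_power[of "int m" b l n "int i - int n"] lf_mfps_geom_power[of "int m" b l i 0]
  by (simp add: lf_mfps_geom_0 mult.commute)

text \<open>Multiplying the generating series by all factors \<open>1 - x_k w\<close> except one
  leaves a multiple of a single geometric series, on which the row functional gives an entry of the
  alternant. Expanded in powers of \<open>w + b\<close>, the product of factors becomes a
  combination of the entries of the row with coefficients free of the row and of the sequence
  \<open>l\<close>. So the Jacobi-Trudi matrix times one fixed matrix is the alternant, up to
  factors that also do not depend on \<open>l\<close>.\<close>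

lemma mtrunc_jacobi_trudi_factor:
  obtains D c where "nonzerodiv c"
    "\<And>l. mtrunc n (jacobi_trudi b n l (\<lambda>_. 0)) * D
      = c * fdet n (\<lambda>i j. mvar i ^ (l j + (n - 1 - j)) * (1 + mconst b * mvar i) ^ j)"
proof -
  let ?T = "mconst [:b, 1:]" and ?W = "mconst [:0, 1 :: ratfun:]"
  have "\<exists>B. (\<Prod>k\<in>{..<n} - {l}. 1 - ?W * mvar k) = (\<Sum>j<n. lift_mfps (B j) * ?T ^ (n - 1 - j))" if "l < n" for l
  proof -
    obtain B where B: "(\<Prod>k\<in>{..<n} - {l}. 1 - ?W * mvar k) = (\<Sum>j\<le>card ({..<n} - {l}). lift_mfps (B j) * ?T ^ j)"
      using expand_linear_factors[of "{..<n} - {l}" b] by auto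
    have "{..card ({..<n} - {l})} = {..<n}" using that by auto
    then have "(\<Prod>k\<in>{..<n} - {l}. 1 - ?W * mvar k) = (\<Sum>j<n. lift_mfps (B j) * ?T ^ j)"
      using B by (simp only:)
    \<comment> \<open>Reversal pairs the power \<open>n - 1 - j\<close> with column
      \<open>j\<close>.\<close>
    also have "\<dots> = (\<Sum>j<n. lift_mfps (B (n - Suc j)) * ?T ^ (n - Suc j))"
      by (rule sum.nat_diff_reindex[symmetric])
    finally show ?thesis by (intro exI[of _ "\<lambda>j. B (n - Suc j)"]) simp
  qed
  then have "\<forall>l\<in>{..<n}. \<exists>B. (\<Prod>k\<in>{..<n} - {l}. 1 - ?W * mvar k) = (\<Sum>j<n. lift_mfps (B j) * ?T ^ (n - 1 - j))"
    by (simp only: lessThan_iff Ball_def) blast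
  from bchoice[OF this] obtain B where B: "\<And>l. l < n \<Longrightarrow>
      (\<Prod>k\<in>{..<n} - {l}. 1 - ?W * mvar k) = (\<Sum>j<n. lift_mfps (B l j) * ?T ^ (n - 1 - j))"
    unfolding Ball_def lessThan_iff by blast
  define En where "En = (\<Prod>k<n. 1 + mconst b * mvar k :: ratfun mfps)"
  have liftEn: "lift_mfps En = (\<Prod>k<n. 1 + mconst [:b:] * mvar k)"
    by (simp add: En_def lift_mfps.hom_prod lift_mfps.hom_add lift_mfps.hom_mult lift_mfps_mvar lift_mfps_mconst)
  have Y: "mtrunc n (gen_series b) * (\<Prod>k\<in>{..<n} - {l}. 1 - ?W * mvar k) = lift_mfps En * geom l" if "l < n" for l
  proof -
    have "(\<Prod>k<n. 1 - ?W * mvar k) = (1 - ?W * mvar l) * (\<Prod>k\<in>{..<n} - {l}. 1 - ?W * mvar k)"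
      using that by (subst prod.remove[of _ l]) auto
    then have "lift_mfps En * geom l
      = mtrunc n (gen_series b) * (\<Prod>k\<in>{..<n} - {l}. 1 - ?W * mvar k) * ((1 - ?W * mvar l) * geom l)"
      unfolding liftEn gen_series_product[symmetric] by (simp only: mult_ac)
    then show ?thesis by (simp only: geom_inverse mult_1_right)
  qed
  \<comment> \<open>The power \<open>n\<close> clears the exponent \<open>i - n\<close>, which is
    negative in every row.\<close>
  define D where "D = fdet n (\<lambda>j l. B l j * (1 + mconst b * mvar l) ^ n)"
  have main: "mtrunc n (jacobi_trudi b n u (\<lambda>_. 0)) * D
      = En ^ n * fdet n (\<lambda>i j. mvar i ^ (u j + (n - 1 - j)) * (1 + mconst b * mvar i) ^ j)" for u
  proof -
    have *: "(\<Sum>j<n. mtrunc n (entry b (int (u i) - int 0 - int i + int j) (int i - int j - 1)) * (B l j * (1 + mconst b * mvar l) ^ n))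
      = En * (mvar l ^ (u i + (n - 1 - i)) * (1 + mconst b * mvar l) ^ i)" if il: "i < n" "l < n" for i l
    proof -
      \<comment> \<open>Index and exponent of row \<open>i\<close> before the shift by
        \<open>(w + b)^(n-1-j)\<close>, which turns \<open>i - n\<close> into
        \<open>i - j - 1\<close>.\<close>
      let ?m = "int (u i + (n - 1 - i))" and ?e = "int i - int n"
      have "mtrunc n (entry b (int (u i) - int 0 - int i + int j) (int i - int j - 1))
         = lf_mfps b ?m ?e (?T ^ (n - 1 - j) * mtrunc n (gen_series b))" if "j < n" for j
      proof -
        have "?m - int (n - 1 - j) = int (u i) - int 0 - int i + int j" "?e + int (n - 1 - j) = int i - int j - 1"
          using il that by auto
        then show ?thesis
          unfolding lf_mfps_w_plus_b_power entry_eq_lf_mfps mtrunc_lf_mfps by (simp only:)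
      qed
      then have "(\<Sum>j<n. mtrunc n (entry b (int (u i) - int 0 - int i + int j) (int i - int j - 1)) * (B l j * (1 + mconst b * mvar l) ^ n))
        = (\<Sum>j<n. lf_mfps b ?m ?e (?T ^ (n - 1 - j) * mtrunc n (gen_series b)) * (B l j * (1 + mconst b * mvar l) ^ n))"
        by (intro sum.cong) simp_all
      also have "\<dots> = (1 + mconst b * mvar l) ^ n * (\<Sum>j<n. B l j * lf_mfps b ?m ?e (?T ^ (n - 1 - j) * mtrunc n (gen_series b)))"
        unfolding sum_distrib_left by (rule sum.cong) (simp_all only: mult_ac)
      also have "(\<Sum>j<n. B l j * lf_mfps b ?m ?e (?T ^ (n - 1 - j) * mtrunc n (gen_series b)))
        = lf_mfps b ?m ?e (mtrunc n (gen_series b) * (\<Sum>j<n. lift_mfps (B l j) * ?T ^ (n - 1 - j)))"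
        unfolding lf_mfps_lift_times[symmetric] lf_mfps_sum[symmetric] sum_distrib_left
        by (simp only: mult_ac)
      also have "\<dots> = En * lf_mfps b ?m ?e (geom l)"
        unfolding B[OF il(2), symmetric] Y[OF il(2)] lf_mfps_lift_times ..
      also have "(1 + mconst b * mvar l) ^ n * \<dots>
        = En * ((1 + mconst b * mvar l) ^ n * lf_mfps b ?m ?e (geom l))"
        by (simp only: mult_ac)
      finally show ?thesis by (simp only: lf_mfps_geom)
    qed
    have "mtrunc n (jacobi_trudi b n u (\<lambda>_. 0)) * D
      = fdet n (\<lambda>i l. \<Sum>j<n. mtrunc n (entry b (int (u i) - int 0 - int i + int j) (int i - int j - 1)) * (B l j * (1 + mconst b * mvar l) ^ n))"
      unfolding jacobi_trudi_def mtrunc.hom_fdet D_def fdet_mult ..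
    also have "\<dots> = fdet n (\<lambda>i l. En * (mvar l ^ (u i + (n - 1 - i)) * (1 + mconst b * mvar l) ^ i))"
      by (rule fdet_cong) (rule *)
    also have "\<dots> = En ^ n * fdet n (\<lambda>i l. mvar l ^ (u i + (n - 1 - i)) * (1 + mconst b * mvar l) ^ i)"
      by (subst fdet_scale_rows) simp
    finally show ?thesis by (simp only: fdet_transpose[of n "\<lambda>i j. mvar i ^ (u j + (n - 1 - j)) * (1 + mconst b * mvar i) ^ j"])
  qed
  have "nonzerodiv (En ^ n)"
    unfolding En_def by (intro nonzerodiv_power nonzerodiv_prod nonzerodiv_one_plus_mvar)
  then show ?thesis using main that by blast
qed

text \<open>The determinant \<open>D\<close> is never computed. The zero sequence, whose
  Jacobi-Trudi determinant is \<open>1\<close> and whose alternant is the Vandermonde determinant,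
  forces \<open>D = c * vandermonde n\<close>, and then \<open>c\<close> cancels.\<close>

theorem bialternant_square:
  "mtrunc n (jacobi_trudi b n l (\<lambda>_. 0)) * vandermonde n
    = fdet n (\<lambda>i j. mvar i ^ (l j + (n - 1 - j)) * (1 + mconst b * mvar i) ^ j)"
proof -
  obtain D c where c: "nonzerodiv c" and D: "\<And>l. mtrunc n (jacobi_trudi b n l (\<lambda>_. 0)) * D
      = c * fdet n (\<lambda>i j. mvar i ^ (l j + (n - 1 - j)) * (1 + mconst b * mvar i) ^ j)"
    using mtrunc_jacobi_trudi_factor[of n b] by blast
  have "D = c * vandermonde n"
    using D[of "\<lambda>_. 0"] by (simp add: jacobi_trudi_empty vandermonde_eq_fdet[of n b])
  then have "c * (mtrunc n (jacobi_trudi b n l (\<lambda>_. 0)) * vandermonde n)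
     = c * fdet n (\<lambda>i j. mvar i ^ (l j + (n - 1 - j)) * (1 + mconst b * mvar i) ^ j)"
    using D[of l] by (simp only: mult_ac)
  then show ?thesis by (rule nonzerodiv_cancel[OF c])
qed


section \<open>Duality and the coproduct\<close>

lemma part_antimono: "i \<le> j \<Longrightarrow> part lam j \<le> part lam i"
  using part[of lam] by (auto simp: monotone_def)

lemma part_eq_0_iff: "part lam i = 0 \<longleftrightarrow> plength lam \<le> i"
proof -
  let ?S = "{i. part lam i \<noteq> 0}"
  have fin: "finite ?S" using part[of lam] by auto
  have down: "j \<in> ?S \<Longrightarrow> i \<le> j \<Longrightarrow> i \<in> ?S" for i j
    using part_antimono[of i j lam] by auto
  have "?S = {..<card ?S}"
  proof -
    have "i < card ?S" if "i \<in> ?S" for i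
    proof -
      have "{..i} \<subseteq> ?S" using down[OF that] by auto
      then show ?thesis using card_mono[OF fin, of "{..i}"] by simp
    qed
    moreover have "i \<in> ?S" if "i < card ?S" for i
    proof (rule ccontr)
      assume "i \<notin> ?S"
      then have "?S \<subseteq> {..<i}" using down by (meson lessThan_iff linorder_not_less subsetI)
      then show False using card_mono[of "{..<i}" ?S] that by simp
    qed
    ultimately show ?thesis by blast
  qed
  then have "i \<in> ?S \<longleftrightarrow> i < plength lam" unfolding plength_def by blast
  then show ?thesis by auto
qed

lemma partition_eqI: "(\<And>i. part lam i = part mu i) \<Longrightarrow> lam = mu"
  by (metis ext part_inject)

lemma part_subset_refl [simp]: "part_subset lam lam"
  by (simp add: part_subset_def)

lemma part_subset_trans: "part_subset lam mu \<Longrightarrow> part_subset mu nu \<Longrightarrow> part_subset lam nu"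
  unfolding part_subset_def using order_trans by blast

lemma part_subset_antisym: "part_subset lam mu \<Longrightarrow> part_subset mu lam \<Longrightarrow> lam = mu"
  unfolding part_subset_def by (intro partition_eqI antisym) auto

lemma plength_mono: 
  assumes "part_subset mu lam"
  shows "plength mu \<le> plength lam"
proof -
  have "part lam (plength lam) = 0" by (simp add: part_eq_0_iff)
  then have "part mu (plength lam) = 0" using assms unfolding part_subset_def by (metis le_zero_eq)
  then show ?thesis by (simp add: part_eq_0_iff)
qed

lemma finite_partition_bounded: "finite {mu. plength mu \<le> n \<and> part mu 0 \<le> d}"
proof -
  let ?S = "{mu. plength mu \<le> n \<and> part mu 0 \<le> d}"
  let ?r = "\<lambda>mu. restrict (part mu) {..<n}"
  have "inj_on ?r ?S"
  proof (rule inj_onI)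
    fix mu nu assume mu: "mu \<in> ?S" and nu: "nu \<in> ?S" and eq: "?r mu = ?r nu"
    show "mu = nu"
    proof (rule partition_eqI)
      fix i show "part mu i = part nu i"
      proof (cases "i < n")
        case True
        then show ?thesis using fun_cong[OF eq, of i] by simp
      next
        case False
        then have "part mu i = 0" "part nu i = 0" using mu nu by (simp_all add: part_eq_0_iff)
        then show ?thesis by simp
      qed
    qed
  qed
  moreover have "?r ` ?S \<subseteq> PiE {..<n} (\<lambda>_. {..d})"
  proof -
    have "part mu i \<le> d" if "mu \<in> ?S" for mu i
      using that part_antimono[of 0 i mu] by simp
    then show ?thesis by (auto simp: PiE_def Pi_def extensional_def)
  qed
  moreover have "finite (PiE {..<n} (\<lambda>_. {..d}))" by (rule finite_PiE) auto
  ultimately show ?thesis using finite_imageD finite_subset by blast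
qed

lemma finite_part_subset: "finite {mu. part_subset mu lam}"
proof -
  have "{mu. part_subset mu lam} \<subseteq> {mu. plength mu \<le> plength lam \<and> part mu 0 \<le> part lam 0}"
    using plength_mono by (auto simp: part_subset_def)
  then show ?thesis using finite_partition_bounded finite_subset by blast
qed

section \<open>Row functionals, dual columns and their duality\<close>

definition row_functional :: "ratfun \<Rightarrow> nat \<Rightarrow> partition \<Rightarrow> nat \<Rightarrow> ratfun poly \<Rightarrow> ratfun" where
  "row_functional b r lam i = lf b (int (part lam i) + int r - 1 - int i) (int i - int r)"

text \<open>If \<open>mu_j > 0\<close>, one factor \<open>w\<close> of
  \<open>w^(mu_j) (w + b)^(r-1-j)\<close> is exchanged for \<open>w + b\<close>, which raises the
  exponent from \<open>i - j - 1\<close> to \<open>i - j\<close>. If \<open>mu_j = 0\<close> there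
  is no factor to exchange, and such a column never meets the block that has to vanish. The degree
  is \<open>mu_j + r - 1 - j\<close> either way.\<close>

definition dual_column :: "ratfun \<Rightarrow> nat \<Rightarrow> partition \<Rightarrow> nat \<Rightarrow> ratfun poly" where
  "dual_column b r mu j = (if part mu j = 0 then [:b, 1:] ^ (r - 1 - j)
     else [:0, 1:] ^ (part mu j - 1) * [:b, 1:] ^ (r - j))"

definition dual_exponent :: "partition \<Rightarrow> nat \<Rightarrow> nat \<Rightarrow> int" where
  "dual_exponent mu i j = int i - int j - (if part mu j = 0 then 1 else 0)"

definition content_shift :: "partition \<Rightarrow> partition \<Rightarrow> nat \<Rightarrow> nat \<Rightarrow> int" where
  "content_shift lam mu i j = int (part lam i) - int (part mu j) - int i + int j"

lemma row_functional_dual_column: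
  assumes "j < r"
  shows "row_functional b r lam i (dual_column b r mu j * g)
    = lf b (content_shift lam mu i j) (dual_exponent mu i j) g"
proof (cases "part mu j = 0")
  case True
  have 1: "int (part lam i) + int r - 1 - int i - int (r - 1 - j) = content_shift lam mu i j"
    using True assms by (simp add: content_shift_def)
  have 2: "int i - int r + int (r - 1 - j) = dual_exponent mu i j"
    using True assms by (simp add: dual_exponent_def)
  show ?thesis
    unfolding row_functional_def dual_column_def
    by (simp only: True simp_thms if_True lf_times_w_plus_b_power 1 2)
next
  case False
  have 1: "int (part lam i) + int r - 1 - int i - int (part mu j - 1) - int (r - j) = content_shift lam mu i j"
    using False assms by (simp add: content_shift_def of_nat_diff)
  have 2: "int i - int r + int (r - j) = dual_exponent mu i j"
    using False assms by (simp add: dual_exponent_def)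
  show ?thesis
    unfolding row_functional_def dual_column_def
    by (simp only: False simp_thms if_False mult.assoc lf_times_w_power lf_times_w_plus_b_power 1 2)
qed

definition dslash_det :: "ratfun \<Rightarrow> nat \<Rightarrow> partition \<Rightarrow> partition \<Rightarrow> ratfun mfps" where
  "dslash_det b r lam mu = fdet r (\<lambda>i j. entry b (content_shift lam mu i j) (dual_exponent mu i j))"

lemma mcoeff_dslash_det:
  "mcoeff (dslash_det b r lam mu) a
    = (\<Sum>g\<in>families r a. fdet r (\<lambda>i j. row_functional b r lam i (dual_column b r mu j * gen_poly b (g i))))"
  unfolding dslash_det_def mcoeff_fdet
  by (intro sum.cong refl fdet_cong) (simp add: mcoeff_entry row_functional_dual_column)

lemma symmetric_dslash_det: "symmetric (dslash_det b r lam mu)"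
  unfolding dslash_det_def by (rule symmetric_fdet) (rule symmetric_entry)

definition empty_partition :: partition where
  "empty_partition = Abs_partition (\<lambda>_. 0)"

lemma part_empty [simp]: "part empty_partition i = 0"
  by (simp add: empty_partition_def Abs_partition_inverse monotone_def)

lemma dslash_det_empty: "dslash_det b r lam empty_partition = jacobi_trudi b r (part lam) (\<lambda>_. 0)"
  unfolding dslash_det_def jacobi_trudi_def by (simp add: content_shift_def dual_exponent_def)

text \<open>If \<open>lam\<close> is shorter than \<open>mu\<close> in row \<open>k\<close>, then
  for \<open>i \<ge> k \<ge> j\<close> the exponent is \<open>i - j \<ge> 0\<close> and the index
  lies below \<open>-(i - j)\<close>, so the functional kills every multiple of the column. Hence
  the multipliers \<open>g\<close> may be arbitrary.\<close>

lemma fdet_dual_zero: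
  assumes "\<not> part_subset mu lam" "plength mu \<le> r"
  shows "fdet r (\<lambda>i j. row_functional b r lam i (dual_column b r mu j * g i j)) = 0"
proof -
  obtain k where k: "part lam k < part mu k" using assms(1) by (auto simp: part_subset_def not_le)
  then have kr: "k < r" using assms(2) part_eq_0_iff[of mu k] by (metis gr_implies_not0 linorder_not_less order_trans)
  show ?thesis
  proof (rule fdet_block_zero[OF kr])
    fix i j assume ij: "k \<le> i" "i < r" "j \<le> k"
    have "part lam i \<le> part lam k" "part mu k \<le> part mu j" using ij by (auto intro: part_antimono)
    then have "dual_exponent mu i j = int i - int j" "content_shift lam mu i j < - (int i - int j)"
      using k by (auto simp: dual_exponent_def content_shift_def)
    then have "lf b (content_shift lam mu i j) (dual_exponent mu i j) (g i j) = 0"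
      using ij by (intro lf_zero_low) auto
    then show "row_functional b r lam i (dual_column b r mu j * g i j) = 0"
      using ij by (subst row_functional_dual_column) auto
  qed
qed

text \<open>If \<open>mu\<close> is not inside \<open>lam\<close>, a lower left block vanishes. If
  \<open>lam\<close> is not inside \<open>mu\<close>, an upper right block does, because a constant
  has no coefficient of positive index. For equal partitions the matrix is triangular with unit
  diagonal.\<close>

lemma fdet_duality:
  assumes "plength lam \<le> r" "plength mu \<le> r"
  shows "fdet r (\<lambda>i j. row_functional b r lam i (dual_column b r mu j)) = (if lam = mu then 1 else 0)"
proof -
  have e: "row_functional b r lam i (dual_column b r mu j) = lfc b (content_shift lam mu i j) (dual_exponent mu i j) 0"
    if "j < r" for i j
    using row_functional_dual_column[OF that, of b lam i mu 1] by (simp add: lf_1)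
  consider "\<not> part_subset mu lam" | "part_subset mu lam" "lam \<noteq> mu" | "lam = mu" by blast
  then show ?thesis
  proof cases
    case 1
    then show ?thesis using fdet_dual_zero[OF 1 assms(2), of b "\<lambda>_ _. 1"] by auto
  next
    case 2
    then have "\<not> part_subset lam mu" using part_subset_antisym by blast
    then obtain k where k: "part mu k < part lam k" by (auto simp: part_subset_def not_le)
    then have kr: "k < r" using assms(1) part_eq_0_iff[of lam k] by (metis gr_implies_not0 linorder_not_less order_trans)
    have "fdet r (\<lambda>j i. row_functional b r lam i (dual_column b r mu j)) = 0"
    proof (rule fdet_block_zero[OF kr])
      fix j i assume ij: "k \<le> j" "j < r" "i \<le> k"
      have "part lam k \<le> part lam i" "part mu j \<le> part mu k" using ij by (auto intro: part_antimono)
      then have "content_shift lam mu i j > 0" using k ij by (simp add: content_shift_def)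
      then show "row_functional b r lam i (dual_column b r mu j) = 0"
        using ij by (subst e) (auto intro: lfc_zero_high)
    qed
    then show ?thesis using 2 by (simp add: fdet_transpose[of r "\<lambda>i j. row_functional b r lam i (dual_column b r mu j)"])
  next
    case 3
    have "fdet r (\<lambda>i j. row_functional b r lam i (dual_column b r mu j)) = (\<Prod>i<r. row_functional b r lam i (dual_column b r mu i))"
    proof (rule fdet_lower_triangular)
      fix i j assume "i < j" "j < r"
      moreover have "part lam j \<le> part lam i" using \<open>i < j\<close> by (intro part_antimono) simp
      ultimately show "row_functional b r lam i (dual_column b r mu j) = 0"
        using 3 by (subst e) (auto intro!: lfc_zero_high simp: content_shift_def)
    qed
    also have "\<dots> = 1"
    proof (rule prod.neutral, rule ballI)
      fix i assume "i \<in> {..<r}"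
      then have "row_functional b r lam i (dual_column b r mu i)
        = lfc b (content_shift lam mu i i) (dual_exponent mu i i) 0" by (intro e) simp
      also have "\<dots> = 1" using 3 by (simp add: content_shift_def lfc_def)
      finally show "row_functional b r lam i (dual_column b r mu i) = 1" .
    qed
    finally show ?thesis using 3 by simp
  qed
qed

section \<open>Alternating forms in polynomials and their expansion in dual columns\<close>

definition linear_functional :: "(ratfun poly \<Rightarrow> ratfun) \<Rightarrow> bool" where
  "linear_functional f \<longleftrightarrow> (\<forall>p q c. f (p + smult c q) = f p + c * f q)"

lemma linear_functional_0:
  assumes "linear_functional f"
  shows "f 0 = 0"
  using assms[unfolded linear_functional_def, rule_format, of 0 1 0] by simp

lemma linear_functional_lf: "linear_functional (\<lambda>p. lf b m e (g * p))"
  by (simp add: linear_functional_def distrib_left lf_add lf_smult)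

lemma linear_row_functional: "linear_functional (row_functional b r lam i)"
  unfolding row_functional_def using linear_functional_lf[of b _ _ 1] by simp

lemma linear_row_functional_times: "linear_functional (\<lambda>p. row_functional b r lam i (g * p))"
  unfolding row_functional_def by (rule linear_functional_lf)

text \<open>The polynomials index the rows of \<open>fdet\<close>, so that the row lemmas apply to
  them.\<close>

definition functional_det :: "nat \<Rightarrow> (nat \<Rightarrow> ratfun poly \<Rightarrow> ratfun) \<Rightarrow> (nat \<Rightarrow> ratfun poly) \<Rightarrow> ratfun" where
  "functional_det r f p = fdet r (\<lambda>j i. f i (p j))"

lemma functional_det_alt: "functional_det r f p = fdet r (\<lambda>i j. f i (p j))"
  unfolding functional_det_def by (rule fdet_transpose)

lemma functional_det_cong: "(\<And>j. j < r \<Longrightarrow> p j = q j) \<Longrightarrow> functional_det r f p = functional_det r f q"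
  unfolding functional_det_def by (rule fdet_cong) simp

lemma functional_det_linear:
  assumes "\<And>i. linear_functional (f i)" "k < r"
  shows "functional_det r f (p(k := u + smult c v)) = functional_det r f (p(k := u)) + c * functional_det r f (p(k := v))"
proof -
  have *: "(\<lambda>j i. f i ((p(k := w)) j)) = (\<lambda>j i. f i (p j))(k := \<lambda>i. f i w)" for w
    by (auto simp: fun_eq_iff)
  have "(\<lambda>i. f i (u + smult c v)) = (\<lambda>i. f i u + c * f i v)"
    using assms(1) by (simp add: linear_functional_def)
  then show ?thesis unfolding functional_det_def * using fdet_row_linear[OF assms(2)] by simp
qed

lemma functional_det_zero:
  assumes "\<And>i. linear_functional (f i)" "k < r" "p k = 0"
  shows "functional_det r f p = 0"
  unfolding functional_det_def
  by (rule fdet_row_zero[OF assms(2)]) (simp add: assms(3) linear_functional_0[OF assms(1)])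

lemma functional_det_add:
  assumes "\<And>i. linear_functional (f i)" "k < r" "l < r" "k \<noteq> l"
  shows "functional_det r f (p(k := p k + smult c (p l))) = functional_det r f p"
proof -
  have "functional_det r f (p(k := p l)) = 0"
    unfolding functional_det_def by (rule fdet_equal_rows[of k r l]) (use assms in auto)
  then show ?thesis using functional_det_linear[of f k r p "p k" c "p l", OF assms(1,2)] by simp
qed

lemma functional_det_swap:
  assumes "k < r" "l < r" "k \<noteq> l"
  shows "functional_det r f (p \<circ> Transposition.transpose k l) = - functional_det r f p"
proof -
  have "Transposition.transpose k l permutes {..<r}" by (rule permutes_swap_id) (use assms in auto)
  from fdet_permute_rows[OF this, where f = "\<lambda>j i. f i (p j)"] show ?thesis
    using assms(3) by (simp add: functional_det_def sign_swap_id)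
qed

lemma degree_cancel_lead:
  assumes "degree q = degree p" "q \<noteq> 0"
  shows "p - smult (lead_coeff p / lead_coeff q) q = 0
    \<or> degree (p - smult (lead_coeff p / lead_coeff q) q) < degree (p :: ratfun poly)"
proof -
  let ?p = "p - smult (lead_coeff p / lead_coeff q) q"
  have "degree ?p \<le> degree p" using assms(1) by (intro degree_diff_le) (auto intro: order_trans[OF degree_smult_le])
  moreover have "coeff q (degree p) \<noteq> 0" using assms by (metis leading_coeff_0_iff)
  then have "coeff ?p (degree p) = 0" by (simp add: assms(1))
  ultimately show ?thesis by (metis leading_coeff_0_iff le_neq_implies_less)
qed

lemma degree_dual_column: "j < r \<Longrightarrow> degree (dual_column b r mu j) = part mu j + (r - 1 - j)"
  by (auto simp: dual_column_def degree_mult_eq degree_power_eq)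

text \<open>Strictly decreasing degrees are a partition plus the staircase, hence the degrees of the
  dual columns of that partition.\<close>

lemma ex_partition:
  assumes "\<And>j. Suc j < r \<Longrightarrow> d (Suc j) < d j"
  shows "\<exists>nu. plength nu \<le> r \<and> (\<forall>j<r. part nu j + (r - 1 - j) = d j)"
proof -
  define p where "p j = (if j < r then d j - (r - 1 - j) else 0)" for j
  have ge: "r - 1 - j \<le> d j" if "j < r" for j
    using that
  proof (induction "r - 1 - j" arbitrary: j)
    case (Suc n)
    then have "n = r - 1 - Suc j" "Suc j < r" by auto
    then have "r - 1 - Suc j \<le> d (Suc j)" using Suc.hyps(1) by blast
    then show ?case using assms[OF \<open>Suc j < r\<close>] \<open>Suc j < r\<close> by linarith
  qed simp
  have "p (Suc j) \<le> p j" for j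
  proof (cases "Suc j < r")
    case True
    then show ?thesis using assms[OF True] ge[OF True] by (simp add: p_def)
  qed (simp add: p_def)
  then have anti: "antimono p" by (simp add: decseq_SucI)
  have "finite {i. p i \<noteq> 0}" by (rule finite_subset[of _ "{..<r}"]) (auto simp: p_def)
  then have P: "part (Abs_partition p) = p" using anti by (simp add: Abs_partition_inverse)
  have "part (Abs_partition p) r = 0" unfolding P by (simp add: p_def)
  then have "plength (Abs_partition p) \<le> r" by (simp add: part_eq_0_iff)
  moreover have "part (Abs_partition p) j + (r - 1 - j) = d j" if "j < r" for j
    unfolding P p_def by (simp only: that if_True le_add_diff_inverse2[OF ge[OF that]])
  ultimately show ?thesis by blast
qed

text \<open>The induction runs on \<open>\<Sum>j<r. (j + 1) * degree (p j)\<close>, which drops both when a leading term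
  is cancelled and when two columns are swapped towards decreasing degrees.\<close>

lemma resolution_of_identity:
  assumes lin: "\<And>i. linear_functional (f i)"
    and fin: "finite S" and S: "\<And>mu. mu \<in> S \<Longrightarrow> plength mu \<le> r"
    and out: "\<And>mu. plength mu \<le> r \<Longrightarrow> mu \<notin> S \<Longrightarrow> functional_det r f (dual_column b r mu) = 0"
  shows "functional_det r f p
    = (\<Sum>mu\<in>S. functional_det r (row_functional b r mu) p * functional_det r f (dual_column b r mu))"
proof -
  define C where "C p \<longleftrightarrow> functional_det r f p
    = (\<Sum>mu\<in>S. functional_det r (row_functional b r mu) p * functional_det r f (dual_column b r mu))" for p
  have C0: "C p" if "k < r" "p k = 0" for p k
    unfolding C_def
    using functional_det_zero[of f k r p, OF lin that]
      functional_det_zero[of "row_functional b r _" k r p, OF linear_row_functional that] by simp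
  have Clin: "C (p(k := u + smult c v))" if "k < r" "C (p(k := u))" "C (p(k := v))" for p k u c v
    using that(2,3) unfolding C_def functional_det_linear[of f, OF lin that(1)] functional_det_linear[of "row_functional b r _", OF linear_row_functional that(1)]
    by (simp add: sum.distrib sum_distrib_left algebra_simps)
  have Cadd: "C p" if "k < r" "l < r" "k \<noteq> l" "C (p(k := p k + smult c (p l)))" for p k l c
    using that(4) unfolding C_def functional_det_add[of f, OF lin that(1-3)]
      functional_det_add[of "row_functional b r _", OF linear_row_functional that(1-3)] .
  have Cswap: "C p" if "k < r" "l < r" "k \<noteq> l" "C (p \<circ> Transposition.transpose k l)" for p k l
    using that(4) unfolding C_def functional_det_swap[OF that(1-3)]
    by (simp add: sum_negf)
  \<comment> \<open>On dual columns the sum collapses by \<open>fdet_duality\<close>; for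
    \<open>nu\<close> outside \<open>S\<close> both sides vanish, the left one by
    \<open>out\<close>.\<close>
  have Cdual: "C (dual_column b r nu)" if "plength nu \<le> r" for nu
  proof -
    have "(\<Sum>mu\<in>S. functional_det r (row_functional b r mu) (dual_column b r nu) * functional_det r f (dual_column b r mu))
      = (\<Sum>mu\<in>S. if mu = nu then functional_det r f (dual_column b r mu) else 0)"
      by (rule sum.cong) (auto simp: functional_det_alt fdet_duality S that)
    then show ?thesis unfolding C_def using out[OF that] fin by simp
  qed
  have Ccong: "C p \<longleftrightarrow> C q" if "\<And>j. j < r \<Longrightarrow> p j = q j" for p q
    unfolding C_def using functional_det_cong[of r p q] that by simp
  define M where "M p = (\<Sum>j<r. Suc j * degree (p j))" for p :: "nat \<Rightarrow> ratfun poly"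
  have M_upd: "M (p(k := u)) < M q" if "k < r" "degree u < degree (q k)" "\<And>j. j < r \<Longrightarrow> j \<noteq> k \<Longrightarrow> degree (p j) = degree (q j)"
    for p q k u
  proof -
    have "M (p(k := u)) = Suc k * degree u + (\<Sum>j\<in>{..<r} - {k}. Suc j * degree (q j))"
      unfolding M_def using that by (subst sum.remove[of _ k]) (auto intro!: sum.cong)
    moreover have "M q = Suc k * degree (q k) + (\<Sum>j\<in>{..<r} - {k}. Suc j * degree (q j))"
      unfolding M_def using that(1) by (subst sum.remove[of _ k]) auto
    ultimately show ?thesis using mult_less_mono2[OF that(2), of "Suc k"] by linarith
  qed
  have "C p"
  proof (induction "M p" arbitrary: p rule: less_induct)
    case less
    consider (zero) k where "k < r" "p k = 0"
      | (eq) k where "Suc k < r" "degree (p k) = degree (p (Suc k))" "p (Suc k) \<noteq> 0"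
      | (lt) k where "Suc k < r" "degree (p k) < degree (p (Suc k))"
      | (dec) "\<And>k. Suc k < r \<Longrightarrow> degree (p (Suc k)) < degree (p k)" "\<And>k. k < r \<Longrightarrow> p k \<noteq> 0"
      by (meson linorder_neqE_nat)
    then show ?case
    proof cases
      case zero
      then show ?thesis by (rule C0)
    next
      case eq
      let ?c = "lead_coeff (p k) / lead_coeff (p (Suc k))"
      let ?u = "p k + smult (- ?c) (p (Suc k))"
      have *: "C (p(k := ?u))"
      proof (cases "?u = 0")
        case True
        then show ?thesis using eq by (intro C0[of k]) simp_all
      next
        case False
        then have "degree ?u < degree (p k)"
          using degree_cancel_lead[of "p (Suc k)" "p k"] eq by simp
        then have "M (p(k := ?u)) < M p" using eq by (intro M_upd) auto
        then show ?thesis by (rule less)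
      qed
      have "k < r" "k \<noteq> Suc k" using eq(1) by simp_all
      then show ?thesis by (rule Cadd[OF _ eq(1) _ *])
    next
      case lt
      have "M (p \<circ> Transposition.transpose k (Suc k)) < M p"
      proof -
        let ?R = "\<Sum>j\<in>{..<r} - {k} - {Suc k}. Suc j * degree (p j)"
        have "M q = Suc k * degree (q k) + (Suc (Suc k) * degree (q (Suc k)) + (\<Sum>j\<in>{..<r} - {k} - {Suc k}. Suc j * degree (q j)))" for q
          unfolding M_def using lt(1) by (subst sum.remove[of _ k], simp, simp, subst sum.remove[of _ "Suc k"]) auto
        note M2 = this
        have R: "(\<Sum>j\<in>{..<r} - {k} - {Suc k}. Suc j * degree ((p \<circ> Transposition.transpose k (Suc k)) j)) = ?R"
          by (rule sum.cong) (auto simp: transpose_def)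
        show ?thesis unfolding M2 R using lt(2) by (simp add: transpose_def)
      qed
      then have *: "C (p \<circ> Transposition.transpose k (Suc k))" by (rule less)
      have "k < r" "k \<noteq> Suc k" using lt(1) by simp_all
      then show ?thesis by (rule Cswap[OF _ lt(1) _ *])
    next
      case dec
      obtain nu where nu: "plength nu \<le> r" "\<And>j. j < r \<Longrightarrow> part nu j + (r - 1 - j) = degree (p j)"
        using ex_partition[of r "\<lambda>j. degree (p j)"] dec(1) by blast
      have deg: "degree (dual_column b r nu j) = degree (p j)" if "j < r" for j
        using nu(2) degree_dual_column that by simp
      have nz: "dual_column b r nu j \<noteq> 0" for j by (auto simp: dual_column_def)
      \<comment> \<open>Dual columns are replaced by those of \<open>p\<close> one at a time. After
        cancelling leading terms, the remainder in column \<open>m\<close> is zero or of smaller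
        degree, where the outer induction applies.\<close>
      have "C (\<lambda>j. if j < m then p j else dual_column b r nu j)" if "m \<le> r" for m
        using that
      proof (induction m)
        case 0
        then show ?case using Cdual[OF nu(1)] by simp
      next
        case (Suc m)
        let ?G = "\<lambda>j. if j < m then p j else dual_column b r nu j"
        let ?c = "lead_coeff (p m) / lead_coeff (dual_column b r nu m)"
        let ?u = "p m - smult ?c (dual_column b r nu m)"
        have m: "m < r" using Suc.prems by simp
        have "C (?G(m := ?u))"
        proof (cases "?u = 0")
          case True
          then show ?thesis using m by (intro C0[of m]) auto
        next
          case False
          then have "degree ?u < degree (p m)"
            using degree_cancel_lead[OF deg[OF m] nz] by blast
          then have "M (?G(m := ?u)) < M p" using m deg by (intro M_upd) auto
          then show ?thesis by (rule less)
        qed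
        moreover have "?G(m := dual_column b r nu m) = ?G" by auto
        then have "C (?G(m := dual_column b r nu m))" using Suc.IH m by (simp only: less_imp_le)
        ultimately have "C (?G(m := ?u + smult ?c (dual_column b r nu m)))"
          by (rule Clin[OF m])
        moreover have "?u + smult ?c (dual_column b r nu m) = p m" by simp
        moreover have "?G(m := p m) = (\<lambda>j. if j < Suc m then p j else dual_column b r nu j)"
          by (auto simp: fun_eq_iff)
        ultimately show ?case by (simp only:)
      qed
      from this[of r] have "C (\<lambda>j. if j < r then p j else dual_column b r nu j)" by simp
      then show ?thesis by (subst Ccong[of p "\<lambda>j. if j < r then p j else dual_column b r nu j"]) auto
    qed
  qed
  then show ?thesis by (simp only: C_def)
qed

section \<open>Disjoint sets of variables and the coproduct\<close>

definition restrict_monom :: "nat set \<Rightarrow> monom \<Rightarrow> monom" where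
  "restrict_monom A a = Poly_Mapping.mapp (\<lambda>i v. if i \<in> A then v else 0) a"

lemma lookup_restrict_monom: "Poly_Mapping.lookup (restrict_monom A a) i = (if i \<in> A then Poly_Mapping.lookup a i else 0)"
  by (auto simp: restrict_monom_def lookup_mapp when_def in_keys_iff)

lemma restrict_monom_add: "restrict_monom A (a + b) = restrict_monom A a + restrict_monom A b"
  by (rule poly_mapping_eqI) (simp add: lookup_restrict_monom lookup_add)

lemma restrict_monom_0 [simp]: "restrict_monom A 0 = 0"
  by (rule poly_mapping_eqI) (simp add: lookup_restrict_monom)

lemma restrict_monom_sum: "restrict_monom A (\<Sum>i\<in>I. f i) = (\<Sum>i\<in>I. restrict_monom A (f i))"
  by (induction I rule: infinite_finite_induct) (auto simp: restrict_monom_add)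

lemma restrict_monom_id: "Poly_Mapping.keys a \<subseteq> A \<Longrightarrow> restrict_monom A a = a"
  by (rule poly_mapping_eqI) (auto simp: lookup_restrict_monom in_keys_iff)

lemma restrict_monom_zero: "Poly_Mapping.keys a \<inter> A = {} \<Longrightarrow> restrict_monom A a = 0"
  by (rule poly_mapping_eqI) (auto simp: lookup_restrict_monom in_keys_iff)

lemma keys_sum_monom: "finite I \<Longrightarrow> i \<in> I \<Longrightarrow> Poly_Mapping.keys (f i :: monom) \<subseteq> Poly_Mapping.keys (\<Sum>i\<in>I. f i)"
  by (simp add: sum.remove keys_add_nat)

lemma keys_families:
  assumes "g \<in> families r a"
  shows "Poly_Mapping.keys (g i) \<subseteq> Poly_Mapping.keys a"
  using assms keys_sum_monom[of "{..<r}" i g] by (cases "i < r") (auto simp: families_def)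

text \<open>Exponents are natural numbers, so each member of a tuple uses only variables of the sum;
  restriction to the two supports therefore inverts addition.\<close>

lemma families_add_bij:
  assumes "Poly_Mapping.keys a \<inter> Poly_Mapping.keys c = {}"
  shows "bij_betw (\<lambda>(g, h) i. g i + h i) (families r a \<times> families r c) (families r (a + c))"
proof (rule bij_betw_byWitness[where f' = "\<lambda>h. (\<lambda>i. restrict_monom (Poly_Mapping.keys a) (h i), \<lambda>i. restrict_monom (Poly_Mapping.keys c) (h i))"])
  let ?A = "Poly_Mapping.keys a" and ?C = "Poly_Mapping.keys c"
  have ac: "restrict_monom ?A (a + c) = a" "restrict_monom ?C (a + c) = c"
    using assms by (auto simp: restrict_monom_add restrict_monom_id restrict_monom_zero Int_commute)
  have 1: "restrict_monom ?A (g i + h i) = g i" "restrict_monom ?C (g i + h i) = h i"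
    if "g \<in> families r a" "h \<in> families r c" for g h i
  proof -
    have "Poly_Mapping.keys (h i) \<inter> ?A = {}" "Poly_Mapping.keys (g i) \<inter> ?C = {}"
      using keys_families[OF that(1), of i] keys_families[OF that(2), of i] assms by auto
    then show "restrict_monom ?A (g i + h i) = g i" "restrict_monom ?C (g i + h i) = h i"
      using keys_families[OF that(1), of i] keys_families[OF that(2), of i]
      by (auto simp: restrict_monom_add restrict_monom_id restrict_monom_zero)
  qed
  show "\<forall>x\<in>families r a \<times> families r c.
      (\<lambda>i. restrict_monom ?A ((case x of (g, h) \<Rightarrow> \<lambda>i. g i + h i) i),
       \<lambda>i. restrict_monom ?C ((case x of (g, h) \<Rightarrow> \<lambda>i. g i + h i) i)) = x"
    using 1 by auto
  show "\<forall>h\<in>families r (a + c). (case (\<lambda>i. restrict_monom ?A (h i), \<lambda>i. restrict_monom ?C (h i)) of (g, h) \<Rightarrow> \<lambda>i. g i + h i) = h"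
  proof
    fix h assume h: "h \<in> families r (a + c)"
    have "restrict_monom ?A (h i) + restrict_monom ?C (h i) = h i" for i
    proof (rule poly_mapping_eqI)
      fix k
      have "k \<notin> Poly_Mapping.keys (h i)" if "k \<notin> ?A" "k \<notin> ?C"
        using keys_families[OF h, of i] that by (auto simp: keys_add_nat)
      then show "Poly_Mapping.lookup (restrict_monom ?A (h i) + restrict_monom ?C (h i)) k = Poly_Mapping.lookup (h i) k"
        using assms by (auto simp: lookup_add lookup_restrict_monom in_keys_iff)
    qed
    then show "(case (\<lambda>i. restrict_monom ?A (h i), \<lambda>i. restrict_monom ?C (h i)) of (g, h) \<Rightarrow> \<lambda>i. g i + h i) = h"
      by simp
  qed
  show "(\<lambda>(g, h) i. g i + h i) ` (families r a \<times> families r c) \<subseteq> families r (a + c)"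
    by (auto simp: families_def sum.distrib)
  show "(\<lambda>h. (\<lambda>i. restrict_monom ?A (h i), \<lambda>i. restrict_monom ?C (h i))) ` families r (a + c) \<subseteq> families r a \<times> families r c"
    by (auto simp: families_def restrict_monom_sum[symmetric] ac)
qed

text \<open>Two alphabets are modelled by monomials of disjoint support. For each tuple
  \<open>g\<close> of monomials with sum \<open>c\<close>, the row functionals composed with
  multiplication by \<open>gen_poly b (g i)\<close> are again linear. The resolution of the identity
  is applied to them, with the monomials of \<open>a\<close> sitting in the columns.\<close>

theorem coproduct:
  assumes "plength lam \<le> r" "Poly_Mapping.keys c \<inter> Poly_Mapping.keys a = {}"
  shows "mcoeff (dslash_det b r lam empty_partition) (c + a)
    = (\<Sum>mu | part_subset mu lam. mcoeff (dslash_det b r mu empty_partition) a * mcoeff (dslash_det b r lam mu) c)"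
proof -
  let ?d = "dual_column b r empty_partition" and ?q = "gen_poly b" and ?S = "{mu. part_subset mu lam}"
  let ?f = "\<lambda>g i p. row_functional b r lam i (?q (g i) * p)"
  have *: "(\<Sum>h\<in>families r a. functional_det r (?f g) (\<lambda>j. ?q (h j) * ?d j))
    = (\<Sum>mu\<in>?S. mcoeff (dslash_det b r mu empty_partition) a * functional_det r (?f g) (dual_column b r mu))" for g
  proof -
    have R: "functional_det r (?f g) p = (\<Sum>mu\<in>?S. functional_det r (row_functional b r mu) p * functional_det r (?f g) (dual_column b r mu))" for p
    proof (rule resolution_of_identity)
      show "linear_functional (?f g i)" for i by (rule linear_row_functional_times)
      show "finite ?S" by (rule finite_part_subset)
      show "plength mu \<le> r" if "mu \<in> ?S" for mu
        using that plength_mono[of mu lam] assms(1) by simp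
      show "functional_det r (?f g) (dual_column b r mu) = 0" if "plength mu \<le> r" "mu \<notin> ?S" for mu
        using fdet_dual_zero[of mu lam r b "\<lambda>i j. ?q (g i)"] that
        by (simp add: functional_det_alt mult.commute)
    qed
    have sw: "mcoeff (dslash_det b r mu empty_partition) a
      = (\<Sum>h\<in>families r a. functional_det r (row_functional b r mu) (\<lambda>j. ?q (h j) * ?d j))" for mu
      unfolding mcoeff_dslash_det functional_det_alt
      using sum_families_fdet_swap[where f = "\<lambda>i j m. row_functional b r mu i (?d j * ?q m)" and n = r and a = a]
      by (simp only: mult.commute)
    have "(\<Sum>h\<in>families r a. functional_det r (?f g) (\<lambda>j. ?q (h j) * ?d j))
      = (\<Sum>h\<in>families r a. \<Sum>mu\<in>?S. functional_det r (row_functional b r mu) (\<lambda>j. ?q (h j) * ?d j) * functional_det r (?f g) (dual_column b r mu))"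
      by (rule sum.cong[OF refl]) (rule R)
    also have "\<dots> = (\<Sum>mu\<in>?S. (\<Sum>h\<in>families r a. functional_det r (row_functional b r mu) (\<lambda>j. ?q (h j) * ?d j)) * functional_det r (?f g) (dual_column b r mu))"
      by (subst sum.swap) (simp only: sum_distrib_right)
    also have "\<dots> = (\<Sum>mu\<in>?S. mcoeff (dslash_det b r mu empty_partition) a * functional_det r (?f g) (dual_column b r mu))"
      unfolding sw ..
    finally show ?thesis .
  qed
  have "mcoeff (dslash_det b r lam empty_partition) (c + a)
    = (\<Sum>x\<in>families r c \<times> families r a. fdet r (\<lambda>i j. row_functional b r lam i (?d j * ?q ((case x of (g, h) \<Rightarrow> \<lambda>i. g i + h i) i))))"
    unfolding mcoeff_dslash_det
    by (rule sum.reindex_bij_betw[OF families_add_bij[OF assms(2)], symmetric])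
  also have "\<dots> = (\<Sum>g\<in>families r c. \<Sum>h\<in>families r a. fdet r (\<lambda>i j. row_functional b r lam i (?d j * ?q (g i + h i))))"
    by (simp add: sum.cartesian_product case_prod_beta)
  also have "\<dots> = (\<Sum>g\<in>families r c. \<Sum>h\<in>families r a. fdet r (\<lambda>i j. ?f g i (?q (h i) * ?d j)))"
  proof (intro sum.cong refl)
    fix g h assume g: "g \<in> families r c" and h: "h \<in> families r a"
    have "?q (g i + h i) = ?q (g i) * ?q (h i)" for i
      by (rule gen_poly_add) (use keys_families[OF g, of i] keys_families[OF h, of i] assms(2) in auto)
    then show "fdet r (\<lambda>i j. row_functional b r lam i (?d j * ?q (g i + h i))) = fdet r (\<lambda>i j. ?f g i (?q (h i) * ?d j))"
      by (simp only: mult_ac)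
  qed
  also have "\<dots> = (\<Sum>g\<in>families r c. \<Sum>h\<in>families r a. functional_det r (?f g) (\<lambda>j. ?q (h j) * ?d j))"
    unfolding functional_det_alt
  proof (rule sum.cong[OF refl])
    fix g
    show "(\<Sum>h\<in>families r a. fdet r (\<lambda>i j. ?f g i (?q (h i) * ?d j)))
      = (\<Sum>h\<in>families r a. fdet r (\<lambda>i j. ?f g i (?q (h j) * ?d j)))"
      by (rule sum_families_fdet_swap[where f = "\<lambda>i j m. ?f g i (?q m * ?d j)"])
  qed
  also have "\<dots> = (\<Sum>mu\<in>?S. mcoeff (dslash_det b r mu empty_partition) a * (\<Sum>g\<in>families r c. functional_det r (?f g) (dual_column b r mu)))"
    unfolding * by (subst sum.swap) (simp only: sum_distrib_left)
  also have "\<dots> = (\<Sum>mu\<in>?S. mcoeff (dslash_det b r mu empty_partition) a * mcoeff (dslash_det b r lam mu) c)"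
    unfolding mcoeff_dslash_det[of b r lam] functional_det_alt by (simp only: mult.commute)
  finally show ?thesis .
qed


section \<open>Expansions in Schur functions\<close>

text \<open>Integer degrees, because indices of complete homogeneous functions in a determinant can
  be negative; such an entry is zero and counts as homogeneous of its index.\<close>

definition homogeneous :: "int \<Rightarrow> 'a::comm_ring_1 mfps \<Rightarrow> bool" where
  "homogeneous d F \<longleftrightarrow> (\<forall>a. mcoeff F a \<noteq> 0 \<longrightarrow> int (mdegree a) = d)"

lemma mcoeff_times_nonzeroE:
  assumes "mcoeff (F * G) a \<noteq> 0"
  obtains b c where "b + c = a" "mcoeff F b \<noteq> 0" "mcoeff G c \<noteq> 0"
proof -
  have "\<exists>p\<in>splits a. (case p of (b, c) \<Rightarrow> mcoeff F b * mcoeff G c) \<noteq> 0"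
    using assms unfolding mcoeff_times by (meson sum.neutral)
  then obtain b c where bc: "(b, c) \<in> splits a" "mcoeff F b * mcoeff G c \<noteq> 0" by auto
  show ?thesis by (rule that[of b c]) (use bc in auto)
qed

lemma homogeneous_times: "homogeneous d F \<Longrightarrow> homogeneous e G \<Longrightarrow> homogeneous (d + e) (F * G)"
  unfolding homogeneous_def by (fastforce elim!: mcoeff_times_nonzeroE simp: mdegree_add)

lemma homogeneous_1: "homogeneous 0 1"
  by (simp add: homogeneous_def mcoeff_1)

lemma homogeneous_prod:
  "(\<And>i. i \<in> I \<Longrightarrow> homogeneous (d i) (F i)) \<Longrightarrow> homogeneous (\<Sum>i\<in>I. d i) (\<Prod>i\<in>I. F i)"
  by (induction I rule: infinite_finite_induct) (auto simp: homogeneous_1 intro: homogeneous_times)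

lemma homogeneous_sum: "(\<And>i. i \<in> I \<Longrightarrow> homogeneous d (F i)) \<Longrightarrow> homogeneous d (\<Sum>i\<in>I. F i)"
  unfolding homogeneous_def mcoeff_sum by (meson sum.neutral)

lemma homogeneous_of_int_times: "homogeneous d F \<Longrightarrow> homogeneous d (of_int z * F)"
  unfolding homogeneous_def mcoeff_of_int_times by (metis mult_zero_right)

lemma homogeneous_mvar: "homogeneous 1 (mvar i)"
  by (auto simp: homogeneous_def mvar_def)

lemma homogeneous_diff: "homogeneous d F \<Longrightarrow> homogeneous d G \<Longrightarrow> homogeneous d (F - G)"
  unfolding homogeneous_def by (metis diff_self mcoeff_diff)

lemma homogeneous_vandermonde: "homogeneous (int (card (pairs_below n))) (vandermonde n)"
proof -
  have "homogeneous (\<Sum>p\<in>pairs_below n. 1) (\<Prod>p\<in>pairs_below n. mvar (fst p) - mvar (snd p) :: ratfun mfps)"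
    by (intro homogeneous_prod homogeneous_diff homogeneous_mvar)
  then show ?thesis unfolding vandermonde_pairs case_prod_beta by simp
qed

definition bounded_degree :: "'a::comm_ring_1 mfps \<Rightarrow> bool" where
  "bounded_degree F \<longleftrightarrow> (\<exists>d. \<forall>a. mcoeff F a \<noteq> 0 \<longrightarrow> mdegree a \<le> d)"

lemma bounded_degree_homogeneous: "homogeneous d F \<Longrightarrow> bounded_degree F"
  unfolding homogeneous_def bounded_degree_def by (rule exI[of _ "nat d"]) auto

lemma bounded_degree_add: 
  assumes "bounded_degree F" "bounded_degree G"
  shows "bounded_degree (F + G)"
proof -
  obtain d e where "\<And>a. mcoeff F a \<noteq> 0 \<Longrightarrow> mdegree a \<le> d" "\<And>a. mcoeff G a \<noteq> 0 \<Longrightarrow> mdegree a \<le> e"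
    using assms unfolding bounded_degree_def by blast
  then show ?thesis unfolding bounded_degree_def
    by (intro exI[of _ "max d e"]) (metis add.right_neutral le_max_iff_disj mcoeff_add add_0)
qed

lemma bounded_degree_times:
  assumes "bounded_degree F" "bounded_degree G"
  shows "bounded_degree (F * G)"
proof -
  obtain d e where de: "\<And>a. mcoeff F a \<noteq> 0 \<Longrightarrow> mdegree a \<le> d" "\<And>a. mcoeff G a \<noteq> 0 \<Longrightarrow> mdegree a \<le> e"
    using assms unfolding bounded_degree_def by blast
  have "mdegree a \<le> d + e" if "mcoeff (F * G) a \<noteq> 0" for a
    using that
  proof (rule mcoeff_times_nonzeroE)
    fix b c assume "b + c = a" and "mcoeff F b \<noteq> 0" "mcoeff G c \<noteq> 0"
    then show "mdegree a \<le> d + e" using add_mono[OF de(1) de(2)] mdegree_add[of b c] by simp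
  qed
  then show ?thesis unfolding bounded_degree_def by blast
qed

lemma bounded_degree_mconst: "bounded_degree (mconst c)"
  unfolding bounded_degree_def by (rule exI[of _ 0]) (auto simp: mcoeff_mconst)

lemma bounded_degree_1: "bounded_degree 1"
  using homogeneous_1 by (rule bounded_degree_homogeneous)

lemma bounded_degree_mvar: "bounded_degree (mvar i)"
  using homogeneous_mvar by (rule bounded_degree_homogeneous)

lemma bounded_degree_0: "bounded_degree 0"
  by (simp add: bounded_degree_def)

lemma bounded_degree_sum: "(\<And>i. i \<in> I \<Longrightarrow> bounded_degree (F i)) \<Longrightarrow> bounded_degree (\<Sum>i\<in>I. F i)"
  by (induction I rule: infinite_finite_induct) (auto intro: bounded_degree_add bounded_degree_0)

lemma bounded_degree_prod: "(\<And>i. i \<in> I \<Longrightarrow> bounded_degree (F i)) \<Longrightarrow> bounded_degree (\<Prod>i\<in>I. F i)"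
  by (induction I rule: infinite_finite_induct) (auto intro: bounded_degree_times bounded_degree_1)

lemma bounded_degree_power: "bounded_degree F \<Longrightarrow> bounded_degree (F ^ n)"
  by (induction n) (auto intro: bounded_degree_times bounded_degree_1)

lemma bounded_degree_fdet:
  assumes "\<And>i j. bounded_degree (F i j :: ratfun mfps)"
  shows "bounded_degree (fdet n F)"
  unfolding fdet_leibniz
proof (intro bounded_degree_sum bounded_degree_times bounded_degree_prod assms)
  fix p :: "nat \<Rightarrow> nat"
  have "of_int (sign p) = (mconst (of_int (sign p)) :: ratfun mfps)" by simp
  then show "bounded_degree (of_int (sign p) :: ratfun mfps)" by (metis bounded_degree_mconst)
qed

text \<open>As \<open>V\<close> is homogeneous, the part of \<open>F\<close> above degree
  \<open>d\<close> times \<open>V\<close> is the part of \<open>F * V\<close> above degree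
  \<open>d + v\<close>, which is zero.\<close>

lemma bounded_degree_quotient:
  assumes "homogeneous (int v) V" "nonzerodiv V" "bounded_degree (F * V)"
  shows "bounded_degree F"
proof -
  obtain d where d: "\<And>a. mcoeff (F * V) a \<noteq> 0 \<Longrightarrow> mdegree a \<le> d"
    using assms(3) unfolding bounded_degree_def by blast
  define F' where "F' = Abs_mfps (\<lambda>a. if mdegree a > d then mcoeff F a else 0)"
  have F': "mcoeff F' a = (if mdegree a > d then mcoeff F a else 0)" for a
    by (simp add: F'_def)
  have "V * F' = 0"
  proof (rule mfps_eqI)
    fix a
    have v: "mcoeff V c \<noteq> 0 \<Longrightarrow> mdegree c = v" for c using assms(1) by (simp add: homogeneous_def)
    have "mcoeff (F' * V) a = (if mdegree a > d + v then mcoeff (F * V) a else 0)"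
    proof (cases "mdegree a > d + v")
      case True
      have "mcoeff F' b * mcoeff V c = mcoeff F b * mcoeff V c" if "b + c = a" for b c
        using v[of c] that True mdegree_add[of b c] by (cases "mcoeff V c = 0") (auto simp: F')
      then have "mcoeff (F' * V) a = mcoeff (F * V) a"
        unfolding mcoeff_times by (intro sum.cong refl) auto
      then show ?thesis using True by simp
    next
      case False
      have "mcoeff F' b * mcoeff V c = 0" if "b + c = a" for b c
        using v[of c] that False mdegree_add[of b c] by (cases "mcoeff V c = 0") (auto simp: F')
      then have "mcoeff (F' * V) a = 0"
        unfolding mcoeff_times by (intro sum.neutral) auto
      then show ?thesis using False by simp
    qed
    also have "\<dots> = 0" using d[of a] by (cases "mcoeff (F * V) a = 0") auto
    finally show "mcoeff (V * F') a = mcoeff 0 a" by (simp add: mult.commute)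
  qed
  then have "F' = 0" using assms(2) by (simp add: nonzerodiv_def)
  then have "mcoeff F' a = 0" for a by simp
  then have "mcoeff F a \<noteq> 0 \<longrightarrow> mdegree a \<le> d" for a using F'[of a] by (metis not_le)
  then show ?thesis unfolding bounded_degree_def by blast
qed

definition psize :: "partition \<Rightarrow> nat" where
  "psize lam = (\<Sum>i<plength lam. part lam i)"

lemma psize_eq: 
  assumes "plength lam \<le> n"
  shows "psize lam = (\<Sum>i<n. part lam i)"
  unfolding psize_def by (rule sum.mono_neutral_left) (use assms in \<open>auto simp: part_eq_0_iff\<close>)

lemma plength_le_psize: "plength lam \<le> psize lam"
proof -
  have "1 \<le> part lam i" if "i < plength lam" for i
    using that part_eq_0_iff[of lam i] by simp
  then have "(\<Sum>i<plength lam. 1) \<le> psize lam" unfolding psize_def by (intro sum_mono) auto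
  then show ?thesis by simp
qed

lemma part_le_psize: "part lam i \<le> psize lam"
proof -
  let ?n = "max (plength lam) (Suc i)"
  have "part lam i \<le> (\<Sum>i<?n. part lam i)" by (rule member_le_sum) auto
  then show ?thesis using psize_eq[of lam ?n] by simp
qed

lemma finite_psize: "finite {lam. psize lam \<le> d}"
proof -
  have "{lam. psize lam \<le> d} \<subseteq> {lam. plength lam \<le> d \<and> part lam 0 \<le> d}"
    using plength_le_psize part_le_psize order_trans by blast
  then show ?thesis using finite_partition_bounded finite_subset by blast
qed

lemma psize_mono_strict:
  assumes "part_subset lam mu" "lam \<noteq> mu"
  shows "psize lam < psize mu"
proof -
  let ?n = "plength mu"
  have n: "plength lam \<le> ?n" using plength_mono[OF assms(1)] .
  obtain k where k: "part lam k \<noteq> part mu k" using assms(2) partition_eqI by blast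
  have le: "part lam i \<le> part mu i" for i using assms(1) by (simp add: part_subset_def)
  have "k < ?n" using k le[of k] part_eq_0_iff[of mu k] by (metis le_zero_eq linorder_not_less)
  moreover have "part lam k < part mu k" using k le[of k] by simp
  ultimately show ?thesis
    unfolding psize_eq[OF n] psize_eq[of mu ?n, simplified]
    by (intro sum_strict_mono_ex1) (auto simp: le)
qed

section \<open>Straight shapes: Grothendieck functions, and Schur functions at parameter
  zero\<close>

definition groth_det :: "ratfun \<Rightarrow> partition \<Rightarrow> ratfun mfps" where
  "groth_det b lam = jacobi_trudi b (plength lam) (part lam) (\<lambda>_. 0)"

lemma groth_det_eq: "plength lam \<le> n \<Longrightarrow> groth_det b lam = jacobi_trudi b n (part lam) (\<lambda>_. 0)"
  unfolding groth_det_def by (rule jacobi_trudi_stable[symmetric]) (auto simp: part_eq_0_iff)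

lemma dslash_det_empty_eq: "plength lam \<le> n \<Longrightarrow> dslash_det b n lam empty_partition = groth_det b lam"
  by (simp add: dslash_det_empty groth_det_eq)

lemma symmetric_groth_det: "symmetric (groth_det b lam)"
  unfolding groth_det_def by (rule symmetric_jacobi_trudi)

lemma bialternant:
  assumes "plength lam \<le> n"
  shows "mtrunc n (groth_det b lam) * vandermonde n
    = fdet n (\<lambda>i j. mvar i ^ (part lam j + (n - 1 - j)) * (1 + mconst b * mvar i) ^ j)"
  unfolding groth_det_eq[OF assms] by (rule bialternant_square)

lemma bialternant_unique:
  assumes "\<And>n. plength lam \<le> n \<Longrightarrow> mtrunc n F * vandermonde n
    = fdet n (\<lambda>i j. mvar i ^ (part lam j + (n - 1 - j)) * (1 + mconst b * mvar i) ^ j)"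
  shows "F = groth_det b lam"
proof (rule mfps_eq_mtruncI)
  fix n assume n: "plength lam \<le> n"
  have "vandermonde n * mtrunc n F = vandermonde n * mtrunc n (groth_det b lam)"
    using assms[OF n] bialternant[OF n, of b] by (simp only: mult.commute)
  then show "mtrunc n F = mtrunc n (groth_det b lam)" by (rule nonzerodiv_cancel[OF nonzerodiv_vandermonde])
qed

lemma mcoeff_entry_zero: "mcoeff (entry 0 m e) a = (if int (mdegree a) = m then 1 else 0)"
proof -
  have "lf 0 m e ([:0, 1:] ^ mdegree a) = lfc 0 (m - int (mdegree a)) e 0"
    using lf_times_w_power[of 0 m e "mdegree a" 1] by (simp add: lf_1)
  then show ?thesis by (auto simp: mcoeff_entry gen_poly_zero_beta lfc_def)
qed

lemma homogeneous_schur_det: "homogeneous (int (psize lam)) (groth_det 0 lam)"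
  unfolding groth_det_def jacobi_trudi_def fdet_leibniz
proof (intro homogeneous_sum homogeneous_of_int_times)
  fix p assume p: "p \<in> {p. p permutes {..<plength lam}}"
  let ?n = "plength lam"
  have "(\<Sum>i<?n. int (p i)) = (\<Sum>i<?n. int i)"
    using sum.permute[of p "{..<?n}" int] p by simp
  then have "(\<Sum>i<?n. int (part lam i) - int 0 - int i + int (p i)) = int (psize lam)"
    by (simp add: psize_def sum.distrib sum_subtractf)
  moreover have "homogeneous (\<Sum>i<?n. int (part lam i) - int 0 - int i + int (p i))
     (\<Prod>i<?n. entry 0 (int (part lam i) - int 0 - int i + int (p i)) (int i - int (p i) - 1))"
    by (intro homogeneous_prod) (auto simp: homogeneous_def mcoeff_entry_zero split: if_splits)
  ultimately show "homogeneous (int (psize lam))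
     (\<Prod>i<?n. entry 0 (int (part lam i) - int 0 - int i + int (p i)) (int i - int (p i) - 1))"
    by (simp only:)
qed

lemma Lambda_iff: "F \<in> Lambda \<longleftrightarrow> symmetric F \<and> bounded_degree F"
  by (simp add: Lambda_def bounded_degree_def)

lemma schur_eq: "schur lam = groth_det 0 lam"
  unfolding schur_def
proof (rule the_equality)
  show "groth_det 0 lam \<in> Lambda \<and> (\<forall>n\<ge>plength lam. mtrunc n (groth_det 0 lam) * vandermonde n =
       det (mat n n (\<lambda>(i, j). mvar i ^ (part lam j + (n - 1 - j)))))"
    using bialternant[of lam _ 0] bounded_degree_homogeneous[OF homogeneous_schur_det]
    by (simp add: Lambda_iff symmetric_groth_det fdet_def)
next
  fix F assume F: "F \<in> Lambda \<and> (\<forall>n\<ge>plength lam. mtrunc n F * vandermonde n =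
       det (mat n n (\<lambda>(i, j). mvar i ^ (part lam j + (n - 1 - j)))))"
  show "F = groth_det 0 lam"
    by (rule bialternant_unique) (use F in \<open>simp add: fdet_def\<close>)
qed

text \<open>It suffices to drop one variable from \<open>plength lam\<close>. All exponents in the
  alternant of that size are positive, so its last row vanishes, while the Vandermonde determinant
  becomes a nonzero divisor.\<close>

lemma mtrunc_groth_det_zero:
  assumes "n < plength lam"
  shows "mtrunc n (groth_det b lam) = 0"
proof -
  obtain k where k: "plength lam = Suc k" "n \<le> k" using assms by (cases "plength lam") auto
  let ?F = "groth_det b lam"
  have pos: "part lam j + (Suc k - 1 - j) \<noteq> 0" if "j < Suc k" for j
    using that k(1) part_eq_0_iff[of lam j] by simp
  have "mtrunc k (mtrunc (Suc k) ?F * vandermonde (Suc k)) = 0"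
    unfolding bialternant[OF eq_refl[OF k(1)]] mtrunc.hom_fdet
  proof (rule fdet_row_zero[of k])
    fix j assume "j < Suc k"
    then show "mtrunc k (mvar k ^ (part lam j + (Suc k - 1 - j)) * (1 + mconst b * mvar k) ^ j) = 0"
      unfolding mtrunc.hom_mult mtrunc.hom_power mtrunc_mvar
      by (simp only: power_0_left pos less_irrefl if_False mult_zero_left)
  qed simp
  then have "mtrunc k ?F * (vandermonde k * (\<Prod>i<k. mvar i)) = 0"
    by (simp only: mtrunc.hom_mult mtrunc_vandermonde_Suc mtrunc_mtrunc) simp
  moreover have "nonzerodiv (vandermonde k * (\<Prod>i<k. mvar i))"
    by (intro nonzerodiv_mult nonzerodiv_vandermonde nonzerodiv_prod nonzerodiv_mvar)
  ultimately have "mtrunc k ?F = 0" unfolding nonzerodiv_def by (metis mult.commute)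
  then have "mtrunc n (mtrunc k ?F) = 0" by simp
  then show ?thesis using k(2) by (simp add: mtrunc_mtrunc min_absorb1)
qed

section \<open>Schur coefficients read off from alternants\<close>

definition monom_of :: "nat \<Rightarrow> (nat \<Rightarrow> nat) \<Rightarrow> monom" where
  "monom_of n e = (\<Sum>i<n. Poly_Mapping.single i (e i))"

lemma lookup_sum_monom: "Poly_Mapping.lookup (\<Sum>i\<in>I. f i :: monom) k = (\<Sum>i\<in>I. Poly_Mapping.lookup (f i) k)"
  by (induction I rule: infinite_finite_induct) (auto simp: lookup_add)

lemma lookup_monom_of: "Poly_Mapping.lookup (monom_of n e) k = (if k < n then e k else 0)"
  unfolding monom_of_def lookup_sum_monom by (simp add: lookup_single when_def)

lemma keys_monom_of: "Poly_Mapping.keys (monom_of n e) \<subseteq> {..<n}"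
  by (auto simp: in_keys_iff lookup_monom_of split: if_splits)

lemma mdegree_monom_of: "mdegree (monom_of n e) = (\<Sum>i<n. e i)"
  using mdegree_superset[OF _ keys_monom_of, of n e] by (simp add: lookup_monom_of)

lemma monom_of_lookup: "Poly_Mapping.keys a \<subseteq> {..<n} \<Longrightarrow> monom_of n (Poly_Mapping.lookup a) = a"
  by (rule poly_mapping_eqI) (auto simp: lookup_monom_of in_keys_iff)

text \<open>Each factor involves only its own variable, so one tuple of monomials
  contributes.\<close>

lemma mcoeff_prod_univariate:
  assumes "\<And>i a. i < n \<Longrightarrow> mcoeff (F i) a \<noteq> 0 \<Longrightarrow> a = Poly_Mapping.single i (Poly_Mapping.lookup a i)"
  shows "mcoeff (\<Prod>i<n. F i) (monom_of n e) = (\<Prod>i<n. mcoeff (F i) (Poly_Mapping.single i (e i)))"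
proof -
  define g where "g i = (if i < n then Poly_Mapping.single i (e i) else 0)" for i
  have g: "g \<in> families n (monom_of n e)" by (simp add: families_def g_def monom_of_def)
  have "(\<Prod>i<n. mcoeff (F i) (h i)) = 0" if h: "h \<in> families n (monom_of n e)" "h \<noteq> g" for h
  proof (rule ccontr)
    assume "(\<Prod>i<n. mcoeff (F i) (h i)) \<noteq> 0"
    then have "mcoeff (F i) (h i) \<noteq> 0" if "i < n" for i
      using that prod_zero[of "{..<n}" "\<lambda>i. mcoeff (F i) (h i)"] by blast
    then have *: "h i = Poly_Mapping.single i (Poly_Mapping.lookup (h i) i)" if "i < n" for i
      using assms that by blast
    have "Poly_Mapping.lookup (h i) i = e i" if "i < n" for i
    proof -
      have "(\<Sum>k<n. h k) = (\<Sum>k<n. Poly_Mapping.single k (Poly_Mapping.lookup (h k) k))"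
        by (rule sum.cong) (use * in auto)
      then have "monom_of n e = monom_of n (\<lambda>k. Poly_Mapping.lookup (h k) k)"
        using h(1) by (simp add: families_def monom_of_def)
      then have "Poly_Mapping.lookup (monom_of n e) i = Poly_Mapping.lookup (monom_of n (\<lambda>k. Poly_Mapping.lookup (h k) k)) i"
        by (simp only:)
      then show ?thesis using that by (simp add: lookup_monom_of)
    qed
    then have "h i = g i" if "i < n" for i using *[OF that] that by (simp add: g_def)
    moreover have "h i = g i" if "\<not> i < n" for i using h(1) that by (simp add: families_def g_def)
    ultimately have "h = g" by blast
    then show False using h(2) by simp
  qed
  then have "mcoeff (\<Prod>i<n. F i) (monom_of n e) = (\<Sum>h\<in>{g}. \<Prod>i<n. mcoeff (F i) (h i))"
    unfolding mcoeff_prod using g by (intro sum.mono_neutral_right) auto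
  then show ?thesis by (simp add: g_def)
qed

lemma bialternant_factor: "mvar i ^ m * (1 + mconst b * mvar i) ^ k = lf_mfps b (int m) (int k) (geom i)"
  using lf_mfps_geom[of b i 0 m k] by simp

lemma mcoeff_bialternant:
  "mcoeff (fdet n (\<lambda>i j. mvar i ^ u j * (1 + mconst b * mvar i) ^ j)) (monom_of n e)
    = fdet n (\<lambda>i j. lfc b (int (u j)) (int j) (e i))"
proof -
  have "mcoeff (\<Prod>i<n. mvar i ^ u (p i) * (1 + mconst b * mvar i) ^ p i) (monom_of n e)
    = (\<Prod>i<n. lfc b (int (u (p i))) (int (p i)) (e i))" for p
    unfolding bialternant_factor
    by (subst mcoeff_prod_univariate) (auto simp: mcoeff_geom lf_monom split: if_splits)
  then show ?thesis unfolding fdet_leibniz mcoeff_sum mcoeff_of_int_times by simp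
qed

definition stair :: "nat \<Rightarrow> partition \<Rightarrow> monom" where
  "stair n nu = monom_of n (\<lambda>i. part nu i + (n - 1 - i))"

text \<open>The coefficient of the Schur function of \<open>nu\<close> in \<open>F\<close>: by the
  bialternant formula, among Schur functions only that of \<open>nu\<close> contributes this
  monomial once \<open>n \<ge> plength nu\<close>.\<close>

definition coef :: "nat \<Rightarrow> ratfun mfps \<Rightarrow> partition \<Rightarrow> ratfun" where
  "coef n F nu = mcoeff (F * vandermonde n) (stair n nu)"

lemma coef_mtrunc: "coef n F nu = mcoeff (mtrunc n F * vandermonde n) (stair n nu)"
proof -
  have "mcoeff (F * vandermonde n) (stair n nu) = mcoeff (mtrunc n (F * vandermonde n)) (stair n nu)"
    by (simp add: mcoeff_mtrunc stair_def keys_monom_of)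
  then show ?thesis unfolding coef_def by (simp only: mtrunc.hom_mult mtrunc_vandermonde)
qed

lemma coef_add: "coef n (F + G) nu = coef n F nu + coef n G nu"
  by (simp add: coef_def distrib_right)

lemma coef_diff: "coef n (F - G) nu = coef n F nu - coef n G nu"
  by (simp add: coef_def left_diff_distrib)

lemma coef_mconst_times: "coef n (mconst c * F) nu = c * coef n F nu"
  by (simp add: coef_def mult.assoc)

lemma coef_0 [simp]: "coef n 0 nu = 0"
  by (simp add: coef_def)

lemma coef_sum: "coef n (\<Sum>i\<in>I. F i) nu = (\<Sum>i\<in>I. coef n (F i) nu)"
  by (simp add: coef_def sum_distrib_right)

lemma coef_groth_det:
  "plength lam \<le> n \<Longrightarrow> coef n (groth_det b lam) nu
    = fdet n (\<lambda>i j. lfc b (int (part lam j + (n - 1 - j))) (int j) (part nu i + (n - 1 - i)))"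
  unfolding coef_mtrunc bialternant stair_def mcoeff_bialternant ..

text \<open>The factors \<open>1 + b x\<close> only raise exponents, so only partitions containing
  \<open>lam\<close> occur. With fewer variables than parts the whole restriction is zero.\<close>

lemma coef_groth_det_zero:
  assumes "plength nu \<le> n" "\<not> part_subset lam nu"
  shows "coef n (groth_det b lam) nu = 0"
proof (cases "plength lam \<le> n")
  case True
  obtain k where k: "part nu k < part lam k" using assms(2) by (auto simp: part_subset_def not_le)
  then have kn: "k < n" using True part_eq_0_iff[of lam k] by (metis gr_implies_not0 linorder_not_less order_trans)
  show ?thesis unfolding coef_groth_det[OF True]
  proof (rule fdet_block_zero[OF kn])
    fix i j assume ij: "k \<le> i" "i < n" "j \<le> k"
    have "part nu i \<le> part nu k" "part lam k \<le> part lam j" using ij by (auto intro: part_antimono)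
    then show "lfc b (int (part lam j + (n - 1 - j))) (int j) (part nu i + (n - 1 - i)) = 0"
      using k ij by (intro lfc_zero_high) simp
  qed
next
  case False
  then show ?thesis by (simp add: coef_mtrunc mtrunc_groth_det_zero)
qed

lemma coef_groth_det_self: "plength lam \<le> n \<Longrightarrow> coef n (groth_det b lam) lam = 1"
proof -
  assume n: "plength lam \<le> n"
  have "coef n (groth_det b lam) lam = (\<Prod>i<n. lfc b (int (part lam i + (n - 1 - i))) (int i) (part lam i + (n - 1 - i)))"
    unfolding coef_groth_det[OF n]
  proof (rule fdet_upper_triangular)
    fix i j assume ij: "j < i" "i < n"
    have "part lam i \<le> part lam j" using ij by (intro part_antimono) simp
    then show "lfc b (int (part lam j + (n - 1 - j))) (int j) (part lam i + (n - 1 - i)) = 0"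
      using ij by (intro lfc_zero_high) simp
  qed
  also have "\<dots> = 1" by (rule prod.neutral) (auto simp: lfc_def)
  finally show ?thesis .
qed

lemma lfc_zero_beta: "lfc 0 m e k = (if int k = m then 1 else 0)"
  by (auto simp: lfc_def)

lemma coef_schur:
  assumes "plength nu \<le> n"
  shows "coef n (schur lam) nu = (if lam = nu then 1 else 0)"
proof -
  consider "\<not> part_subset lam nu" | "lam = nu" | "part_subset lam nu" "lam \<noteq> nu" by blast
  then show ?thesis
  proof cases
    case 1
    then show ?thesis using coef_groth_det_zero[OF assms 1, of 0] by (auto simp: schur_eq)
  next
    case 2
    then show ?thesis using coef_groth_det_self[of lam n 0] assms by (simp add: schur_eq)
  next
    case 3
    have n: "plength lam \<le> n" using plength_mono[OF 3(1)] assms by simp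
    have "\<not> part_subset nu lam" using 3 part_subset_antisym by blast
    then obtain k where k: "part lam k < part nu k" by (auto simp: part_subset_def not_le)
    then have kn: "k < n" using assms part_eq_0_iff[of nu k] by (metis gr_implies_not0 linorder_not_less order_trans)
    let ?f = "\<lambda>i j. lfc 0 (int (part lam j + (n - 1 - j))) (int j) (part nu i + (n - 1 - i))"
    have "fdet n (\<lambda>j i. ?f i j) = 0"
    proof (rule fdet_block_zero[OF kn])
      fix j i assume ij: "k \<le> j" "j < n" "i \<le> k"
      have "part nu k \<le> part nu i" "part lam j \<le> part lam k" using ij by (auto intro: part_antimono)
      then show "?f i j = 0" using k ij by (simp add: lfc_zero_beta)
    qed
    then show ?thesis using 3 by (simp only: schur_eq coef_groth_det[OF n] fdet_transpose[of n ?f]) simp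
  qed
qed

lemma symmetric_schur: "symmetric (schur lam)"
  by (simp add: schur_eq symmetric_groth_det)

lemma mcoeff_schur_nonzero: "mcoeff (schur lam) a \<noteq> 0 \<Longrightarrow> psize lam = mdegree a"
  using homogeneous_schur_det[of lam] by (simp add: homogeneous_def schur_eq)

lemma schur_in_Lambda: "schur lam \<in> Lambda"
  using bounded_degree_homogeneous[OF homogeneous_schur_det] by (simp add: Lambda_iff schur_eq symmetric_groth_det)

lemma mcoeff_schur_sum:
  assumes "mdegree a \<le> d"
  shows "mcoeff (schur_sum c) a = mcoeff (\<Sum>lam | psize lam \<le> d. mconst (c lam) * schur lam) a"
proof -
  have "mcoeff (schur_sum c) a = Sum_any (\<lambda>lam. c lam * mcoeff (schur lam) a)"
    by (simp add: schur_sum_def)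
  also have "\<dots> = (\<Sum>lam | psize lam \<le> d. c lam * mcoeff (schur lam) a)"
    by (rule Sum_any.expand_superset[OF finite_psize]) (use mcoeff_schur_nonzero assms in fastforce)
  finally show ?thesis by simp
qed

lemma symmetric_schur_sum: "symmetric (schur_sum c)"
  unfolding symmetric_def
  by (auto simp: schur_sum_def symmetricD[OF symmetric_schur])

lemma psize_le_stair: "plength nu \<le> n \<Longrightarrow> psize nu \<le> mdegree (stair n nu)"
  unfolding stair_def mdegree_monom_of psize_eq by (rule sum_mono) (rule le_add1)

lemma coef_schur_sum:
  assumes "plength nu \<le> n"
  shows "coef n (schur_sum c) nu = c nu"
proof -
  let ?d = "mdegree (stair n nu)"
  let ?F = "\<Sum>lam | psize lam \<le> ?d. mconst (c lam) * schur lam"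
  have "coef n (schur_sum c) nu = coef n ?F nu"
    unfolding coef_def mcoeff_times
  proof (intro sum.cong refl)
    fix p assume p: "p \<in> splits (stair n nu)"
    obtain b d where bd: "p = (b, d)" by (cases p)
    then have "mdegree b \<le> ?d" using p mdegree_add[of b d] by simp
    from mcoeff_schur_sum[OF this, of c] show "(case p of (b, d) \<Rightarrow> mcoeff (schur_sum c) b * mcoeff (vandermonde n) d)
      = (case p of (b, d) \<Rightarrow> mcoeff ?F b * mcoeff (vandermonde n) d)" by (simp only: bd prod.case)
  qed
  also have "\<dots> = (\<Sum>lam | psize lam \<le> ?d. if lam = nu then c lam else 0)"
    unfolding coef_sum by (rule sum.cong) (auto simp: coef_mconst_times coef_schur[OF assms])
  also have "\<dots> = c nu" using psize_le_stair[OF assms] finite_psize[of ?d] by simp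
  finally show ?thesis .
qed

lemma schur_coeff_schur_sum:
  assumes "admissible c"
  shows "schur_coeff (schur_sum c) = c"
  unfolding schur_coeff_def
proof (rule the_equality)
  fix c' assume "admissible c' \<and> schur_sum c = schur_sum c'"
  then have "coef (plength nu) (schur_sum c) nu = coef (plength nu) (schur_sum c') nu" for nu by simp
  then show "c' = c" by (auto simp: coef_schur_sum fun_eq_iff)
qed (use assms in simp)

lemma monom_of_Suc: "monom_of (Suc n) e = monom_of n e + Poly_Mapping.single n (e n)"
  by (simp add: monom_of_def)

lemma mcoeff_times_mvars: "mcoeff (F * (\<Prod>i<m. mvar i)) (a + monom_of m (\<lambda>_. 1)) = mcoeff F a"
proof (induction m arbitrary: F)
  case 0
  then show ?case by (simp add: monom_of_def)
next
  case (Suc m)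
  have "F * (\<Prod>i<Suc m. mvar i) = mvar m * (F * (\<Prod>i<m. mvar i))" by (simp add: mult_ac)
  moreover have "a + monom_of (Suc m) (\<lambda>_. 1) - Poly_Mapping.single m 1 = a + monom_of m (\<lambda>_. 1)"
    by (simp add: monom_of_Suc add.assoc[symmetric])
  moreover have "Poly_Mapping.lookup (a + monom_of (Suc m) (\<lambda>_. 1)) m \<noteq> 0"
    by (simp add: lookup_add lookup_monom_of)
  ultimately show ?case by (simp only: mcoeff_mvar_times if_False Suc)
qed

text \<open>The staircase of size \<open>n + 1\<close> is that of size \<open>n\<close> plus one in
  each of the first \<open>n\<close> places, and \<open>vandermonde (Suc n)\<close> gains exactly
  these variables as factors when the last one is set to zero.\<close>

lemma coef_Suc:
  assumes "plength nu \<le> n"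
  shows "coef (Suc n) F nu = coef n F nu"
proof -
  have s: "stair (Suc n) nu = stair n nu + monom_of n (\<lambda>_. 1)"
    by (rule poly_mapping_eqI) (use assms in \<open>auto simp: stair_def lookup_add lookup_monom_of less_Suc_eq part_eq_0_iff[symmetric]\<close>)
  have "Poly_Mapping.keys (stair (Suc n) nu) \<subseteq> {..<n}"
    unfolding s using keys_monom_of by (auto simp: keys_add_nat stair_def)
  then have "coef (Suc n) F nu = mcoeff (mtrunc n (F * vandermonde (Suc n))) (stair (Suc n) nu)"
    by (simp add: coef_def mcoeff_mtrunc)
  also have "\<dots> = mcoeff (mtrunc n F * vandermonde n * (\<Prod>i<n. mvar i)) (stair n nu + monom_of n (\<lambda>_. 1))"
    by (simp only: s mtrunc.hom_mult mtrunc_vandermonde_Suc mult.assoc)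
  also have "\<dots> = coef n F nu" by (simp only: mcoeff_times_mvars coef_mtrunc)
  finally show ?thesis .
qed

lemma coef_stable:
  assumes "plength nu \<le> n"
  shows "coef n F nu = coef (plength nu) F nu"
  using assms by (induction n rule: dec_induct) (auto simp: coef_Suc)

section \<open>Symmetric series are determined by their Schur coefficients\<close>

lemma prod_mvar_power: "mcoeff (\<Prod>i<n. mvar i ^ e i :: 'a::comm_ring_1 mfps) a = (if a = monom_of n e then 1 else 0)"
proof (cases "Poly_Mapping.keys a \<subseteq> {..<n}")
  case True
  have "mcoeff (\<Prod>i<n. mvar i ^ e i :: 'a mfps) (monom_of n (Poly_Mapping.lookup a))
    = (\<Prod>i<n. mcoeff (mvar i ^ e i) (Poly_Mapping.single i (Poly_Mapping.lookup a i)))"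
    by (rule mcoeff_prod_univariate) (auto simp: mcoeff_mvar_power split: if_splits)
  also have "\<dots> = (\<Prod>i<n. if Poly_Mapping.lookup a i = e i then 1 else 0)"
  proof (rule prod.cong)
    fix i
    have "Poly_Mapping.single i (Poly_Mapping.lookup a i) = Poly_Mapping.single i (e i) \<longleftrightarrow> Poly_Mapping.lookup a i = e i"
      by (metis lookup_single_eq)
    then show "mcoeff (mvar i ^ e i :: 'a mfps) (Poly_Mapping.single i (Poly_Mapping.lookup a i))
      = (if Poly_Mapping.lookup a i = e i then 1 else 0)" by (simp add: mcoeff_mvar_power)
  qed simp
  also have "\<dots> = (if \<forall>i<n. Poly_Mapping.lookup a i = e i then 1 else 0)"
  proof (cases "\<forall>i<n. Poly_Mapping.lookup a i = e i")
    case False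
    then obtain i where "i < n" "Poly_Mapping.lookup a i \<noteq> e i" by blast
    then have "(\<Prod>i<n. if Poly_Mapping.lookup a i = e i then 1 else 0) = (0 :: 'a)"
      by (intro prod_zero bexI[of _ i]) auto
    then show ?thesis using False by simp
  qed simp
  also have "(\<forall>i<n. Poly_Mapping.lookup a i = e i) \<longleftrightarrow> a = monom_of n e"
  proof
    assume *: "\<forall>i<n. Poly_Mapping.lookup a i = e i"
    show "a = monom_of n e"
      by (rule poly_mapping_eqI) (use * True in \<open>auto simp: lookup_monom_of in_keys_iff\<close>)
  qed (simp add: lookup_monom_of)
  finally show ?thesis using monom_of_lookup[OF True] by simp
next
  case False
  then have "a \<noteq> monom_of n e" using keys_monom_of by blast
  moreover have "mcoeff (mtrunc n (\<Prod>i<n. mvar i ^ e i :: 'a mfps)) a = 0" using False by (simp add: mcoeff_mtrunc)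
  moreover have "mtrunc n (\<Prod>i<n. mvar i ^ e i :: 'a mfps) = (\<Prod>i<n. mvar i ^ e i)"
    unfolding mtrunc.hom_prod by (rule prod.cong) (auto simp: mtrunc.hom_power mtrunc_mvar)
  ultimately show ?thesis by simp
qed

lemma mcoeff_times_mvar_powers:
  "mcoeff (F * (\<Prod>i<n. mvar i ^ e i)) (b + monom_of n e) = mcoeff F b"
proof -
  have "mcoeff (F * (\<Prod>i<n. mvar i ^ e i)) (b + monom_of n e)
    = (\<Sum>p\<in>{(b, monom_of n e)}. mcoeff F (fst p) * mcoeff (\<Prod>i<n. mvar i ^ e i) (snd p))"
    unfolding mcoeff_times case_prod_beta
    by (rule sum.mono_neutral_right) (auto simp: prod_mvar_power)
  then show ?thesis by (simp add: prod_mvar_power)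
qed

lemma mcoeff_times_mvar_powers_zero:
  assumes "\<And>b. b + monom_of n e = a \<Longrightarrow> mcoeff F b = 0"
  shows "mcoeff (F * (\<Prod>i<n. mvar i ^ e i)) a = 0"
  unfolding mcoeff_times
  by (rule sum.neutral) (use assms in \<open>auto simp: prod_mvar_power\<close>)

lemma vandermonde_leibniz:
  "vandermonde n = (\<Sum>p | p permutes {..<n}. of_int (sign p) * (\<Prod>i<n. mvar i ^ (n - 1 - p i)))"
  unfolding vandermonde_pairs fdet_vandermonde[symmetric] fdet_leibniz ..

lemma coef_leibniz:
  "coef n F nu = (\<Sum>p | p permutes {..<n}. of_int (sign p) * mcoeff (F * (\<Prod>i<n. mvar i ^ (n - 1 - p i))) (stair n nu))"
proof -
  have "F * vandermonde n = (\<Sum>p | p permutes {..<n}. of_int (sign p) * (F * (\<Prod>i<n. mvar i ^ (n - 1 - p i))))"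
    unfolding vandermonde_leibniz sum_distrib_left by (simp only: mult.left_commute)
  then show ?thesis by (simp only: coef_def mcoeff_sum mcoeff_of_int_times)
qed

text \<open>This makes the staircase the unique leading exponent of the Vandermonde determinant for the
  weight \<open>\<Sum>i<n. a\<^sub>i * (n - i)\<close>.\<close>

lemma staircase_weight:
  fixes p :: "nat \<Rightarrow> nat"
  assumes p: "p permutes {..<n}" "p \<noteq> id"
  shows "(\<Sum>i<n. (n - 1 - p i) * (n - i)) < (\<Sum>i<n. (n - 1 - i) * (n - i))"
proof -
  have pn: "p i < n" if "i < n" for i using that permutes_in_image[OF p(1), of i] by simp
  have perm: "(\<Sum>i<n. g (p i)) = (\<Sum>i<n. g i)" for g :: "nat \<Rightarrow> int"
    using sum.permute[OF p(1), of g] by simp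
  obtain k where k: "p k \<noteq> k" using p(2) by (auto simp: fun_eq_iff)
  then have kn: "k < n" using p(1) by (metis lessThan_iff permutes_not_in)
  \<comment> \<open>Rearrangement inequality: this sum is twice the difference of
    \<open>\<Sum>i<n. i * i\<close> and \<open>\<Sum>i<n. i * p i\<close>.\<close>
  have "0 < (\<Sum>i<n. (int i - int (p i)) ^ 2)"
    by (rule sum_pos2[of _ k]) (use k kn in auto)
  also have "(\<Sum>i<n. (int i - int (p i)) ^ 2)
    = (\<Sum>i<n. (int i) ^ 2) + (\<Sum>i<n. (int (p i)) ^ 2) - 2 * (\<Sum>i<n. int i * int (p i))"
    by (simp add: power2_diff sum.distrib sum_subtractf sum_distrib_left mult_ac)
  also have "(\<Sum>i<n. (int (p i)) ^ 2) = (\<Sum>i<n. (int i) ^ 2)" by (rule perm)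
  finally have pos: "(\<Sum>i<n. int i * int (p i)) < (\<Sum>i<n. int i * int i)" by (simp add: power2_eq_square)
  have eq: "int (\<Sum>i<n. (n - 1 - q i) * (n - i)) = (\<Sum>i<n. (int n - 1) * (int n - int i)) - int n * (\<Sum>i<n. int (q i)) + (\<Sum>i<n. int i * int (q i))"
    if "\<And>i. i < n \<Longrightarrow> q i < n" for q
  proof -
    have "int (\<Sum>i<n. (n - 1 - q i) * (n - i)) = (\<Sum>i<n. (int n - 1 - int (q i)) * (int n - int i))"
      unfolding of_nat_sum
    proof (rule sum.cong)
      fix i assume "i \<in> {..<n}"
      then show "int ((n - 1 - q i) * (n - i)) = (int n - 1 - int (q i)) * (int n - int i)"
        using that[of i] by (simp add: of_nat_diff)
    qed simp
    also have "\<dots> = (\<Sum>i<n. (int n - 1) * (int n - int i) - int n * int (q i) + int i * int (q i))"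
      by (rule sum.cong) (simp_all add: algebra_simps)
    finally show ?thesis by (simp only: sum.distrib sum_subtractf sum_distrib_left)
  qed
  have e1: "int (\<Sum>i<n. (n - 1 - p i) * (n - i)) = (\<Sum>i<n. (int n - 1) * (int n - int i)) - int n * (\<Sum>i<n. int i) + (\<Sum>i<n. int i * int (p i))"
  proof -
    have "int (\<Sum>i<n. (n - 1 - p i) * (n - i)) = (\<Sum>i<n. (int n - 1) * (int n - int i)) - int n * (\<Sum>i<n. int (p i)) + (\<Sum>i<n. int i * int (p i))"
      by (rule eq) (rule pn)
    also have "(\<Sum>i<n. int (p i)) = (\<Sum>i<n. int i)" by (rule perm)
    finally show ?thesis .
  qed
  have e2: "int (\<Sum>i<n. (n - 1 - i) * (n - i)) = (\<Sum>i<n. (int n - 1) * (int n - int i)) - int n * (\<Sum>i<n. int i) + (\<Sum>i<n. int i * int i)"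
    by (rule eq)
  have "int (\<Sum>i<n. (n - 1 - p i) * (n - i)) < int (\<Sum>i<n. (n - 1 - i) * (n - i))"
    unfolding e1 e2 using pos by linarith
  then show ?thesis by (simp only: of_nat_less_iff)
qed

text \<open>Among the exponents of \<open>F\<close> in \<open>n\<close> variables and of one fixed
  degree, a finite set, one of maximal weight is a partition by symmetry. At that partition plus the
  staircase only the leading term of the Vandermonde determinant contributes, so a nonzero
  coefficient of \<open>F\<close> is a Schur coefficient.\<close>

lemma symmetric_eq_0I:
  assumes sym: "symmetric F" and coef: "\<And>n nu. plength nu \<le> n \<Longrightarrow> coef n F nu = 0"
  shows "F = 0"
proof (rule ccontr)
  assume "F \<noteq> 0"
  then obtain a0 where a0: "mcoeff F a0 \<noteq> 0" by (metis mcoeff_0 mfps_eqI)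
  obtain n where n: "Poly_Mapping.keys a0 \<subseteq> {..<n}" using ex_keys_bound[of 0 a0] by blast
  define S where "S = {a. Poly_Mapping.keys a \<subseteq> {..<n} \<and> mdegree a = mdegree a0 \<and> mcoeff F a \<noteq> 0}"
  define w where "w a = (\<Sum>i<n. Poly_Mapping.lookup a i * (n - i))" for a :: monom
  have "finite S" unfolding S_def
    by (rule finite_subset[OF _ finite_mdegree_bounded[of n "mdegree a0"]]) auto
  moreover have "a0 \<in> S" using a0 n by (simp add: S_def)
  ultimately obtain a where a: "a \<in> S" "\<And>b. b \<in> S \<Longrightarrow> w b \<le> w a"
    using Max_in[of "w ` S"] Max_ge[of "w ` S"] by (metis (no_types, lifting) empty_iff finite_imageI imageE image_eqI image_is_empty)
  have keys: "Poly_Mapping.keys a \<subseteq> {..<n}" using a(1) by (simp add: S_def)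
  \<comment> \<open>Swapping two adjacent exponents in increasing order would stay in
    \<open>S\<close> by symmetry and raise the weight.\<close>
  have dec: "Poly_Mapping.lookup a (Suc i) \<le> Poly_Mapping.lookup a i" for i
  proof (cases "Suc i < n")
    case True
    let ?t = "Transposition.transpose i (Suc i)"
    let ?b = "Poly_Mapping.map_key ?t a"
    have t: "bij ?t" by simp
    have "Poly_Mapping.keys ?b \<subseteq> {..<n}"
    proof
      fix k assume "k \<in> Poly_Mapping.keys ?b"
      then have "?t k < n" using keys by (auto simp: keys_map_key[OF t])
      then show "k \<in> {..<n}" using True by (cases "k = i"; cases "k = Suc i") (auto simp: transpose_def)
    qed
    then have "?b \<in> S" using a(1) by (simp add: S_def mdegree_map_key[OF t] symmetricD[OF sym t])
    then have le: "w ?b \<le> w a" by (rule a(2))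
    have W: "w c = Poly_Mapping.lookup c i * (n - i) + (Poly_Mapping.lookup c (Suc i) * (n - Suc i)
        + (\<Sum>j\<in>{..<n} - {i} - {Suc i}. Poly_Mapping.lookup c j * (n - j)))" for c
      unfolding w_def using True
      by (subst sum.remove[of _ i], simp, simp, subst sum.remove[of _ "Suc i"]) auto
    have R: "(\<Sum>j\<in>{..<n} - {i} - {Suc i}. Poly_Mapping.lookup ?b j * (n - j))
      = (\<Sum>j\<in>{..<n} - {i} - {Suc i}. Poly_Mapping.lookup a j * (n - j))"
      by (rule sum.cong) (auto simp: lookup_map_key[OF t] transpose_def)
    have ni: "n - i = Suc (n - Suc i)" using True by simp
    show ?thesis using le unfolding W[of a] W[of ?b] R ni
      by (simp add: lookup_map_key[OF t] transpose_def)
  next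
    case False
    then have "Suc i \<notin> Poly_Mapping.keys a" using keys by auto
    then show ?thesis by (simp add: in_keys_iff)
  qed
  then have "antimono (Poly_Mapping.lookup a)" by (simp add: decseq_SucI)
  moreover have "finite {i. Poly_Mapping.lookup a i \<noteq> 0}" by simp
  ultimately have P: "part (Abs_partition (Poly_Mapping.lookup a)) = Poly_Mapping.lookup a"
    by (simp add: Abs_partition_inverse)
  define nu where "nu = Abs_partition (Poly_Mapping.lookup a)"
  have part: "part nu = Poly_Mapping.lookup a" by (simp add: nu_def P)
  have "n \<notin> Poly_Mapping.keys a" using keys by auto
  then have "part nu n = 0" by (simp add: part in_keys_iff)
  then have len: "plength nu \<le> n" by (simp add: part_eq_0_iff)
  have stair: "stair n nu = a + monom_of n (\<lambda>i. n - 1 - i)"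
    unfolding stair_def part
    by (rule poly_mapping_eqI) (use keys in \<open>auto simp: lookup_add lookup_monom_of in_keys_iff\<close>)
  \<comment> \<open>Such a \<open>b\<close> would lie in \<open>S\<close>. As \<open>p\<close>
    lowers the weight of the staircase, \<open>b\<close> would outweigh \<open>a\<close>.\<close>
  have other: "mcoeff (F * (\<Prod>i<n. mvar i ^ (n - 1 - p i))) (stair n nu) = 0"
    if p: "p permutes {..<n}" "p \<noteq> id" for p :: "nat \<Rightarrow> nat"
  proof (rule mcoeff_times_mvar_powers_zero, rule ccontr)
    fix b assume b: "b + monom_of n (\<lambda>i. n - 1 - p i) = stair n nu" and nz: "mcoeff F b \<noteq> 0"
    have eq: "Poly_Mapping.lookup b i + (n - 1 - p i) = Poly_Mapping.lookup a i + (n - 1 - i)" if "i < n" for i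
    proof -
      have "Poly_Mapping.lookup (b + monom_of n (\<lambda>i. n - 1 - p i)) i = Poly_Mapping.lookup (stair n nu) i"
        using b by (simp only:)
      then show ?thesis using that by (simp add: lookup_add lookup_monom_of stair)
    qed
    have "Poly_Mapping.keys b \<subseteq> Poly_Mapping.keys (stair n nu)" unfolding b[symmetric] keys_add_nat by simp
    then have kb: "Poly_Mapping.keys b \<subseteq> {..<n}" using keys_monom_of unfolding stair_def by blast
    have "(\<Sum>i<n. n - 1 - p i) = (\<Sum>i<n. n - 1 - i)"
      using sum.permute[OF p(1), of "\<lambda>i. n - 1 - i"] by (simp add: comp_def)
    moreover have "(\<Sum>i<n. Poly_Mapping.lookup b i) + (\<Sum>i<n. n - 1 - p i) = (\<Sum>i<n. Poly_Mapping.lookup a i) + (\<Sum>i<n. n - 1 - i)"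
      unfolding sum.distrib[symmetric] by (rule sum.cong) (use eq in auto)
    ultimately have "mdegree b = mdegree a"
      using mdegree_superset[OF _ kb] mdegree_superset[OF _ keys] by simp
    then have "b \<in> S" using a(1) kb nz by (simp add: S_def)
    then have "w b \<le> w a" by (rule a(2))
    moreover have "w b + (\<Sum>i<n. (n - 1 - p i) * (n - i)) = w a + (\<Sum>i<n. (n - 1 - i) * (n - i))"
      unfolding w_def sum.distrib[symmetric] distrib_right[symmetric]
      by (rule sum.cong) (use eq in auto)
    ultimately show False using staircase_weight[OF p] by linarith
  qed
  have "coef n F nu = (\<Sum>p\<in>{id}. of_int (sign p) * mcoeff (F * (\<Prod>i<n. mvar i ^ (n - 1 - p i))) (stair n nu))"
    unfolding coef_leibniz
    by (rule sum.mono_neutral_right) (use other in \<open>auto simp: finite_permutations permutes_id\<close>)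
  also have "\<dots> = mcoeff F a" by (simp add: stair mcoeff_times_mvar_powers sign_id)
  finally show False using coef[OF len] a(1) by (simp add: S_def)
qed


section \<open>The Hall product\<close>

text \<open>The product of the complete homogeneous functions indexed by the exponents of
  \<open>c\<close>. Monomials serve as indices instead of partitions, so that products over disjoint
  supports are sums of indices.\<close>

definition hprod :: "monom \<Rightarrow> ratfun mfps" where
  "hprod c = (\<Prod>l\<in>Poly_Mapping.keys c. entry 0 (int (Poly_Mapping.lookup c l)) 0)"

lemma entry_zero_exponent: "entry 0 m e = entry 0 m e'"
  by (rule mfps_eqI) (simp add: mcoeff_entry_zero)

lemma entry_zero_negative: "m < 0 \<Longrightarrow> entry 0 m e = 0"
  by (rule mfps_eqI) (simp add: mcoeff_entry_zero)

lemma mdegree_eq_0_iff: "mdegree a = 0 \<longleftrightarrow> a = 0"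
proof
  assume "mdegree a = 0"
  then have "Poly_Mapping.lookup a i = 0" for i
    by (cases "i \<in> Poly_Mapping.keys a") (auto simp: mdegree_def in_keys_iff)
  then show "a = 0" by (intro poly_mapping_eqI) simp
qed simp

lemma entry_zero_0: "entry 0 0 e = 1"
  by (rule mfps_eqI) (simp add: mcoeff_entry_zero mcoeff_1 mdegree_eq_0_iff)

lemma hprod_eq:
  assumes "Poly_Mapping.keys c \<subseteq> {..<n}"
  shows "hprod c = (\<Prod>l<n. entry 0 (int (Poly_Mapping.lookup c l)) 0)"
  unfolding hprod_def
  by (rule prod.mono_neutral_left) (use assms in \<open>auto simp: in_keys_iff entry_zero_0\<close>)

lemma homogeneous_hprod: "homogeneous (int (mdegree c)) (hprod c)"
  unfolding hprod_def mdegree_def of_nat_sum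
  by (intro homogeneous_prod) (auto simp: homogeneous_def mcoeff_entry_zero split: if_splits)

lemma symmetric_hprod: "symmetric (hprod c)"
  unfolding hprod_def by (intro symmetric_prod symmetric_entry)

lemma hprod_in_Lambda: "hprod c \<in> Lambda"
  by (simp add: Lambda_iff symmetric_hprod bounded_degree_homogeneous[OF homogeneous_hprod])

lemma hprod_add:
  assumes "Poly_Mapping.keys a \<inter> Poly_Mapping.keys c = {}"
  shows "hprod (a + c) = hprod a * hprod c"
  unfolding hprod_def keys_add_nat
  by (subst prod.union_disjoint) (use assms lookup_add_disjoint[OF assms] in \<open>simp_all cong: prod.cong\<close>)

lemma hprod_map_key:
  assumes "bij \<pi>"
  shows "hprod (Poly_Mapping.map_key \<pi> c) = hprod c"
  unfolding hprod_def keys_map_key[OF assms]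
  by (rule prod.reindex_bij_witness[where i = "inv_into UNIV \<pi>" and j = \<pi>])
    (use assms in \<open>auto simp: lookup_map_key bij_is_surj surj_f_inv_f inv_f_f bij_is_inj\<close>)

text \<open>Matrices of exponents with prescribed row sums and column sums, one monomial per row.\<close>

definition margins :: "nat \<Rightarrow> monom \<Rightarrow> monom \<Rightarrow> (nat \<Rightarrow> monom) set" where
  "margins n a c = {g \<in> families n a. \<forall>l<n. mdegree (g l) = Poly_Mapping.lookup c l}"

definition transpose_family :: "nat \<Rightarrow> (nat \<Rightarrow> monom) \<Rightarrow> nat \<Rightarrow> monom" where
  "transpose_family n g i = (if i < n then monom_of n (\<lambda>l. Poly_Mapping.lookup (g l) i) else 0)"

lemma transpose_family_margins:
  assumes "Poly_Mapping.keys a \<subseteq> {..<n}" "Poly_Mapping.keys c \<subseteq> {..<n}" "g \<in> margins n a c"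
  shows "transpose_family n g \<in> margins n c a" "transpose_family n (transpose_family n g) = g"
proof -
  have g: "g \<in> families n a" "\<And>l. l < n \<Longrightarrow> mdegree (g l) = Poly_Mapping.lookup c l"
    using assms(3) by (auto simp: margins_def)
  have keys: "Poly_Mapping.keys (g l) \<subseteq> {..<n}" for l
    using keys_families[OF g(1), of l] assms(1) by blast
  have "(\<Sum>i<n. transpose_family n g i) = c"
  proof (rule poly_mapping_eqI)
    fix k
    have "Poly_Mapping.lookup (\<Sum>i<n. transpose_family n g i) k = (if k < n then \<Sum>i<n. Poly_Mapping.lookup (g k) i else 0)"
      by (simp add: lookup_sum_monom transpose_family_def lookup_monom_of)
    also have "\<dots> = Poly_Mapping.lookup c k"
      using g(2)[of k] mdegree_superset[OF _ keys[of k]] assms(2) by (auto simp: in_keys_iff)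
    finally show "Poly_Mapping.lookup (\<Sum>i<n. transpose_family n g i) k = Poly_Mapping.lookup c k" .
  qed
  moreover have "mdegree (transpose_family n g i) = Poly_Mapping.lookup a i" if "i < n" for i
  proof -
    have "mdegree (transpose_family n g i) = Poly_Mapping.lookup (\<Sum>l<n. g l) i"
      using that by (simp add: transpose_family_def mdegree_monom_of lookup_sum_monom)
    then show ?thesis using g(1) by (simp add: families_def)
  qed
  ultimately show "transpose_family n g \<in> margins n c a"
    by (simp add: margins_def families_def transpose_family_def)
  show "transpose_family n (transpose_family n g) = g"
  proof
    fix l
    show "transpose_family n (transpose_family n g) l = g l"
    proof (cases "l < n")
      case True
      have "transpose_family n (transpose_family n g) l = monom_of n (Poly_Mapping.lookup (g l))"
        unfolding transpose_family_def monom_of_def using True by (auto simp: lookup_monom_of[unfolded monom_of_def] intro!: sum.cong)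
      then show ?thesis using monom_of_lookup[OF keys] by simp
    qed (use g(1) in \<open>simp add: transpose_family_def families_def\<close>)
  qed
qed

lemma card_margins_commute:
  assumes "Poly_Mapping.keys a \<subseteq> {..<n}" "Poly_Mapping.keys c \<subseteq> {..<n}"
  shows "card (margins n a c) = card (margins n c a)"
proof (rule bij_betw_same_card)
  show "bij_betw (transpose_family n) (margins n a c) (margins n c a)"
    by (rule bij_betw_byWitness[where f' = "transpose_family n"])
      (use transpose_family_margins[OF assms] transpose_family_margins[OF assms(2,1)] in auto)
qed

lemma mcoeff_hprod:
  assumes "Poly_Mapping.keys c \<subseteq> {..<n}"
  shows "mcoeff (hprod c) a = of_nat (card (margins n a c))"
proof -
  have *: "(\<Prod>l<n. if int (mdegree (g l)) = int (Poly_Mapping.lookup c l) then 1 else 0 :: ratfun)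
    = (if \<forall>l<n. mdegree (g l) = Poly_Mapping.lookup c l then 1 else 0)" for g
  proof (cases "\<forall>l<n. mdegree (g l) = Poly_Mapping.lookup c l")
    case False
    then obtain l where "l < n" "mdegree (g l) \<noteq> Poly_Mapping.lookup c l" by blast
    then have "(\<Prod>l<n. if int (mdegree (g l)) = int (Poly_Mapping.lookup c l) then 1 else 0 :: ratfun) = 0"
      by (intro prod_zero bexI[of _ l]) auto
    then show ?thesis using False by simp
  qed simp
  show ?thesis
    unfolding hprod_eq[OF assms] mcoeff_prod mcoeff_entry_zero * margins_def
    by (simp add: sum.If_cases Int_def)
qed

text \<open>Both sides count nonnegative integer matrices with given row and column sums;
  transposition exchanges the two.\<close>

lemma mcoeff_hprod_commute: "mcoeff (hprod c) a = mcoeff (hprod a) c"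
proof -
  obtain n where n: "Poly_Mapping.keys (a + c) \<subseteq> {..<n}" using ex_keys_bound[of 0 "a + c"] by blast
  then have a: "Poly_Mapping.keys a \<subseteq> {..<n}" and c: "Poly_Mapping.keys c \<subseteq> {..<n}" by (auto simp: keys_add_nat)
  show ?thesis by (simp only: mcoeff_hprod[OF a] mcoeff_hprod[OF c] card_margins_commute[OF a c])
qed

text \<open>Cauchy's identity in coefficients: both sides are the coefficient of \<open>s\<^sub>\<nu>\<close> in \<open>h\<^sub>c\<close>.\<close>

lemma coef_hprod:
  assumes n: "plength nu \<le> n" and c: "Poly_Mapping.keys c \<subseteq> {..<n}"
  shows "coef n (hprod c) nu = mcoeff (schur nu) c"
proof -
  let ?E = "\<lambda>p i. entry 0 (int (part nu i) - int 0 - int i + int (p i)) (int i - int (p i) - 1)"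
  have *: "mcoeff (hprod c * (\<Prod>i<n. mvar i ^ (n - 1 - p i))) (stair n nu) = mcoeff (\<Prod>i<n. ?E p i) c"
    if p: "p permutes {..<n}" for p
  proof (cases "\<forall>i<n. i \<le> part nu i + p i")
    case True
    \<comment> \<open>What remains of the staircase monomial after the Vandermonde term of
      \<open>p\<close>. The same numbers index the term of \<open>p\<close> in the Jacobi-Trudi
      determinant; if one is negative, both terms vanish.\<close>
    define e where "e i = part nu i + p i - i" for i
    have pn: "p i < n" if "i < n" for i using that permutes_in_image[OF p, of i] by simp
    have s: "stair n nu = monom_of n e + monom_of n (\<lambda>i. n - 1 - p i)"
    proof (rule poly_mapping_eqI)
      fix k
      show "Poly_Mapping.lookup (stair n nu) k = Poly_Mapping.lookup (monom_of n e + monom_of n (\<lambda>i. n - 1 - p i)) k"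
        using True pn[of k] by (auto simp: stair_def lookup_add lookup_monom_of e_def)
    qed
    have "mcoeff (hprod c * (\<Prod>i<n. mvar i ^ (n - 1 - p i))) (stair n nu) = mcoeff (hprod c) (monom_of n e)"
      unfolding s by (rule mcoeff_times_mvar_powers)
    also have "\<dots> = mcoeff (hprod (monom_of n e)) c" by (rule mcoeff_hprod_commute)
    also have "hprod (monom_of n e) = (\<Prod>i<n. ?E p i)"
      unfolding hprod_eq[OF keys_monom_of]
    proof (rule prod.cong)
      fix i assume "i \<in> {..<n}"
      then have "int (Poly_Mapping.lookup (monom_of n e) i) = int (part nu i) - int 0 - int i + int (p i)"
        using True by (simp add: lookup_monom_of e_def of_nat_diff)
      then show "entry 0 (int (Poly_Mapping.lookup (monom_of n e) i)) 0 = ?E p i"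
        by (simp only:) (rule entry_zero_exponent)
    qed simp
    finally show ?thesis .
  next
    case False
    then obtain i where i: "i < n" "part nu i + p i < i" by (meson not_le)
    then have "?E p i = 0" by (intro entry_zero_negative) simp
    then have "(\<Prod>i<n. ?E p i) = 0" using i(1) by (intro prod_zero bexI[of _ i]) auto
    moreover have "mcoeff (hprod c * (\<Prod>i<n. mvar i ^ (n - 1 - p i))) (stair n nu) = 0"
    proof (rule mcoeff_times_mvar_powers_zero)
      fix b assume "b + monom_of n (\<lambda>i. n - 1 - p i) = stair n nu"
      then have "Poly_Mapping.lookup (b + monom_of n (\<lambda>i. n - 1 - p i)) i = Poly_Mapping.lookup (stair n nu) i"
        by (simp only:)
      then have False using i by (simp add: lookup_add lookup_monom_of stair_def)
      then show "mcoeff (hprod c) b = 0" ..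
    qed
    ultimately show ?thesis by simp
  qed
  have "mcoeff (schur nu) c = (\<Sum>p | p permutes {..<n}. of_int (sign p) * mcoeff (\<Prod>i<n. ?E p i) c)"
    unfolding schur_eq groth_det_eq[OF n] jacobi_trudi_def fdet_leibniz mcoeff_sum mcoeff_of_int_times ..
  also have "\<dots> = coef n (hprod c) nu"
    unfolding coef_leibniz by (rule sum.cong) (simp_all only: mem_Collect_eq *)
  finally show ?thesis ..
qed

text \<open>A criterion for \<open>Lambda_hat\<close> that needs no Schur expansion: symmetric, and
  a polynomial in any finite set of variables.\<close>

definition sympoly :: "ratfun mfps \<Rightarrow> bool" where
  "sympoly F \<longleftrightarrow> symmetric F \<and> (\<forall>n. finite {a. Poly_Mapping.keys a \<subseteq> {..<n} \<and> mcoeff F a \<noteq> 0})"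

definition scoef :: "ratfun mfps \<Rightarrow> partition \<Rightarrow> ratfun" where
  "scoef F nu = coef (plength nu) F nu"

lemma coef_eq_scoef: "plength nu \<le> n \<Longrightarrow> coef n F nu = scoef F nu"
  unfolding scoef_def by (rule coef_stable)

lemma scoef_schur_sum: "scoef (schur_sum c) = c"
  by (rule ext) (simp add: scoef_def coef_schur_sum)

lemma bounded_degree_finite_support:
  assumes "finite {a. mcoeff F a \<noteq> 0}"
  shows "bounded_degree F"
proof -
  have "finite (mdegree ` {a. mcoeff F a \<noteq> 0})" using assms by simp
  then obtain d where "\<forall>x\<in>mdegree ` {a. mcoeff F a \<noteq> 0}. x \<le> d" by (auto simp: finite_nat_set_iff_bounded_le)
  then show ?thesis unfolding bounded_degree_def by blast
qed

text \<open>In \<open>n\<close> variables \<open>F * vandermonde n\<close> is a polynomial, so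
  finitely many partitions of length at most \<open>n\<close> occur. The series minus its Schur sum
  is symmetric without Schur coefficients, hence zero.\<close>

lemma sympoly_expand:
  assumes "sympoly F"
  shows "admissible (scoef F)" "F = schur_sum (scoef F)"
proof -
  have sym: "symmetric F" and fin: "\<And>n. finite {a. Poly_Mapping.keys a \<subseteq> {..<n} \<and> mcoeff F a \<noteq> 0}"
    using assms by (auto simp: sympoly_def)
  show "admissible (scoef F)"
    unfolding admissible_def
  proof
    fix n
    have "finite {a. mcoeff (mtrunc n F) a \<noteq> 0}"
      by (rule finite_subset[OF _ fin[of n]]) (auto simp: mcoeff_mtrunc)
    then have "bounded_degree (mtrunc n F * vandermonde n)"
      by (intro bounded_degree_times bounded_degree_finite_support bounded_degree_homogeneous[OF homogeneous_vandermonde])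
    then obtain d where d: "\<And>a. mcoeff (mtrunc n F * vandermonde n) a \<noteq> 0 \<Longrightarrow> mdegree a \<le> d"
      unfolding bounded_degree_def by blast
    have "{lam. plength lam \<le> n \<and> scoef F lam \<noteq> 0} \<subseteq> {lam. psize lam \<le> d}"
    proof clarify
      fix lam assume lam: "plength lam \<le> n" "scoef F lam \<noteq> 0"
      then have "mcoeff (mtrunc n F * vandermonde n) (stair n lam) \<noteq> 0"
        by (simp add: coef_eq_scoef[symmetric] coef_mtrunc)
      then show "psize lam \<le> d" using d psize_le_stair[OF lam(1)] order_trans by blast
    qed
    then show "finite {lam. plength lam \<le> n \<and> scoef F lam \<noteq> 0}" using finite_psize finite_subset by blast
  qed
  have "F - schur_sum (scoef F) = 0"
  proof (rule symmetric_eq_0I)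
    show "symmetric (F - schur_sum (scoef F))" using sym symmetric_schur_sum by (rule symmetric_diff)
    show "coef n (F - schur_sum (scoef F)) nu = 0" if "plength nu \<le> n" for n nu
      using that by (simp add: coef_diff coef_schur_sum coef_eq_scoef scoef_schur_sum)
  qed
  then show "F = schur_sum (scoef F)" by simp
qed

lemma sympoly_Lambda_hat: "sympoly F \<Longrightarrow> F \<in> Lambda_hat"
  unfolding Lambda_hat_def using sympoly_expand by blast

lemma schur_coeff_eq: "F \<in> Lambda_hat \<Longrightarrow> schur_coeff F = scoef F"
  unfolding Lambda_hat_def by (auto simp: schur_coeff_schur_sum scoef_schur_sum)

lemma Lambda_hat_expand: "F \<in> Lambda_hat \<Longrightarrow> F = schur_sum (scoef F)"
  unfolding Lambda_hat_def by (auto simp: scoef_schur_sum)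

lemma sympoly_Lambda:
  assumes "F \<in> Lambda"
  shows "sympoly F"
proof -
  obtain d where d: "\<And>a. mcoeff F a \<noteq> 0 \<Longrightarrow> mdegree a \<le> d"
    using assms unfolding Lambda_iff bounded_degree_def by blast
  have "finite {a. Poly_Mapping.keys a \<subseteq> {..<n} \<and> mcoeff F a \<noteq> 0}" for n
    by (rule finite_subset[OF _ finite_mdegree_bounded[of n d]]) (use d in auto)
  then show ?thesis using assms by (simp add: sympoly_def Lambda_iff)
qed

lemma Lambda_subset_Lambda_hat: "F \<in> Lambda \<Longrightarrow> F \<in> Lambda_hat"
  by (intro sympoly_Lambda_hat sympoly_Lambda)

lemma Lambda_0: "0 \<in> Lambda"
  by (simp add: Lambda_iff bounded_degree_0)

lemma Lambda_add: "F \<in> Lambda \<Longrightarrow> G \<in> Lambda \<Longrightarrow> F + G \<in> Lambda"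
  by (simp add: Lambda_iff symmetric_add bounded_degree_add)

lemma Lambda_times: "F \<in> Lambda \<Longrightarrow> G \<in> Lambda \<Longrightarrow> F * G \<in> Lambda"
  by (simp add: Lambda_iff symmetric_times bounded_degree_times)

lemma Lambda_mconst_times: "F \<in> Lambda \<Longrightarrow> mconst c * F \<in> Lambda"
  by (simp add: Lambda_iff symmetric_times bounded_degree_times bounded_degree_mconst)

lemma Lambda_sum: "(\<And>i. i \<in> I \<Longrightarrow> F i \<in> Lambda) \<Longrightarrow> (\<Sum>i\<in>I. F i) \<in> Lambda"
  by (induction I rule: infinite_finite_induct) (auto intro: Lambda_add Lambda_0)

lemma card_pairs_below: "card (pairs_below n) = (\<Sum>i<n. n - 1 - i)"
proof (induction n)
  case 0
  then show ?case by (simp add: pairs_below_def)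
next
  case (Suc n)
  have "pairs_below n \<inter> (\<lambda>i. (i, n)) ` {..<n} = {}" by (auto simp: pairs_below_def)
  then have "card (pairs_below (Suc n)) = card (pairs_below n) + n"
    unfolding pairs_below_Suc by (subst card_Un_disjoint) (auto simp: card_image inj_on_def)
  moreover have "(\<Sum>i<Suc n. Suc n - 1 - i) = n + (\<Sum>i<n. n - 1 - i)"
    by (subst sum.lessThan_Suc_shift) simp
  ultimately show ?case using Suc by simp
qed

text \<open>The Vandermonde determinant and the staircase have the same degree, so a degree bound on
  \<open>h\<close> bounds the size of the partitions, whatever their length.\<close>

lemma finite_scoef_Lambda:
  assumes "h \<in> Lambda"
  shows "finite {lam. scoef h lam \<noteq> 0}"
proof -
  obtain d where d: "\<And>a. mcoeff h a \<noteq> 0 \<Longrightarrow> mdegree a \<le> d"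
    using assms unfolding Lambda_iff bounded_degree_def by blast
  have "psize lam \<le> d" if nz: "scoef h lam \<noteq> 0" for lam
  proof -
    let ?n = "plength lam"
    obtain b c where bc: "b + c = stair ?n lam" "mcoeff h b \<noteq> 0" "mcoeff (vandermonde ?n) c \<noteq> 0"
      using nz unfolding scoef_def coef_def by (rule mcoeff_times_nonzeroE)
    have "mdegree c = card (pairs_below ?n)"
      using homogeneous_vandermonde[of ?n] bc(3) by (simp add: homogeneous_def)
    then have "mdegree (stair ?n lam) \<le> d + card (pairs_below ?n)"
      using d[OF bc(2)] mdegree_add[of b c] bc(1) by simp
    moreover have "mdegree (stair ?n lam) = psize lam + card (pairs_below ?n)"
      unfolding stair_def mdegree_monom_of card_pairs_below psize_def by (rule sum.distrib)
    ultimately show ?thesis by simp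
  qed
  then have "{lam. scoef h lam \<noteq> 0} \<subseteq> {lam. psize lam \<le> d}" by blast
  then show ?thesis using finite_psize by (rule finite_subset)
qed

lemma hall_eq_sum:
  assumes "F \<in> Lambda_hat" "h \<in> Lambda" "finite L" "{lam. scoef h lam \<noteq> 0} \<subseteq> L"
  shows "hall F h = (\<Sum>lam\<in>L. scoef F lam * scoef h lam)"
  unfolding hall_def schur_coeff_eq[OF assms(1)] schur_coeff_eq[OF Lambda_subset_Lambda_hat[OF assms(2)]]
  by (rule Sum_any.expand_superset) (use assms(3,4) in auto)

lemma scoef_add: "scoef (F + G) nu = scoef F nu + scoef G nu"
  by (simp add: scoef_def coef_add)

lemma scoef_mconst_times: "scoef (mconst c * F) nu = c * scoef F nu"
  by (simp add: scoef_def coef_mconst_times)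

lemma hall_add_right:
  assumes "F \<in> Lambda_hat" "f \<in> Lambda" "g \<in> Lambda"
  shows "hall F (f + g) = hall F f + hall F g"
proof -
  let ?L = "{lam. scoef f lam \<noteq> 0} \<union> {lam. scoef g lam \<noteq> 0}"
  have L: "finite ?L" using finite_scoef_Lambda assms by blast
  have s: "{lam. scoef f lam \<noteq> 0} \<subseteq> ?L" "{lam. scoef g lam \<noteq> 0} \<subseteq> ?L" "{lam. scoef (f + g) lam \<noteq> 0} \<subseteq> ?L"
    by (auto simp: scoef_add)
  show ?thesis
    unfolding hall_eq_sum[OF assms(1) assms(2) L s(1)] hall_eq_sum[OF assms(1) assms(3) L s(2)]
      hall_eq_sum[OF assms(1) Lambda_add[OF assms(2,3)] L s(3)]
    by (simp only: scoef_add distrib_left sum.distrib)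
qed

lemma hall_mconst_right:
  assumes "F \<in> Lambda_hat" "f \<in> Lambda"
  shows "hall F (mconst c * f) = c * hall F f"
proof -
  let ?L = "{lam. scoef f lam \<noteq> 0}"
  have L: "finite ?L" using finite_scoef_Lambda assms by blast
  have s: "{lam. scoef (mconst c * f) lam \<noteq> 0} \<subseteq> ?L" by (auto simp: scoef_mconst_times)
  show ?thesis
    unfolding hall_eq_sum[OF assms L subset_refl] hall_eq_sum[OF assms(1) Lambda_mconst_times[OF assms(2)] L s]
    by (simp only: scoef_mconst_times sum_distrib_left mult.left_commute)
qed

lemma scoef_0 [simp]: "scoef 0 nu = 0"
  by (simp add: scoef_def)

lemma hall_0_right: "F \<in> Lambda_hat \<Longrightarrow> hall F 0 = 0"
  using hall_eq_sum[of F 0 "{}"] Lambda_0 by simp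

lemma scoef_hprod: "scoef (hprod c) nu = mcoeff (schur nu) c"
proof -
  obtain n where "n \<ge> plength nu" "Poly_Mapping.keys c \<subseteq> {..<n}" using ex_keys_bound[of "plength nu" c] by blast
  then show ?thesis using coef_hprod[of nu n c] coef_eq_scoef[of nu n] by simp
qed

lemma hall_hprod:
  assumes "F \<in> Lambda_hat"
  shows "hall F (hprod c) = mcoeff F c"
proof -
  have "hall F (hprod c) = mcoeff (schur_sum (scoef F)) c"
    unfolding hall_def schur_coeff_eq[OF assms] schur_coeff_eq[OF Lambda_subset_Lambda_hat[OF hprod_in_Lambda]] scoef_hprod
    by (simp add: schur_sum_def)
  then show ?thesis using Lambda_hat_expand[OF assms] by simp
qed

lemma Lambda_expand_finite:
  assumes "h \<in> Lambda"
  shows "h = (\<Sum>lam | scoef h lam \<noteq> 0. mconst (scoef h lam) * schur lam)"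
proof (rule mfps_eqI)
  fix a
  have "mcoeff h a = mcoeff (schur_sum (scoef h)) a"
    using sympoly_expand(2)[OF sympoly_Lambda[OF assms]] by simp
  also have "\<dots> = (\<Sum>lam | scoef h lam \<noteq> 0. scoef h lam * mcoeff (schur lam) a)"
    unfolding schur_sum_def mcoeff_Abs
    by (rule Sum_any.expand_superset) (use finite_scoef_Lambda[OF assms] in auto)
  finally show "mcoeff h a = mcoeff (\<Sum>lam | scoef h lam \<noteq> 0. mconst (scoef h lam) * schur lam) a" by simp
qed

text \<open>Schur expansions in \<open>Lambda\<close> are finite, and Jacobi-Trudi at parameter zero
  writes each Schur function in the \<open>hprod\<close>. The terms with a negative index are
  zero.\<close>

lemma Lambda_induct [consumes 1, case_names zero hprod add scale]:
  assumes h: "h \<in> Lambda"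
    and zero: "P 0" and hprod: "\<And>c. P (hprod c)"
    and add: "\<And>f g. f \<in> Lambda \<Longrightarrow> g \<in> Lambda \<Longrightarrow> P f \<Longrightarrow> P g \<Longrightarrow> P (f + g)"
    and scale: "\<And>k f. f \<in> Lambda \<Longrightarrow> P f \<Longrightarrow> P (mconst k * f)"
  shows "P h"
proof -
  have sums: "(\<And>i. i \<in> I \<Longrightarrow> F i \<in> Lambda) \<Longrightarrow> (\<And>i. i \<in> I \<Longrightarrow> P (F i)) \<Longrightarrow> P (\<Sum>i\<in>I. F i)"
    for F :: "'b \<Rightarrow> ratfun mfps" and I
    by (induction I rule: infinite_finite_induct) (auto intro!: add zero Lambda_sum)
  have prods: "(\<Prod>i<n. entry 0 (m i) (e i)) \<in> Lambda \<and> P (\<Prod>i<n. entry 0 (m i) (e i))" for n :: nat and m e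
  proof (cases "\<forall>i<n. 0 \<le> m i")
    case True
    let ?c = "monom_of n (\<lambda>i. nat (m i))"
    have "(\<Prod>i<n. entry 0 (m i) (e i)) = hprod ?c"
      unfolding hprod_eq[OF keys_monom_of]
    proof (rule prod.cong)
      fix i assume "i \<in> {..<n}"
      then have "int (Poly_Mapping.lookup ?c i) = m i" using True by (simp add: lookup_monom_of)
      then show "entry 0 (m i) (e i) = entry 0 (int (Poly_Mapping.lookup ?c i)) 0"
        by (simp only:) (rule entry_zero_exponent)
    qed simp
    then show ?thesis using hprod hprod_in_Lambda by simp
  next
    case False
    then obtain i where "i < n" "m i < 0" by (auto simp: not_le)
    then have "(\<Prod>i<n. entry 0 (m i) (e i)) = 0"
      by (intro prod_zero bexI[of _ i]) (auto intro: entry_zero_negative)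
    then show ?thesis using zero Lambda_0 by simp
  qed
  have "P (schur lam)" for lam
  proof -
    let ?n = "plength lam"
    have "schur lam = (\<Sum>p | p permutes {..<?n}. mconst (of_int (sign p)) *
        (\<Prod>i<?n. entry 0 (int (part lam i) - int 0 - int i + int (p i)) (int i - int (p i) - 1)))"
      by (simp add: schur_eq groth_det_def jacobi_trudi_def fdet_leibniz)
    also have "P \<dots>"
      by (rule sums, rule Lambda_mconst_times[OF conjunct1[OF prods]],
          rule scale[OF conjunct1[OF prods] conjunct2[OF prods]])
    finally show ?thesis .
  qed
  then have "P (\<Sum>lam | scoef h lam \<noteq> 0. mconst (scoef h lam) * schur lam)"
    by (intro sums Lambda_mconst_times scale schur_in_Lambda)
  then show ?thesis using Lambda_expand_finite[OF h] by simp
qed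

text \<open>The series has unbounded degree, but in finitely many variables it is a bounded
  alternant divided by a homogeneous Vandermonde determinant. The number of variables is enlarged to
  the length so that the formula applies.\<close>

lemma sympoly_groth_det: "sympoly (groth_det b lam)"
proof -
  let ?G = "groth_det b lam"
  have "finite {a. Poly_Mapping.keys a \<subseteq> {..<n} \<and> mcoeff ?G a \<noteq> 0}" for n
  proof -
    let ?N = "max n (plength lam)"
    have "bounded_degree (mtrunc ?N ?G * vandermonde ?N)"
      unfolding bialternant[OF max.cobounded2]
      by (intro bounded_degree_fdet bounded_degree_times bounded_degree_power bounded_degree_add
          bounded_degree_mvar bounded_degree_1 bounded_degree_mconst)
    then have "bounded_degree (mtrunc ?N ?G)"
      by (rule bounded_degree_quotient[OF homogeneous_vandermonde nonzerodiv_vandermonde])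
    then obtain d where d: "\<And>a. mcoeff (mtrunc ?N ?G) a \<noteq> 0 \<Longrightarrow> mdegree a \<le> d"
      unfolding bounded_degree_def by blast
    have "{a. Poly_Mapping.keys a \<subseteq> {..<n} \<and> mcoeff ?G a \<noteq> 0} \<subseteq> {a. Poly_Mapping.keys a \<subseteq> {..<n} \<and> mdegree a \<le> d}"
    proof clarify
      fix a assume a: "Poly_Mapping.keys a \<subseteq> {..<n}" "mcoeff ?G a \<noteq> 0"
      then have "Poly_Mapping.keys a \<subseteq> {..<?N}" by auto
      then show "mdegree a \<le> d" using a by (intro d) (simp add: mcoeff_mtrunc)
    qed
    then show ?thesis using finite_mdegree_bounded finite_subset by blast
  qed
  then show ?thesis by (simp add: sympoly_def symmetric_groth_det)
qed

lemma groth_det_Lambda_hat: "groth_det b lam \<in> Lambda_hat"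
  by (intro sympoly_Lambda_hat sympoly_groth_det)

lemma groth_eq: "groth lam = groth_det beta lam"
  unfolding groth_def
proof (rule the_equality)
  show "groth_det beta lam \<in> Lambda_hat \<and> (\<forall>n\<ge>plength lam. mtrunc n (groth_det beta lam) * vandermonde n =
       det (mat n n (\<lambda>(i, j). mvar i ^ (part lam j + (n - 1 - j)) * (1 + mconst beta * mvar i) ^ j)))"
    using bialternant[of lam _ beta] by (simp add: groth_det_Lambda_hat fdet_def)
next
  fix F assume F: "F \<in> Lambda_hat \<and> (\<forall>n\<ge>plength lam. mtrunc n F * vandermonde n =
       det (mat n n (\<lambda>(i, j). mvar i ^ (part lam j + (n - 1 - j)) * (1 + mconst beta * mvar i) ^ j)))"
  show "F = groth_det beta lam"
    by (rule bialternant_unique) (use F in \<open>simp add: fdet_def\<close>)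
qed

text \<open>The row of an index \<open>x\<close> maximal for \<open>s\<close> has only its diagonal
  entry, so its unknown is \<open>d x\<close>; its contribution is moved to the right-hand side of
  the smaller system.\<close>

lemma solve_triangular:
  fixes A :: "'a \<Rightarrow> 'a \<Rightarrow> 'b::comm_ring_1" and s :: "'a \<Rightarrow> nat"
  assumes "finite S" "\<And>x. A x x = 1" "\<And>x y. A x y \<noteq> 0 \<Longrightarrow> x = y \<or> s x < s y"
  shows "\<exists>m. \<forall>x\<in>S. (\<Sum>y\<in>S. A x y * m y) = d x"
  using assms(1)
proof (induction S arbitrary: d rule: finite_ranking_induct[where f = s])
  case empty
  then show ?case by simp
next
  case (insert x S)
  show ?case
  proof (cases "x \<in> S")
    case True
    then show ?thesis using insert.IH[of d] by (simp add: insert_absorb)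
  next
    case False
    obtain m where m: "\<And>z. z \<in> S \<Longrightarrow> (\<Sum>y\<in>S. A z y * m y) = d z - A z x * d x"
      using insert.IH[of "\<lambda>z. d z - A z x * d x"] by blast
    have zero: "A x y = 0" if "y \<in> S" for y
      using insert.hyps(2)[OF that] assms(3)[of x y] that False by (metis linorder_not_less)
    have S: "(\<Sum>y\<in>S. A z y * (m(x := d x)) y) = (\<Sum>y\<in>S. A z y * m y)" for z
      by (rule sum.cong) (use False in auto)
    have "(\<Sum>y\<in>insert x S. A z y * (m(x := d x)) y) = d z" if "z \<in> insert x S" for z
    proof (cases "z = x")
      case True
      have "(\<Sum>y\<in>S. A x y * m y) = 0" by (rule sum.neutral) (simp add: zero)
      then show ?thesis using True False insert.hyps(1) S[of x] by (simp add: assms(2))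
    next
      case False
      then have "z \<in> S" using that by simp
      then show ?thesis using \<open>x \<notin> S\<close> insert.hyps(1) S[of z] m[of z] by simp
    qed
    then show ?thesis by blast
  qed
qed

lemma scoef_groth_det_zero: "\<not> part_subset lam nu \<Longrightarrow> scoef (groth_det b lam) nu = 0"
  unfolding scoef_def by (rule coef_groth_det_zero) auto

lemma scoef_groth_det_self: "scoef (groth_det b lam) lam = 1"
  unfolding scoef_def by (rule coef_groth_det_self) simp

lemma scoef_groth_det_cases: "scoef (groth_det b lam) nu \<noteq> 0 \<Longrightarrow> lam = nu \<or> psize lam < psize nu"
  using scoef_groth_det_zero psize_mono_strict by blast

lemma scoef_schur: "scoef (schur lam) nu = (if lam = nu then 1 else 0)"
  unfolding scoef_def by (rule coef_schur) simp

text \<open>A combination of Schur functions inside \<open>mu\<close> solves a finite unitriangular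
  system. Partitions \<open>lam\<close> not inside \<open>mu\<close> pair to zero automatically, as
  \<open>groth_det b lam\<close> only involves partitions containing \<open>lam\<close>.\<close>

lemma ex_dual_groth: "\<exists>g\<in>Lambda. \<forall>lam. hall (groth_det b lam) g = (if lam = mu then 1 else 0)"
proof -
  let ?S = "{nu. part_subset nu mu}"
  obtain m where m: "\<And>lam. part_subset lam mu \<Longrightarrow>
      (\<Sum>nu\<in>?S. scoef (groth_det b lam) nu * m nu) = (if lam = mu then 1 else 0)"
    using solve_triangular[OF finite_part_subset[of mu], of "\<lambda>lam. scoef (groth_det b lam)" psize "\<lambda>lam. if lam = mu then 1 else 0"]
      scoef_groth_det_self scoef_groth_det_cases by auto
  define g where "g = (\<Sum>nu\<in>?S. mconst (m nu) * schur nu)"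
  have g: "g \<in> Lambda" unfolding g_def by (intro Lambda_sum Lambda_mconst_times schur_in_Lambda)
  have sg: "scoef g nu = (if nu \<in> ?S then m nu else 0)" for nu
  proof -
    have "scoef g nu = (\<Sum>nu'\<in>?S. scoef (mconst (m nu') * schur nu') nu)"
      by (simp add: g_def scoef_def coef_sum)
    also have "\<dots> = (\<Sum>nu'\<in>?S. if nu' = nu then m nu' else 0)"
      by (rule sum.cong) (auto simp: scoef_mconst_times scoef_schur)
    finally show ?thesis using finite_part_subset[of mu] by simp
  qed
  have "hall (groth_det b lam) g = (if lam = mu then 1 else 0)" for lam
  proof -
    have "hall (groth_det b lam) g = (\<Sum>nu\<in>?S. scoef (groth_det b lam) nu * scoef g nu)"
      by (rule hall_eq_sum[OF groth_det_Lambda_hat g finite_part_subset]) (auto simp: sg split: if_splits)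
    also have "\<dots> = (\<Sum>nu\<in>?S. scoef (groth_det b lam) nu * m nu)"
      by (rule sum.cong) (auto simp: sg)
    also have "\<dots> = (if lam = mu then 1 else 0)"
    proof (cases "part_subset lam mu")
      case False
      have "scoef (groth_det b lam) nu = 0" if "nu \<in> ?S" for nu
        using False that part_subset_trans by (intro scoef_groth_det_zero) blast
      then have "(\<Sum>nu\<in>?S. scoef (groth_det b lam) nu * m nu) = 0" by (intro sum.neutral) simp
      then show ?thesis using False by auto
    qed (rule m)
    finally show ?thesis .
  qed
  then show ?thesis using g by blast
qed

text \<open>For \<open>nu\<close> of maximal size in the support of \<open>h\<close>, the other
  Schur functions in \<open>groth_det b nu\<close> are larger than \<open>nu\<close>, so the pairing
  is the coefficient of \<open>h\<close> at \<open>nu\<close>.\<close>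

lemma dual_groth_unique:
  assumes h: "h \<in> Lambda" and zero: "\<And>lam. hall (groth_det b lam) h = 0"
  shows "h = 0"
proof -
  let ?L = "{lam. scoef h lam \<noteq> 0}"
  have fin: "finite ?L" by (rule finite_scoef_Lambda[OF h])
  have "?L = {}"
  proof (rule ccontr)
    assume "?L \<noteq> {}"
    then obtain nu where nu: "nu \<in> ?L" "\<And>lam. lam \<in> ?L \<Longrightarrow> psize lam \<le> psize nu"
      using fin Max_in[of "psize ` ?L"] Max_ge[of "psize ` ?L"] by (metis (no_types, lifting) finite_imageI imageE image_eqI image_is_empty)
    have "hall (groth_det b nu) h = (\<Sum>lam\<in>?L. scoef (groth_det b nu) lam * scoef h lam)"
      by (rule hall_eq_sum[OF groth_det_Lambda_hat h fin subset_refl])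
    also have "\<dots> = (\<Sum>lam\<in>?L. if lam = nu then scoef h nu else 0)"
    proof (rule sum.cong)
      fix lam assume lam: "lam \<in> ?L"
      show "scoef (groth_det b nu) lam * scoef h lam = (if lam = nu then scoef h nu else 0)"
        using nu(2)[OF lam] scoef_groth_det_cases[of b nu lam]
        by (cases "lam = nu") (auto simp: scoef_groth_det_self)
    qed simp
    also have "\<dots> = scoef h nu" using nu(1) fin by simp
    finally show False using nu(1) zero by simp
  qed
  then have "h = (\<Sum>lam\<in>{}. mconst (scoef h lam) * schur lam)" using Lambda_expand_finite[OF h] by simp
  then show ?thesis by simp
qed

lemma dual_groth: "dual_groth mu \<in> Lambda \<and> (\<forall>lam. hall (groth lam) (dual_groth mu) = (if lam = mu then 1 else 0))"
  unfolding dual_groth_def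
proof (rule theI')
  obtain g where g: "g \<in> Lambda" "\<And>lam. hall (groth lam) g = (if lam = mu then 1 else 0)"
    using ex_dual_groth[of beta mu] unfolding groth_eq by blast
  show "\<exists>!g. g \<in> Lambda \<and> (\<forall>lam. hall (groth lam) g = (if lam = mu then 1 else 0))"
  proof (rule ex1I[of _ g])
    fix g' assume g': "g' \<in> Lambda \<and> (\<forall>lam. hall (groth lam) g' = (if lam = mu then 1 else 0))"
    have "g' + mconst (- 1) * g = 0"
    proof (rule dual_groth_unique)
      show "g' + mconst (- 1) * g \<in> Lambda" using g(1) g' by (intro Lambda_add Lambda_mconst_times) auto
      show "hall (groth_det beta lam) (g' + mconst (- 1) * g) = 0" for lam
        using g g' by (simp add: hall_add_right hall_mconst_right groth_det_Lambda_hat Lambda_mconst_times groth_eq)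
    qed
    then show "g' = g" by (simp add: mconst.hom_uminus)
  qed (use g in simp)
qed


section \<open>Skew stable Grothendieck polynomials\<close>

text \<open>Exchanges the first \<open>n\<close> variables with the next \<open>n\<close>, which
  gives a symmetric series a second alphabet.\<close>

definition block_swap :: "nat \<Rightarrow> nat \<Rightarrow> nat" where
  "block_swap n i = (if i < n then i + n else if i < 2 * n then i - n else i)"

lemma block_swap_involution: "block_swap n (block_swap n i) = i"
  by (auto simp: block_swap_def)

lemma bij_block_swap: "bij (block_swap n)"
  by (rule o_bij[of "block_swap n"]) (auto simp: block_swap_involution)

lemma keys_block_swap:
  assumes "Poly_Mapping.keys c \<subseteq> {..<n}"
  shows "Poly_Mapping.keys (Poly_Mapping.map_key (block_swap n) c) \<subseteq> {n..<2 * n}"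
proof
  fix i assume "i \<in> Poly_Mapping.keys (Poly_Mapping.map_key (block_swap n) c)"
  then have "block_swap n i < n" using assms by (auto simp: keys_map_key[OF bij_block_swap])
  then show "i \<in> {n..<2 * n}" by (auto simp: block_swap_def split: if_splits)
qed

lemma hall_hprod_times_hprod:
  assumes "Poly_Mapping.keys a \<subseteq> {..<n}" "Poly_Mapping.keys c \<subseteq> {..<n}" "F \<in> Lambda_hat"
  shows "hall F (hprod a * hprod c) = mcoeff F (Poly_Mapping.map_key (block_swap n) c + a)"
proof -
  let ?c = "Poly_Mapping.map_key (block_swap n) c"
  have "Poly_Mapping.keys ?c \<inter> Poly_Mapping.keys a = {}"
    using keys_block_swap[OF assms(2)] assms(1) by fastforce
  then have "hprod (?c + a) = hprod a * hprod c"
    by (simp add: hprod_add hprod_map_key[OF bij_block_swap] mult.commute)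
  then show ?thesis using hall_hprod[OF assms(3), of "?c + a"] by simp
qed

text \<open>For \<open>f = hprod a\<close>, moving \<open>c\<close> to fresh variables makes
  \<open>hprod a * hprod c\<close> a single \<open>hprod\<close>, so the pairing is a coefficient to
  which \<open>coproduct\<close> applies. Linearity in \<open>f\<close> gives the rest.\<close>

lemma hall_groth_det_times_hprod:
  assumes "f \<in> Lambda" "plength lam \<le> r"
  shows "hall (groth_det b lam) (f * hprod c)
    = (\<Sum>mu | part_subset mu lam. hall (groth_det b mu) f * mcoeff (dslash_det b r lam mu) c)"
  using assms(1)
proof (induction f rule: Lambda_induct)
  case zero
  then show ?case by (simp add: hall_0_right groth_det_Lambda_hat)
next
  case (hprod a)
  obtain n where n: "Poly_Mapping.keys (a + c) \<subseteq> {..<n}" using ex_keys_bound[of 0 "a + c"] by blast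
  then have a: "Poly_Mapping.keys a \<subseteq> {..<n}" and c: "Poly_Mapping.keys c \<subseteq> {..<n}" by (auto simp: keys_add_nat)
  let ?c = "Poly_Mapping.map_key (block_swap n) c"
  have disj: "Poly_Mapping.keys ?c \<inter> Poly_Mapping.keys a = {}"
    using keys_block_swap[OF c] a by fastforce
  have "hall (groth_det b lam) (hprod a * hprod c) = mcoeff (dslash_det b r lam empty_partition) (?c + a)"
    by (simp add: hall_hprod_times_hprod[OF a c groth_det_Lambda_hat] dslash_det_empty_eq[OF assms(2)])
  also have "\<dots> = (\<Sum>mu | part_subset mu lam. mcoeff (dslash_det b r mu empty_partition) a * mcoeff (dslash_det b r lam mu) ?c)"
    by (rule coproduct[OF assms(2) disj])
  also have "\<dots> = (\<Sum>mu | part_subset mu lam. hall (groth_det b mu) (hprod a) * mcoeff (dslash_det b r lam mu) c)"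
  proof (rule sum.cong)
    fix mu assume "mu \<in> {mu. part_subset mu lam}"
    then have "plength mu \<le> r" using plength_mono[of mu lam] assms(2) by simp
    then show "mcoeff (dslash_det b r mu empty_partition) a * mcoeff (dslash_det b r lam mu) ?c
      = hall (groth_det b mu) (hprod a) * mcoeff (dslash_det b r lam mu) c"
      by (simp add: dslash_det_empty_eq hall_hprod groth_det_Lambda_hat symmetricD[OF symmetric_dslash_det bij_block_swap])
  qed simp
  finally show ?case .
next
  case (add f g)
  then show ?case
    by (simp add: distrib_right hall_add_right groth_det_Lambda_hat Lambda_times hprod_in_Lambda sum.distrib)
next
  case (scale k f)
  then show ?case
    by (simp add: mult.assoc hall_mconst_right groth_det_Lambda_hat Lambda_times hprod_in_Lambda sum_distrib_left)
qed

text \<open>For \<open>f = hprod a\<close> the values are coefficients of \<open>F\<close> at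
  distinct monomials in \<open>2 * N\<close> variables.\<close>

lemma finite_hall_times_hprod:
  assumes "f \<in> Lambda" "sympoly F"
  shows "finite {c. Poly_Mapping.keys c \<subseteq> {..<n} \<and> hall F (f * hprod c) \<noteq> 0}"
  using assms(1)
proof (induction f rule: Lambda_induct)
  case zero
  then show ?case by (simp add: hall_0_right sympoly_Lambda_hat[OF assms(2)])
next
  case (hprod a)
  obtain N where N: "N \<ge> n" "Poly_Mapping.keys a \<subseteq> {..<N}" using ex_keys_bound[of n a] by blast
  let ?h = "\<lambda>c. Poly_Mapping.map_key (block_swap N) c + a"
  let ?T = "{d. Poly_Mapping.keys d \<subseteq> {..<2 * N} \<and> mcoeff F d \<noteq> 0}"
  show ?case
  proof (rule inj_on_finite[of ?h _ ?T])
    have "c = c'" if "?h c = ?h c'" for c c'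
    proof -
      have "Poly_Mapping.map_key (block_swap N) c = Poly_Mapping.map_key (block_swap N) c'" using that by simp
      then show ?thesis using map_key_inverse(1)[OF bij_block_swap] by metis
    qed
    then show "inj_on ?h {c. Poly_Mapping.keys c \<subseteq> {..<n} \<and> hall F (hprod a * hprod c) \<noteq> 0}"
      by (intro inj_onI)
    show "?h ` {c. Poly_Mapping.keys c \<subseteq> {..<n} \<and> hall F (hprod a * hprod c) \<noteq> 0} \<subseteq> ?T"
    proof clarify
      fix c assume c: "Poly_Mapping.keys c \<subseteq> {..<n}" "hall F (hprod a * hprod c) \<noteq> 0"
      then have cN: "Poly_Mapping.keys c \<subseteq> {..<N}" using N(1) by auto
      have "Poly_Mapping.keys (?h c) \<subseteq> {..<2 * N}"
        unfolding keys_add_nat using keys_block_swap[OF cN] N(2) by fastforce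
      then show "Poly_Mapping.keys (?h c) \<subseteq> {..<2 * N} \<and> mcoeff F (?h c) \<noteq> 0"
        using c(2) hall_hprod_times_hprod[OF N(2) cN sympoly_Lambda_hat[OF assms(2)]] by simp
    qed
    show "finite ?T" using assms(2) by (simp add: sympoly_def)
  qed
next
  case (add f g)
  have "{c. Poly_Mapping.keys c \<subseteq> {..<n} \<and> hall F ((f + g) * hprod c) \<noteq> 0}
    \<subseteq> {c. Poly_Mapping.keys c \<subseteq> {..<n} \<and> hall F (f * hprod c) \<noteq> 0} \<union> {c. Poly_Mapping.keys c \<subseteq> {..<n} \<and> hall F (g * hprod c) \<noteq> 0}"
    using add.hyps by (auto simp: distrib_right hall_add_right sympoly_Lambda_hat[OF assms(2)] Lambda_times hprod_in_Lambda)
  then show ?case using add.IH finite_subset by blast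
next
  case (scale k f)
  have "{c. Poly_Mapping.keys c \<subseteq> {..<n} \<and> hall F (mconst k * f * hprod c) \<noteq> 0}
    \<subseteq> {c. Poly_Mapping.keys c \<subseteq> {..<n} \<and> hall F (f * hprod c) \<noteq> 0}"
    using scale.hyps by (auto simp: mult.assoc hall_mconst_right sympoly_Lambda_hat[OF assms(2)] Lambda_times hprod_in_Lambda)
  then show ?case using scale.IH finite_subset by blast
qed

lemma mcoeff_dslash_det_hall:
  assumes "part_subset mu lam" "plength lam \<le> r"
  shows "mcoeff (dslash_det beta r lam mu) c = hall (groth lam) (dual_groth mu * hprod c)"
proof -
  have "hall (groth lam) (dual_groth mu * hprod c)
    = (\<Sum>nu | part_subset nu lam. hall (groth nu) (dual_groth mu) * mcoeff (dslash_det beta r lam nu) c)"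
    using hall_groth_det_times_hprod[OF conjunct1[OF dual_groth] assms(2)] by (simp add: groth_eq)
  also have "\<dots> = (\<Sum>nu | part_subset nu lam. if nu = mu then mcoeff (dslash_det beta r lam nu) c else 0)"
    using dual_groth by (intro sum.cong) auto
  finally show ?thesis using assms(1) finite_part_subset[of lam] by simp
qed

text \<open>Not visible from the entries: one with exponent \<open>-2\<close> has infinitely many
  terms already in one variable. The coefficients are therefore read as Hall products with
  \<open>groth lam\<close>.\<close>

lemma sympoly_dslash_det:
  assumes "part_subset mu lam" "plength lam \<le> r"
  shows "sympoly (dslash_det beta r lam mu)"
  unfolding sympoly_def mcoeff_dslash_det_hall[OF assms]
  using finite_hall_times_hprod[OF conjunct1[OF dual_groth], of "groth lam"]
  by (simp add: symmetric_dslash_det groth_eq sympoly_groth_det)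

lemma groth_dslash_eq:
  assumes "part_subset mu lam" "plength lam \<le> r"
  shows "groth_dslash lam mu = dslash_det beta r lam mu"
  unfolding groth_dslash_def perp_def
proof (rule the_equality)
  let ?K = "dslash_det beta r lam mu"
  have K: "?K \<in> Lambda_hat" by (intro sympoly_Lambda_hat sympoly_dslash_det assms)
  have G: "groth lam \<in> Lambda_hat" by (simp add: groth_eq groth_det_Lambda_hat)
  have g: "dual_groth mu \<in> Lambda" using dual_groth by blast
  have "hall ?K h = hall (groth lam) (dual_groth mu * h)" if "h \<in> Lambda" for h
    using that
  proof (induction h rule: Lambda_induct)
    case zero
    then show ?case by (simp add: hall_0_right K G)
  next
    case (hprod c)
    then show ?case by (simp add: hall_hprod[OF K] mcoeff_dslash_det_hall[OF assms])
  next
    case (add f h)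
    then show ?case by (simp add: distrib_left hall_add_right K G Lambda_times g)
  next
    case (scale k f)
    then show ?case by (simp add: mult.left_commute[of _ "mconst k"] hall_mconst_right K G Lambda_times g)
  qed
  then show "?K \<in> Lambda_hat \<and> (\<forall>h\<in>Lambda. hall ?K h = hall (groth lam) (dual_groth mu * h))"
    using K by blast
  fix H assume H: "H \<in> Lambda_hat \<and> (\<forall>h\<in>Lambda. hall H h = hall (groth lam) (dual_groth mu * h))"
  show "H = ?K"
  proof (rule mfps_eqI)
    fix c
    have "mcoeff H c = hall H (hprod c)" using H by (simp add: hall_hprod)
    also have "\<dots> = mcoeff ?K c" using H hprod_in_Lambda by (simp add: mcoeff_dslash_det_hall[OF assms])
    finally show "mcoeff H c = mcoeff ?K c" .
  qed
qed

text \<open>This is \<open>u^(e+1) = u^e + (b/w) u^e\<close>, where division by \<open>w\<close>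
  raises the index.\<close>

lemma entry_pascal: "entry b m (e + 1) = entry b m e + mconst b * entry b (m + 1) e"
proof (rule mfps_eqI)
  fix a
  have *: "lfc b m (e + 1) k = b * lfc b (m + 1) e k + lfc b m e k" for k
    using lfc_pascal[of b "m + 1" e k] by simp
  have "lf b m (e + 1) p = lf b m e p + b * lf b (m + 1) e p" for p
    unfolding lf_def * by (simp add: sum_distrib_left sum.distrib algebra_simps)
  then show "mcoeff (entry b m (e + 1)) a = mcoeff (entry b m e + mconst b * entry b (m + 1) e) a"
    by (simp add: mcoeff_entry)
qed

section \<open>Rook strips and sets of corners\<close>

definition corners :: "partition \<Rightarrow> nat set" where
  "corners mu = {j. part mu (Suc j) < part mu j}"

definition remove_boxes :: "partition \<Rightarrow> nat set \<Rightarrow> partition" where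
  "remove_boxes mu S = Abs_partition (\<lambda>j. part mu j - (if j \<in> S then 1 else 0))"

lemma corners_bounded: "j \<in> corners mu \<Longrightarrow> j < plength mu"
  using part_eq_0_iff[of mu j] by (auto simp: corners_def not_le[symmetric])

lemma finite_corners: "finite (corners mu)"
  by (rule finite_subset[of _ "{..<plength mu}"]) (auto dest: corners_bounded)

lemma part_remove_boxes:
  assumes "S \<subseteq> corners mu"
  shows "part (remove_boxes mu S) j = part mu j - (if j \<in> S then 1 else 0)"
proof -
  let ?p = "\<lambda>j. part mu j - (if j \<in> S then 1 else 0)"
  have "?p (Suc j) \<le> ?p j" for j
  proof (cases "j \<in> S")
    case True
    then have "part mu (Suc j) < part mu j" using assms by (auto simp: corners_def)
    then show ?thesis using True by simp
  next
    case False
    then show ?thesis using part_antimono[of j "Suc j" mu] by simp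
  qed
  then have "antimono ?p" by (rule decseq_SucI)
  moreover have "{i. ?p i \<noteq> 0} \<subseteq> {..<plength mu}"
  proof
    fix i assume "i \<in> {i. ?p i \<noteq> 0}"
    then have "part mu i \<noteq> 0" by auto
    then show "i \<in> {..<plength mu}" by (simp add: part_eq_0_iff)
  qed
  then have "finite {i. ?p i \<noteq> 0}" by (rule finite_subset) simp
  ultimately have "?p \<in> {p. antimono p \<and> finite {i. p i \<noteq> 0}}" by blast
  from Abs_partition_inverse[OF this] show ?thesis by (simp only: remove_boxes_def)
qed

lemma skew_diagram_remove_boxes:
  assumes "S \<subseteq> corners mu"
  shows "skew_diagram mu (remove_boxes mu S) = (\<lambda>j. (j, part mu j - 1)) ` S"
proof -
  have "part mu j > 0" if "j \<in> S" for j using that assms by (auto simp: corners_def)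
  then show ?thesis
    unfolding skew_diagram_def part_remove_boxes[OF assms]
    by (auto simp: image_iff split: if_splits)
qed

lemma part_subset_remove_boxes: "S \<subseteq> corners mu \<Longrightarrow> part_subset (remove_boxes mu S) mu"
  by (simp add: part_subset_def part_remove_boxes)

lemma rook_strip_remove_boxes:
  assumes "S \<subseteq> corners mu"
  shows "rook_strip mu (remove_boxes mu S)"
proof -
  have pos: "part mu j > 0" if "j \<in> S" for j using that assms by (auto simp: corners_def)
  have lt: "part mu j' < part mu j" if "j \<in> S" "j < j'" for j j'
    using that assms part_antimono[of "Suc j" j' mu] by (fastforce simp: corners_def)
  have "j = j'" if j: "j \<in> S" "j' \<in> S" "part mu j - 1 = part mu j' - 1" for j j'
  proof (rule ccontr)
    assume "j \<noteq> j'"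
    then consider "j < j'" | "j' < j" by linarith
    then show False using lt[of j j'] lt[of j' j] j pos[of j] pos[of j'] by cases auto
  qed
  then show ?thesis
    unfolding rook_strip_def skew_diagram_remove_boxes[OF assms]
    using part_subset_remove_boxes[OF assms] by auto
qed

lemma card_skew_diagram_remove_boxes:
  "S \<subseteq> corners mu \<Longrightarrow> card (skew_diagram mu (remove_boxes mu S)) = card S"
  by (simp add: skew_diagram_remove_boxes card_image inj_on_def)

text \<open>A row loses at most one box. If it were not a corner, the next row would have the same
  length and would lose a box in the same column.\<close>

lemma rook_strip_cases:
  assumes "rook_strip mu sigma"
  defines "S \<equiv> {j. part sigma j < part mu j}"
  shows "S \<subseteq> corners mu" "remove_boxes mu S = sigma"
proof -
  have sub: "part sigma j \<le> part mu j" for j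
    using assms(1) by (simp add: rook_strip_def part_subset_def)
  have uniq: "p = q" if "p \<in> skew_diagram mu sigma" "q \<in> skew_diagram mu sigma" "fst p = fst q \<or> snd p = snd q" for p q
    using assms(1) that by (auto simp: rook_strip_def)
  have one: "part mu j = Suc (part sigma j)" if "j \<in> S" for j
  proof (rule ccontr)
    assume "part mu j \<noteq> Suc (part sigma j)"
    then have "Suc (part sigma j) < part mu j" using that by (simp add: S_def)
    then have "(j, part sigma j) = (j, Suc (part sigma j))"
      by (intro uniq) (auto simp: skew_diagram_def)
    then show False by simp
  qed
  show S: "S \<subseteq> corners mu"
  proof
    fix j assume j: "j \<in> S"
    show "j \<in> corners mu"
    proof (rule ccontr)
      assume "j \<notin> corners mu"
      then have eq: "part mu (Suc j) = part mu j"
        using part_antimono[of j "Suc j" mu] by (simp add: corners_def)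
      have "part sigma (Suc j) \<le> part sigma j" by (intro part_antimono) simp
      then have "(j, part sigma j) = (Suc j, part sigma j)"
        using one[OF j] eq by (intro uniq) (auto simp: skew_diagram_def)
      then show False by simp
    qed
  qed
  show "remove_boxes mu S = sigma"
  proof (rule partition_eqI)
    fix j show "part (remove_boxes mu S) j = part sigma j"
      unfolding part_remove_boxes[OF S] using one[of j] sub[of j] by (cases "j \<in> S") (auto simp: S_def)
  qed
qed

lemma sum_rook_strips:
  "(\<Sum>sigma | rook_strip mu sigma. f (card (skew_diagram mu sigma)) sigma)
    = (\<Sum>S\<in>Pow (corners mu). f (card S) (remove_boxes mu S))"
proof (rule sum.reindex_bij_witness[where i = "remove_boxes mu" and j = "\<lambda>sigma. {j. part sigma j < part mu j}"])
  fix sigma assume "sigma \<in> {sigma. rook_strip mu sigma}"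
  then have s: "rook_strip mu sigma" by simp
  show "remove_boxes mu {j. part sigma j < part mu j} = sigma" by (rule rook_strip_cases(2)[OF s])
  show "{j. part sigma j < part mu j} \<in> Pow (corners mu)" using rook_strip_cases(1)[OF s] by blast
  show "f (card {j. part sigma j < part mu j}) (remove_boxes mu {j. part sigma j < part mu j})
    = f (card (skew_diagram mu sigma)) sigma"
    using card_skew_diagram_remove_boxes[OF rook_strip_cases(1)[OF s]] by (simp add: rook_strip_cases(2)[OF s])
next
  fix S assume "S \<in> Pow (corners mu)"
  then have S: "S \<subseteq> corners mu" by blast
  then have "part mu j > 0" if "j \<in> S" for j using that by (auto simp: corners_def)
  then show "{j. part (remove_boxes mu S) j < part mu j} = S"
    by (auto simp: part_remove_boxes[OF S])
  show "remove_boxes mu S \<in> {sigma. rook_strip mu sigma}" using rook_strip_remove_boxes[OF S] by simp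
qed

text \<open>At a corner, \<open>k\<^sub>j = d\<^sub>j + \<beta> d'\<^sub>j\<close> with \<open>d'\<^sub>j\<close> the column of the partition without the corner box;
  elsewhere in the support of \<open>\<mu>\<close> this \<open>d'\<^sub>j\<close> equals \<open>k\<^sub>j\<^sub>+\<^sub>1\<close>, so the term is removed by a column operation.\<close>

lemma dslash_det_rook_strips:
  assumes "plength mu \<le> r"
  shows "dslash_det b r lam mu
    = (\<Sum>sigma | rook_strip mu sigma. mconst (b ^ card (skew_diagram mu sigma)) * jacobi_trudi b r (part lam) (part sigma))"
proof -
  define k where "k i j = entry b (content_shift lam mu i j) (dual_exponent mu i j)" for i j
  define d where "d i j = entry b (content_shift lam mu i j) (int i - int j - 1)" for i j
  define d' where "d' i j = entry b (content_shift lam mu i j + 1) (int i - int j - 1)" for i j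
  let ?C = "corners mu"
  define c where "c j = (if j \<notin> ?C \<and> part mu j > 0 then - mconst b else 0)" for j
  have k_pos: "k i j = d i j + mconst b * d' i j" if "part mu j > 0" for i j
    using entry_pascal[of b "content_shift lam mu i j" "int i - int j - 1"] that
    by (simp add: k_def d_def d'_def dual_exponent_def)
  have k_zero: "k i j = d i j" if "part mu j = 0" for i j
    using that by (simp add: k_def d_def dual_exponent_def)
  have k_next: "k i (Suc j) = d' i j" "Suc j < r" if "part mu j > 0" "j \<notin> ?C" for i j
  proof -
    have eq: "part mu (Suc j) = part mu j"
      using that(2) part_antimono[of j "Suc j" mu] by (simp add: corners_def)
    then show "Suc j < r" using that(1) part_eq_0_iff[of mu "Suc j"] assms by simp
    have 1: "content_shift lam mu i (Suc j) = content_shift lam mu i j + 1" using eq by (simp add: content_shift_def)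
    have 2: "dual_exponent mu i (Suc j) = int i - int j - 1" using eq that(1) by (simp add: dual_exponent_def)
    show "k i (Suc j) = d' i j" unfolding k_def d'_def 1 2 ..
  qed
  have col: "k i j + (if Suc j < r then c j * k i (Suc j) else 0) = d i j + (if j \<in> ?C then mconst b * d' i j else 0)" for i j
  proof -
    consider "j \<in> ?C" | "j \<notin> ?C" "part mu j > 0" | "j \<notin> ?C" "part mu j = 0" by blast
    then show ?thesis
    proof cases
      case 1
      then have "part mu j > 0" by (auto simp: corners_def)
      then show ?thesis using 1 k_pos[of j i] by (simp add: c_def)
    next
      case 2
      then show ?thesis using k_next[OF 2(2,1)] k_pos[of j i] by (simp add: c_def)
    next
      case 3
      then show ?thesis using k_zero[of j i] by (simp add: c_def)
    qed
  qed
  have CR: "?C \<subseteq> {..<r}" using corners_bounded assms by fastforce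
  have D: "fdet r (\<lambda>j. if j \<in> S then (\<lambda>i. d' i j) else (\<lambda>i. d i j)) = jacobi_trudi b r (part lam) (part (remove_boxes mu S))"
    if S: "S \<subseteq> ?C" for S
  proof -
    have pos: "part mu j > 0" if "j \<in> S" for j using that S by (auto simp: corners_def)
    have "(if j \<in> S then (\<lambda>i. d' i j) else (\<lambda>i. d i j)) i
      = entry b (int (part lam i) - int (part (remove_boxes mu S) j) - int i + int j) (int i - int j - 1)" for i j
    proof (cases "j \<in> S")
      case True
      then have "content_shift lam mu i j + 1 = int (part lam i) - int (part (remove_boxes mu S) j) - int i + int j"
        using pos[OF True] by (simp add: part_remove_boxes[OF S] content_shift_def of_nat_diff)
      then show ?thesis using True by (simp add: d'_def)
    next
      case False
      then show ?thesis by (simp add: d_def part_remove_boxes[OF S] content_shift_def)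
    qed
    then have "(\<lambda>j. if j \<in> S then (\<lambda>i. d' i j) else (\<lambda>i. d i j))
      = (\<lambda>j i. entry b (int (part lam i) - int (part (remove_boxes mu S) j) - int i + int j) (int i - int j - 1))"
      by (intro ext)
    then show ?thesis
      unfolding jacobi_trudi_def
      by (simp only: fdet_transpose[of r "\<lambda>i j. entry b (int (part lam i) - int (part (remove_boxes mu S) j) - int i + int j) (int i - int j - 1)"])
  qed
  have "dslash_det b r lam mu = fdet r k" by (simp add: dslash_det_def k_def[abs_def])
  also have "\<dots> = fdet r (\<lambda>i j. d i j + (if j \<in> ?C then mconst b * d' i j else 0))"
    unfolding fdet_add_next_col[of r k c, symmetric] col ..
  also have "\<dots> = fdet r (\<lambda>j i. d i j + (if j \<in> ?C then mconst b * d' i j else 0))"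
    by (rule fdet_transpose[symmetric])
  also have "\<dots> = (\<Sum>S\<in>Pow ?C. mconst b ^ card S * fdet r (\<lambda>j. if j \<in> S then (\<lambda>i. d' i j) else (\<lambda>i. d i j)))"
    by (rule fdet_row_expand[OF finite_corners CR])
  also have "\<dots> = (\<Sum>S\<in>Pow ?C. mconst (b ^ card S) * jacobi_trudi b r (part lam) (part (remove_boxes mu S)))"
    by (rule sum.cong) (simp_all only: Pow_iff D mconst.hom_power)
  also have "\<dots> = (\<Sum>sigma | rook_strip mu sigma. mconst (b ^ card (skew_diagram mu sigma)) * jacobi_trudi b r (part lam) (part sigma))"
    by (rule sum_rook_strips[symmetric, of "\<lambda>n sigma. mconst (b ^ n) * jacobi_trudi b r (part lam) (part sigma)"])
  finally show ?thesis .
qed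

lemma rook_strip_refl: "rook_strip mu mu" "card (skew_diagram mu mu) = 0"
proof -
  have "skew_diagram mu mu = {}" by (auto simp: skew_diagram_def)
  then show "rook_strip mu mu" "card (skew_diagram mu mu) = 0" by (simp_all add: rook_strip_def)
qed

lemma finite_rook_strips: "finite {sigma. rook_strip mu sigma}"
  by (rule finite_subset[OF _ finite_part_subset[of mu]]) (auto simp: rook_strip_def)

lemma rook_strip_sum_split:
  "(\<Sum>sigma | rook_strip mu sigma. mconst (b ^ card (skew_diagram mu sigma)) * H sigma)
    = H mu + (\<Sum>sigma\<in>{sigma. rook_strip mu sigma} - {mu}. mconst (b ^ card (skew_diagram mu sigma)) * H sigma)"
  using finite_rook_strips[of mu] rook_strip_refl[of mu] by (subst sum.remove[of _ mu]) auto

text \<open>The system is triangular in the size of \<open>mu\<close>: the term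
  \<open>sigma = mu\<close> has coefficient \<open>1\<close>, all others are smaller and still
  inside \<open>lam\<close>.\<close>

lemma rook_strip_sum_inverse:
  assumes "\<And>mu. part_subset mu lam \<Longrightarrow>
      (\<Sum>sigma | rook_strip mu sigma. mconst (b ^ card (skew_diagram mu sigma)) * H sigma)
      = (\<Sum>sigma | rook_strip mu sigma. mconst (b ^ card (skew_diagram mu sigma)) * H' sigma)"
    and "part_subset mu lam"
  shows "H mu = H' mu"
  using assms(2)
proof (induction "psize mu" arbitrary: mu rule: less_induct)
  case less
  have "H sigma = H' sigma" if "sigma \<in> {sigma. rook_strip mu sigma} - {mu}" for sigma
    using that less.prems psize_mono_strict[of sigma mu] part_subset_trans[of sigma mu lam]
    by (intro less.hyps) (auto simp: rook_strip_def)
  then have "(\<Sum>sigma\<in>{sigma. rook_strip mu sigma} - {mu}. mconst (b ^ card (skew_diagram mu sigma)) * H sigma)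
    = (\<Sum>sigma\<in>{sigma. rook_strip mu sigma} - {mu}. mconst (b ^ card (skew_diagram mu sigma)) * H' sigma)"
    by (intro sum.cong) simp_all
  then show ?case using assms(1)[OF less.prems] unfolding rook_strip_sum_split by simp
qed

lemma sympoly_diff:
  assumes "sympoly F" "sympoly G"
  shows "sympoly (F - G)"
proof -
  have "finite {a. Poly_Mapping.keys a \<subseteq> {..<n} \<and> mcoeff (F - G) a \<noteq> 0}" for n
  proof (rule finite_subset)
    show "{a. Poly_Mapping.keys a \<subseteq> {..<n} \<and> mcoeff (F - G) a \<noteq> 0}
      \<subseteq> {a. Poly_Mapping.keys a \<subseteq> {..<n} \<and> mcoeff F a \<noteq> 0} \<union> {a. Poly_Mapping.keys a \<subseteq> {..<n} \<and> mcoeff G a \<noteq> 0}"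
      by auto
  qed (use assms in \<open>simp add: sympoly_def\<close>)
  then show ?thesis using assms by (simp add: sympoly_def symmetric_diff)
qed

lemma sympoly_mconst_times: 
  assumes "sympoly F"
  shows "sympoly (mconst c * F)"
proof -
  have "finite {a. Poly_Mapping.keys a \<subseteq> {..<n} \<and> mcoeff (mconst c * F) a \<noteq> 0}" for n
    by (rule finite_subset[of _ "{a. Poly_Mapping.keys a \<subseteq> {..<n} \<and> mcoeff F a \<noteq> 0}"])
      (use assms in \<open>auto simp: sympoly_def\<close>)
  then show ?thesis using assms by (simp add: sympoly_def symmetric_times)
qed

lemma sympoly_sub_sum:
  assumes "sympoly G" "\<And>i. i \<in> I \<Longrightarrow> sympoly (F i)"
  shows "sympoly (G - (\<Sum>i\<in>I. F i))"
  using assms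
proof (induction I rule: infinite_finite_induct)
  case (insert i I)
  have "G - (\<Sum>i\<in>insert i I. F i) = (G - (\<Sum>i\<in>I. F i)) - F i"
    using insert.hyps by simp
  moreover have "sympoly (G - (\<Sum>i\<in>I. F i) - F i)"
    by (rule sympoly_diff) (use insert in auto)
  ultimately show ?case by (simp only:)
qed auto

text \<open>Solving the triangular system for its leading term expresses the determinant through
  \<open>dslash_det\<close> and smaller shapes, for which polynomiality is known.\<close>

lemma sympoly_jacobi_trudi:
  assumes "part_subset mu lam" "plength lam \<le> r"
  shows "sympoly (jacobi_trudi beta r (part lam) (part mu))"
  using assms(1)
proof (induction "psize mu" arbitrary: mu rule: less_induct)
  case less
  let ?D = "\<lambda>sigma. jacobi_trudi beta r (part lam) (part sigma)"
  have "plength mu \<le> r" using plength_mono[OF less.prems] assms(2) by simp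
  from dslash_det_rook_strips[OF this, of beta lam]
  have "?D mu = dslash_det beta r lam mu
    - (\<Sum>sigma\<in>{sigma. rook_strip mu sigma} - {mu}. mconst (beta ^ card (skew_diagram mu sigma)) * ?D sigma)"
    unfolding rook_strip_sum_split by simp
  moreover have *: "sympoly (mconst (beta ^ card (skew_diagram mu sigma)) * ?D sigma)"
    if "sigma \<in> {sigma. rook_strip mu sigma} - {mu}" for sigma
    using that less.prems psize_mono_strict[of sigma mu] part_subset_trans[of sigma mu lam]
    by (intro sympoly_mconst_times less.hyps) (auto simp: rook_strip_def)
  moreover have "sympoly (dslash_det beta r lam mu
    - (\<Sum>sigma\<in>{sigma. rook_strip mu sigma} - {mu}. mconst (beta ^ card (skew_diagram mu sigma)) * ?D sigma))"
    by (rule sympoly_sub_sum[OF sympoly_dslash_det[OF less.prems assms(2)]]) (rule *)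
  ultimately show ?case by (simp only:)
qed

lemma groth_dslash_rook_strips:
  assumes "part_subset mu lam" "plength lam \<le> r"
  shows "groth_dslash lam mu = (\<Sum>sigma | rook_strip mu sigma.
    mconst (beta ^ card (skew_diagram mu sigma)) * jacobi_trudi beta r (part lam) (part sigma))"
  unfolding groth_dslash_eq[OF assms]
  using plength_mono[OF assms(1)] assms(2) by (intro dslash_det_rook_strips) simp

theorem skew_groth_eq_jacobi_trudi:
  assumes "part_subset mu lam" "plength lam \<le> r"
  shows "skew_groth lam mu = jacobi_trudi beta r (part lam) (part mu)"
proof -
  let ?D = "\<lambda>lam. jacobi_trudi beta (plength lam) (part lam)"
  define H where "H lam mu = (if part_subset mu lam then ?D lam (part mu) else 0)" for lam mu
  let ?P = "\<lambda>H. \<forall>lam mu. if part_subset mu lam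
     then H lam mu \<in> Lambda_hat \<and> groth_dslash lam mu =
         (\<Sum>sigma\<in>{sigma. rook_strip mu sigma}. mconst (beta ^ card (skew_diagram mu sigma)) * H lam sigma)
     else H lam mu = 0"
  have "?P H"
  proof (intro allI)
    fix lam mu
    have "(\<Sum>sigma | rook_strip mu sigma. mconst (beta ^ card (skew_diagram mu sigma)) * H lam sigma)
      = (\<Sum>sigma | rook_strip mu sigma. mconst (beta ^ card (skew_diagram mu sigma)) * ?D lam (part sigma))"
      if "part_subset mu lam"
      by (rule sum.cong) (use that part_subset_trans in \<open>auto simp: H_def rook_strip_def\<close>)
    then show "if part_subset mu lam
     then H lam mu \<in> Lambda_hat \<and> groth_dslash lam mu =
         (\<Sum>sigma\<in>{sigma. rook_strip mu sigma}. mconst (beta ^ card (skew_diagram mu sigma)) * H lam sigma)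
     else H lam mu = 0"
      using groth_dslash_rook_strips[of mu lam "plength lam"] sympoly_jacobi_trudi[of mu lam "plength lam"]
      by (auto simp: H_def intro: sympoly_Lambda_hat)
  qed
  moreover have "H' = H" if "?P H'" for H'
  proof (intro ext)
    fix lam mu
    show "H' lam mu = H lam mu"
    proof (cases "part_subset mu lam")
      case True
      show ?thesis
      proof (rule rook_strip_sum_inverse[of lam beta, OF _ True])
        fix nu assume nu: "part_subset nu lam"
        show "(\<Sum>sigma | rook_strip nu sigma. mconst (beta ^ card (skew_diagram nu sigma)) * H' lam sigma)
          = (\<Sum>sigma | rook_strip nu sigma. mconst (beta ^ card (skew_diagram nu sigma)) * H lam sigma)"
          using that[rule_format, of nu lam] \<open>?P H\<close>[rule_format, of nu lam] nu by simp
      qed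
    next
      case False
      then show ?thesis using that[rule_format, of mu lam] by (simp add: H_def)
    qed
  qed
  ultimately have "skew_groth = H" unfolding skew_groth_def by (rule the_equality)
  then have "skew_groth lam mu = H lam mu" by (rule fun_cong[OF fun_cong])
  also have "\<dots> = ?D lam (part mu)" using assms(1) by (simp add: H_def)
  \<comment> \<open>Both sizes of determinant solve the same system, since
    \<open>groth_dslash\<close> does not involve \<open>r\<close>.\<close>
  also have "\<dots> = jacobi_trudi beta r (part lam) (part mu)"
  proof (rule rook_strip_sum_inverse[of lam beta, OF _ assms(1)])
    fix nu assume nu: "part_subset nu lam"
    show "(\<Sum>sigma | rook_strip nu sigma. mconst (beta ^ card (skew_diagram nu sigma)) * ?D lam (part sigma))
      = (\<Sum>sigma | rook_strip nu sigma. mconst (beta ^ card (skew_diagram nu sigma)) * jacobi_trudi beta r (part lam) (part sigma))"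
      using groth_dslash_rook_strips[OF nu order_refl] groth_dslash_rook_strips[OF nu assms(2)] by simp
  qed
  finally show ?thesis .
qed


section \<open>The entries of the determinant\<close>

lemma formal_lim_eqI:
  assumes "formal_tendsto f F"
  shows "formal_lim f = F"
  unfolding formal_lim_def
proof (rule the_equality[of _ F])
  fix F' assume F': "formal_tendsto f F'"
  show "F' = F"
  proof (rule mfps_eqI)
    fix a
    have "\<forall>\<^sub>F N in sequentially. mcoeff (f N) a = mcoeff F a \<and> mcoeff (f N) a = mcoeff F' a"
      using assms F' unfolding formal_tendsto_def by (intro eventually_conj) auto
    then have "\<exists>N. mcoeff (f N) a = mcoeff F a \<and> mcoeff (f N) a = mcoeff F' a"
      unfolding eventually_sequentially by blast
    then show "mcoeff F' a = mcoeff F a" by auto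
  qed
qed (rule assms)

lemma formal_tendstoI:
  "(\<And>a N. N0 a \<le> N \<Longrightarrow> mcoeff (f N) a = mcoeff F a) \<Longrightarrow> formal_tendsto f F"
  unfolding formal_tendsto_def eventually_sequentially by blast

text \<open>Chu-Vandermonde convolution, that is \<open>u^f u^e = u^(e+f)\<close>. Terms with
  \<open>n > k - m\<close> vanish, so the bound on \<open>N\<close> makes the sum complete.\<close>

lemma lfc_vandermonde:
  assumes "int k - m < int N"
  shows "(\<Sum>n<N. (of_int f gchoose n) * b ^ n * lfc b (m + int n) e k) = lfc b m (e + f) k"
proof (cases "m \<le> int k")
  case False
  then show ?thesis by (simp add: lfc_def)
next
  case True
  define d where "d = nat (int k - m)"
  have d: "int k - m = int d" using True by (simp add: d_def)
  have "(\<Sum>n<N. (of_int f gchoose n) * b ^ n * lfc b (m + int n) e k)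
    = (\<Sum>n\<in>{0..d}. (of_int f gchoose n) * b ^ n * lfc b (m + int n) e k)"
  proof (rule sum.mono_neutral_right)
    show "{0..d} \<subseteq> {..<N}" using assms d by auto
    show "\<forall>n\<in>{..<N} - {0..d}. (of_int f gchoose n) * b ^ n * lfc b (m + int n) e k = 0"
      using d by (auto intro!: lfc_zero_high)
  qed simp
  also have "\<dots> = (\<Sum>n\<in>{0..d}. b ^ d * ((of_int f gchoose n) * (of_int e gchoose (d - n))))"
  proof (rule sum.cong)
    fix n assume "n \<in> {0..d}"
    then have n: "n \<le> d" by simp
    have "nat (int k - (m + int n)) = d - n" "m + int n \<le> int k" using d n by linarith+
    then have "lfc b (m + int n) e k = (of_int e gchoose (d - n)) * b ^ (d - n)" by (simp add: lfc_def)
    moreover have "b ^ d = b ^ n * b ^ (d - n)" using n by (simp flip: power_add)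
    ultimately show "(of_int f gchoose n) * b ^ n * lfc b (m + int n) e k
      = b ^ d * ((of_int f gchoose n) * (of_int e gchoose (d - n)))" by (simp only: mult_ac)
  qed simp
  also have "\<dots> = b ^ d * (of_int f + of_int e gchoose d)"
    by (simp only: sum_distrib_left[symmetric] gbinomial_Vandermonde)
  finally show ?thesis using True by (simp add: lfc_def d_def mult.commute add.commute)
qed

lemma formal_suminf_entry:
  "formal_suminf (\<lambda>n. mconst ((of_int f gchoose n) * b ^ n) * entry b (m + int n) e) = entry b m (e + f)"
  unfolding formal_suminf_def
proof (rule formal_lim_eqI, rule formal_tendstoI)
  \<comment> \<open>The coefficient of \<open>A(w)\<close> at \<open>a\<close> is a polynomial in
    \<open>w\<close>; its degree bounds all \<open>k\<close>, and hence the terms that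
    contribute.\<close>
  fix a N assume N: "nat (int (degree (gen_poly b a)) - m + 1) \<le> N"
  let ?q = "gen_poly b a"
  have "mcoeff (\<Sum>n<N. mconst ((of_int f gchoose n) * b ^ n) * entry b (m + int n) e) a
    = (\<Sum>k\<le>degree ?q. coeff ?q k * (\<Sum>n<N. (of_int f gchoose n) * b ^ n * lfc b (m + int n) e k))"
  proof -
    have "mcoeff (\<Sum>n<N. mconst ((of_int f gchoose n) * b ^ n) * entry b (m + int n) e) a
      = (\<Sum>n<N. (of_int f gchoose n) * b ^ n * (\<Sum>k\<le>degree ?q. coeff ?q k * lfc b (m + int n) e k))"
      by (simp add: mcoeff_entry lf_def)
    also have "\<dots> = (\<Sum>n<N. \<Sum>k\<le>degree ?q. coeff ?q k * ((of_int f gchoose n) * b ^ n * lfc b (m + int n) e k))"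
      unfolding sum_distrib_left by (intro sum.cong refl) (simp only: mult_ac)
    also have "\<dots> = (\<Sum>k\<le>degree ?q. \<Sum>n<N. coeff ?q k * ((of_int f gchoose n) * b ^ n * lfc b (m + int n) e k))"
      by (rule sum.swap)
    finally show ?thesis by (simp only: sum_distrib_left)
  qed
  also have "\<dots> = (\<Sum>k\<le>degree ?q. coeff ?q k * lfc b m (e + f) k)"
  proof (rule sum.cong)
    fix k assume "k \<in> {..degree ?q}"
    then have "int k - m < int N" using N by auto
    then show "coeff ?q k * (\<Sum>n<N. (of_int f gchoose n) * b ^ n * lfc b (m + int n) e k)
      = coeff ?q k * lfc b m (e + f) k" by (simp only: lfc_vandermonde)
  qed simp
  finally show "mcoeff (\<Sum>n<N. mconst ((of_int f gchoose n) * b ^ n) * entry b (m + int n) e) a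
    = mcoeff (entry b m (e + f)) a" by (simp add: mcoeff_entry lf_def)
qed

section \<open>The functions \<open>groth_row\<close> as entries\<close>

definition coeff_mfps :: "nat \<Rightarrow> ratfun poly mfps \<Rightarrow> ratfun mfps" where
  "coeff_mfps a Y = Abs_mfps (\<lambda>c. coeff (mcoeff Y c) a)"

lemma mcoeff_coeff_mfps [simp]: "mcoeff (coeff_mfps a Y) c = coeff (mcoeff Y c) a"
  by (simp add: coeff_mfps_def)

text \<open>The identity \<open>gen_series_step\<close> read at the power \<open>w^a\<close>; the
  case distinction is the shift caused by \<open>w\<close>.\<close>

lemma coeff_mfps_step:
  "coeff_mfps a (mtrunc (Suc n) (gen_series b)) - mvar n * (case a of 0 \<Rightarrow> 0 | Suc a' \<Rightarrow> coeff_mfps a' (mtrunc (Suc n) (gen_series b)))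
    = (1 + mconst b * mvar n) * coeff_mfps a (mtrunc n (gen_series b))"
proof (rule mfps_eqI)
  fix c :: monom
  let ?Y = "mtrunc (Suc n) (gen_series b)" and ?Z = "mtrunc n (gen_series b)"
  let ?i = "Poly_Mapping.lookup c n = 0" and ?c = "c - Poly_Mapping.single n 1"
  have L: "mcoeff (?Y * (1 - mconst [:0, 1:] * mvar n)) c
    = mcoeff ?Y c - pCons 0 (if ?i then 0 else mcoeff ?Y ?c)"
    unfolding right_diff_distrib mult_1_right mcoeff_diff mult.commute[of ?Y]
      mult.assoc mcoeff_mconst_times mcoeff_mvar_times by simp
  have R: "mcoeff (?Z * (1 + mconst [:b:] * mvar n)) c
    = mcoeff ?Z c + smult b (if ?i then 0 else mcoeff ?Z ?c)"
    unfolding distrib_left mult_1_right mcoeff_add mult.commute[of ?Z]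
      mult.assoc mcoeff_mconst_times mcoeff_mvar_times by simp
  have "coeff (mcoeff ?Y c - pCons 0 (if ?i then 0 else mcoeff ?Y ?c)) a
    = coeff (mcoeff ?Z c + smult b (if ?i then 0 else mcoeff ?Z ?c)) a"
    unfolding L[symmetric] R[symmetric] gen_series_step ..
  moreover have "mcoeff ((1 + mconst b * mvar n) * coeff_mfps a ?Z) c
    = coeff (mcoeff ?Z c) a + b * (if ?i then 0 else coeff (mcoeff ?Z ?c) a)"
    unfolding distrib_right mult_1_left mcoeff_add mult.assoc mcoeff_mconst_times mcoeff_mvar_times by simp
  moreover have "mcoeff (coeff_mfps a ?Y - mvar n * (case a of 0 \<Rightarrow> 0 | Suc a' \<Rightarrow> coeff_mfps a' ?Y)) c
    = coeff (mcoeff ?Y c) a - (if ?i then 0 else case a of 0 \<Rightarrow> 0 | Suc a' \<Rightarrow> coeff (mcoeff ?Y ?c) a')"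
    unfolding mcoeff_diff mcoeff_mvar_times by (simp split: nat.split)
  ultimately show "mcoeff (coeff_mfps a ?Y - mvar n * (case a of 0 \<Rightarrow> 0 | Suc a' \<Rightarrow> coeff_mfps a' ?Y)) c
    = mcoeff ((1 + mconst b * mvar n) * coeff_mfps a ?Z) c"
    by (simp add: coeff_pCons split: nat.split_asm if_splits)
qed

lemma fps_geometric: "Abs_fps (\<lambda>k. x ^ k) * (1 - fps_const x * fps_X) = (1 :: 'a::comm_ring_1 fps)"
proof (rule fps_ext)
  fix k
  have "Abs_fps (\<lambda>k. x ^ k) * (1 - fps_const x * fps_X) = Abs_fps (\<lambda>k. x ^ k) - fps_const x * (fps_X * Abs_fps (\<lambda>k. x ^ k))"
    by (simp add: algebra_simps)
  then show "fps_nth (Abs_fps (\<lambda>k. x ^ k) * (1 - fps_const x * fps_X)) k = fps_nth 1 k"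
    by (cases k) simp_all
qed

lemma gen_product_partial:
  "(\<Prod>l<n. fps_const (1 + mconst b * mvar l) * Abs_fps (\<lambda>k. mvar l ^ k))
    = Abs_fps (\<lambda>a. coeff_mfps a (mtrunc n (gen_series b)))"
proof (induction n)
  case 0
  have "mtrunc 0 (gen_series b) = 1"
    by (rule mfps_eqI) (auto simp: mcoeff_mtrunc mcoeff_1)
  then show ?case
    by (intro fps_ext mfps_eqI) (auto simp: mcoeff_1)
next
  case (Suc n)
  let ?C = "\<lambda>n. Abs_fps (\<lambda>a. coeff_mfps a (mtrunc n (gen_series b)))"
  let ?g = "Abs_fps (\<lambda>k. mvar n ^ k :: ratfun mfps)"
  have *: "?C (Suc n) * (1 - fps_const (mvar n) * fps_X) = fps_const (1 + mconst b * mvar n) * ?C n"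
  proof (rule fps_ext)
    fix a
    have "?C (Suc n) * (1 - fps_const (mvar n) * fps_X) = ?C (Suc n) - fps_const (mvar n) * (fps_X * ?C (Suc n))"
      by (simp add: algebra_simps)
    then show "fps_nth (?C (Suc n) * (1 - fps_const (mvar n) * fps_X)) a = fps_nth (fps_const (1 + mconst b * mvar n) * ?C n) a"
      using coeff_mfps_step[of a n b] by (cases a) simp_all
  qed
  have "(\<Prod>l<Suc n. fps_const (1 + mconst b * mvar l) * Abs_fps (\<lambda>k. mvar l ^ k))
    = (fps_const (1 + mconst b * mvar n) * ?C n) * ?g"
    unfolding prod.lessThan_Suc Suc by (simp only: mult_ac)
  also have "\<dots> = ?C (Suc n) * (?g * (1 - fps_const (mvar n) * fps_X))"
    unfolding *[symmetric] by (simp only: mult_ac)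
  finally show ?case by (simp only: fps_geometric mult_1_right)
qed

lemma gen_product_coeff_eq: "gen_product_coeff a = coeff_mfps a (gen_series beta)"
  unfolding gen_product_coeff_def gen_product_partial
proof (rule formal_lim_eqI)
  show "formal_tendsto (\<lambda>N. fps_nth (Abs_fps (\<lambda>a. coeff_mfps a (mtrunc N (gen_series beta)))) a) (coeff_mfps a (gen_series beta))"
    unfolding formal_tendsto_def eventually_sequentially
  proof
    fix c :: monom
    obtain n where n: "Poly_Mapping.keys c \<subseteq> {..<n}" using ex_keys_bound[of 0 c] by blast
    have "mcoeff (coeff_mfps a (mtrunc N (gen_series beta))) c = mcoeff (coeff_mfps a (gen_series beta)) c" if "n \<le> N" for N
    proof -
      have "Poly_Mapping.keys c \<subseteq> {..<N}" using n that by auto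
      then show ?thesis by (simp add: mcoeff_mtrunc)
    qed
    then show "\<exists>N0. \<forall>N\<ge>N0. mcoeff (fps_nth (Abs_fps (\<lambda>a. coeff_mfps a (mtrunc N (gen_series beta)))) a) c
      = mcoeff (coeff_mfps a (gen_series beta)) c" by auto
  qed
qed

lemma entry_exponent_0: "entry b m 0 = (if 0 \<le> m then coeff_mfps (nat m) (gen_series b) else 0)"
proof (rule mfps_eqI)
  fix a
  let ?q = "gen_poly b a"
  have "lf b m 0 ?q = (\<Sum>k\<le>degree ?q. if int k = m then coeff ?q k else 0)"
    unfolding lf_def by (rule sum.cong) (auto simp: lfc_exponent_0)
  also have "\<dots> = (if 0 \<le> m then coeff ?q (nat m) else 0)"
  proof (cases "0 \<le> m")
    case True
    then have "(int k = m) = (k = nat m)" for k by auto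
    then show ?thesis using True by (simp add: coeff_eq_0)
  next
    case False
    then have "int k \<noteq> m" for k by auto
    then show ?thesis using False by simp
  qed
  finally show "mcoeff (entry b m 0) a = mcoeff (if 0 \<le> m then coeff_mfps (nat m) (gen_series b) else 0) a"
    by (simp add: mcoeff_entry)
qed

lemma gbinomial_minus_1: "(of_int (- 1) gchoose n :: ratfun) * b ^ n = (- b) ^ n"
proof -
  have "(of_int (- 1) gchoose n :: ratfun) = (- 1) ^ n"
    using gbinomial_minus[of "1 :: ratfun" n] binomial_gbinomial[of n n, where ?'a = ratfun] by simp
  then show ?thesis by (simp add: power_minus[of b])
qed

text \<open>The factor \<open>1 / (1 + \<beta>/z)\<close> is the binomial series of exponent
  \<open>-1\<close>, so this is \<open>formal_suminf_entry\<close> at \<open>f = -1\<close>,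
  \<open>e = 0\<close>.\<close>

lemma groth_row_eq: "groth_row m = entry beta m (- 1)"
proof -
  have "groth_row m = formal_suminf (\<lambda>n. mconst ((of_int (- 1) gchoose n) * beta ^ n) * entry beta (m + int n) 0)"
    unfolding groth_row_def gen_product_coeff_eq gbinomial_minus_1
    by (rule arg_cong[of _ _ formal_suminf]) (auto simp: entry_exponent_0 fun_eq_iff)
  then show ?thesis using formal_suminf_entry[of "- 1" beta m 0] by simp
qed

theorem proposition4p4:
  fixes lam mu :: partition and r :: nat
  assumes "part_subset mu lam"
    and "1 \<le> r"
    and "plength lam \<le> r"
  shows "skew_groth lam mu =
    det (mat r r (\<lambda>(i, j). formal_suminf (\<lambda>n.
      mconst ((of_int (int i - int j) gchoose n) * beta ^ n) *
        groth_row (int (part lam i) - int (part mu j) - int i + int j + int n))))"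
proof -
  \<comment> \<open>The binomials contribute the exponent \<open>i - j\<close>, and
    \<open>groth_row\<close> contributes \<open>-1\<close>.\<close>
  have "formal_suminf (\<lambda>n. mconst ((of_int (int i - int j) gchoose n) * beta ^ n) * groth_row (m + int n))
    = entry beta m (int i - int j - 1)" for i j m
    unfolding groth_row_eq formal_suminf_entry by (rule arg_cong[of _ _ "entry beta m"]) simp
  then show ?thesis
    unfolding skew_groth_eq_jacobi_trudi[OF assms(1,3)] jacobi_trudi_def fdet_def by (simp only:)
qed


end
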